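(* Let $V^{\mathrm{ir}}_{2,4}=\mathrm{SO}(3)\times\mathrm{SO}(3)/\mathrm{SO}(2)_{\mathrm{ir}}$ be the twisted Stiefel manifold with the metrics $g_{\alpha\beta\gamma}$, $\alpha,\beta,\gamma>0$. (1) In the orthonormal basis $e_1,\dots,e_5$ of $\mathfrak m$, the Riemannian Ricci tensor of $g_{\alpha\beta\gamma}$ is diagonal and given by $$\mathrm{Ric}(e_1,e_1)=\frac{2\alpha}{25\beta^2}+\frac{\alpha}{50\gamma^2},\quad \mathrm{Ric}(e_2,e_2)=\mathrm{Ric}(e_3,e_3)=\frac1\beta-\frac{2\alpha}{25\beta^2},\quad \mathrm{Ric}(e_4,e_4)=\mathrm{Ric}(e_5,e_5)=\frac1\gamma-\frac{\alpha}{50\gamma^2}.$$ (2) The metric $g_{\alpha\beta\gamma}$ is Einstein (but not naturally reductive) for $\alpha=1$ and $$\beta=\frac{18}{25\,(10^{2/3}-2\cdot10^{1/3}+4)}\approx0.166177,\qquad \gamma=\frac{3\left(9+\sqrt{21+12\cdot10^{1/3}+3\cdot10^{2/3}}\right)}{25\,(20-4\cdot10^{1/3}-10^{2/3})}\approx0.299009 .$$ Its Riemannian scalar curvature is $\mathrm{Scal}^g=\left[\frac53\right]^3\left(10-2\cdot10^{1/3}-\frac{10^{2/3}}{2}\right)\approx15.60340835$. (3) The Riemannian holonomy of $(V^{\mathrm{ir}}_{2,4},g_{\alpha\beta\gamma})$ is $\mathrm{SO}(5)$, i.e. maximal.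
   Context: Let $E_{ij}$ be the endomorphism sending the basis vector $e_i$ to $e_j$, $e_j$ to $-e_i$ and all others to zero. Let $G=\mathrm{SO}(3)\times\mathrm{SO}(3)$ and let $H=\mathrm{SO}(2)_{\mathrm{ir}}$ be the image of $\mathrm{SO}(2)\ni A\mapsto(A,A^2)\in G$, where $\mathrm{SO}(2)\subset\mathrm{SO}(3)$ is the subgroup $\exp(\mathbb{R}s_3)$. With $s_1=E_{23}$, $s_2=E_{31}$, $s_3=E_{12}$ in $\mathfrak{so}(3)$, put $a_i=(s_i,0)$, $b_i=(0,s_i)$. The Lie algebra of $H$ is $\mathfrak h=\mathbb{R}\tilde e_0$, $\tilde e_0=a_3+2b_3$. Put $\tilde e_1=b_3-2a_3$, $\tilde e_2=a_1$, $\tilde e_3=a_2$, $\tilde e_4=b_1$, $\tilde e_5=b_2$, and let $\mathfrak m=\mathrm{span}(\tilde e_1,\dots,\tilde e_5)$, a reductive complement of $\mathfrak h$ in $\mathfrak g$. The $G$-invariant metric $g_{\alpha\beta\gamma}$ on $V^{\mathrm{ir}}_{2,4}=G/H$ is given on $\mathfrak m$ by $\mathrm{diag}(\alpha,\beta,\beta,\gamma,\gamma)$ in the basis $\tilde e_1,\dots,\tilde e_5$, and $e_1=\tilde e_1/\sqrt\alpha$, $e_2=\tilde e_2/\sqrt\beta$, $e_3=\tilde e_3/\sqrt\beta$, $e_4=\tilde e_4/\sqrt\gamma$, $e_5=\tilde e_5/\sqrt\gamma$ is the corresponding orthonormal basis of $\mathfrak m\cong T_{eH}V^{\mathrm{ir}}_{2,4}$.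 Naturally reductive means with respect to the decomposition $\mathfrak g=\mathfrak h\oplus\mathfrak m$, i.e. $g([X,Y]_{\mathfrak m},Z)$ is skew-symmetric in $X,Y,Z\in\mathfrak m$. *)

theory Defs
  imports "HOL-Analysis.Analysis"
begin

text \<open>
  The Riemannian geometry of \<open>V = G/H\<close> is set up through the principal bundle \<open>G \<rightarrow> G/H\<close>.
  The class \<open>[g,v]\<close>, with \<open>g \<in> G\<close> and \<open>v \<in> \<mm>\<close>, denotes the tangent vector
  \<open>d/dt (g exp(t v) H)\<close> at \<open>t = 0\<close> of \<open>G/H\<close> at \<open>gH\<close>, so that \<open>[g h, Ad(h\<^sup>-\<^sup>1) v] = [g, v]\<close>
  for \<open>h \<in> H\<close>. Accordingly functions on \<open>G/H\<close> are right \<open>H\<close>-invariant functions on \<open>G\<close>, and vector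
  fields on \<open>G/H\<close> are \<open>H\<close>-equivariant functions from \<open>G\<close> to \<open>\<mm>\<close>.
\<close>

subsection \<open>The group \<open>G = SO(3) \<times> SO(3)\<close>, the subgroup \<open>H\<close> and the complement \<open>\<mm>\<close>\<close>

type_synonym mpair = "(real^3^3) \<times> (real^3^3)"

definition mp_mult :: "mpair \<Rightarrow> mpair \<Rightarrow> mpair"  (infixl "\<bullet>\<^sub>G" 70)
  where "x \<bullet>\<^sub>G y = (fst x ** fst y, snd x ** snd y)"

definition mp_one :: mpair  ("1\<^sub>G")
  where "1\<^sub>G = (mat 1, mat 1)"

definition mp_inv :: "mpair \<Rightarrow> mpair"
  where "mp_inv x = (matrix_inv (fst x), matrix_inv (snd x))"

definition bracket :: "mpair \<Rightarrow> mpair \<Rightarrow> mpair"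
  where "bracket X Y = X \<bullet>\<^sub>G Y - Y \<bullet>\<^sub>G X"

definition Ad :: "mpair \<Rightarrow> mpair \<Rightarrow> mpair"
  where "Ad g X = g \<bullet>\<^sub>G X \<bullet>\<^sub>G mp_inv g"

definition G_grp :: "mpair set"
  where "G_grp = {A. rotation_matrix A} \<times> {B. rotation_matrix B}"

definition G_alg :: "mpair set"
  where "G_alg = {A. transpose A = - A} \<times> {B. transpose B = - B}"

definition E_mat :: "3 \<Rightarrow> 3 \<Rightarrow> real^3^3"
  where "E_mat i j = (\<chi> r c. if r = j \<and> c = i then 1 else if r = i \<and> c = j then - 1 else 0)"

definition s_mat :: "3 \<Rightarrow> real^3^3"
  where "s_mat i = (if i = 1 then E_mat 2 3 else if i = 2 then E_mat 3 1 else E_mat 1 2)"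

definition a_vec :: "3 \<Rightarrow> mpair" where "a_vec i = (s_mat i, 0)"
definition b_vec :: "3 \<Rightarrow> mpair" where "b_vec i = (0, s_mat i)"

definition mat_exp :: "real^3^3 \<Rightarrow> real^3^3"
  where "mat_exp A = (\<Sum>n. (1 / fact n) *\<^sub>R (((**) A ^^ n) (mat 1)))"

definition SO2 :: "(real^3^3) set"
  where "SO2 = range (\<lambda>t::real. mat_exp (t *\<^sub>R s_mat 3))"

definition H_grp :: "mpair set"
  where "H_grp = (\<lambda>A. (A, A ** A)) ` SO2"

definition e_tilde0 :: mpair
  where "e_tilde0 = a_vec 3 + 2 *\<^sub>R b_vec 3"

text \<open>The type \<open>5\<close> has the elements \<open>1, 2, 3, 4, 5\<close>, where \<open>5 = 0\<close>.\<close>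

definition e_tilde :: "5 \<Rightarrow> mpair"
  where "e_tilde i =
    (if i = 1 then b_vec 3 - 2 *\<^sub>R a_vec 3
     else if i = 2 then a_vec 1
     else if i = 3 then a_vec 2
     else if i = 4 then b_vec 1
     else b_vec 2)"

definition H_alg :: "mpair set" where "H_alg = span {e_tilde0}"
definition m_sp :: "mpair set" where "m_sp = span (range e_tilde)"

definition m_part :: "mpair \<Rightarrow> mpair"
  where "m_part X = (THE Y. Y \<in> m_sp \<and> X - Y \<in> H_alg)"

subsection \<open>The metrics\<close>

definition metric_diag :: "real \<Rightarrow> real \<Rightarrow> real \<Rightarrow> 5 \<Rightarrow> real"
  where "metric_diag \<alpha> \<beta> \<gamma> i = (if i = 1 then \<alpha> else if i = 2 \<or> i = 3 then \<beta> else \<gamma>)"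

definition metric :: "real \<Rightarrow> real \<Rightarrow> real \<Rightarrow> mpair \<Rightarrow> mpair \<Rightarrow> real"
  where "metric \<alpha> \<beta> \<gamma> X Y =
    (\<Sum>i\<in>UNIV. metric_diag \<alpha> \<beta> \<gamma> i *
       representation (range e_tilde) X (e_tilde i) * representation (range e_tilde) Y (e_tilde i))"

definition e_orth :: "real \<Rightarrow> real \<Rightarrow> real \<Rightarrow> 5 \<Rightarrow> mpair"
  where "e_orth \<alpha> \<beta> \<gamma> i = (1 / sqrt (metric_diag \<alpha> \<beta> \<gamma> i)) *\<^sub>R e_tilde i"

definition naturally_reductive :: "real \<Rightarrow> real \<Rightarrow> real \<Rightarrow> bool"
  where "naturally_reductive \<alpha> \<beta> \<gamma> \<longleftrightarrow>
    (let T = (\<lambda>X Y Z. metric \<alpha> \<beta> \<gamma> (m_part (bracket X Y)) Z)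
     in \<forall>X\<in>m_sp. \<forall>Y\<in>m_sp. \<forall>Z\<in>m_sp. T X Y Z = - T Y X Z \<and> T X Y Z = - T X Z Y)"

subsection \<open>Smooth functions and vector fields on \<open>G/H\<close>\<close>

text \<open>The derivative at \<open>g \<in> G\<close> in the direction of the tangent vector \<open>g X\<close> to \<open>G\<close>, \<open>X \<in> \<gg>\<close>. A
  derivative within \<open>G\<close> is not unique as a map on all pairs of matrices, but its values on vectors
  tangent to \<open>G\<close> are.\<close>

definition dir_deriv :: "(mpair \<Rightarrow> 'b::real_normed_vector) \<Rightarrow> mpair \<Rightarrow> mpair \<Rightarrow> 'b"
  where "dir_deriv f g X = frechet_derivative f (at g within G_grp) (g \<bullet>\<^sub>G X)"

text \<open>A function on \<open>G\<close> is smooth if all its iterated derivatives along left-invariant vector fields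
  exist and are differentiable.\<close>

coinductive smooth_G :: "(mpair \<Rightarrow> 'b::real_normed_vector) \<Rightarrow> bool"
  where "\<lbrakk>\<forall>g\<in>G_grp. f differentiable (at g within G_grp);
          \<forall>X\<in>G_alg. smooth_G (\<lambda>g. dir_deriv f g X)\<rbrakk> \<Longrightarrow> smooth_G f"

definition V_funs :: "(mpair \<Rightarrow> real) set"
  where "V_funs = {f. smooth_G f \<and> (\<forall>g\<in>G_grp. \<forall>h\<in>H_grp. f (g \<bullet>\<^sub>G h) = f g)}"

definition V_fields :: "(mpair \<Rightarrow> mpair) set"
  where "V_fields = {Y. smooth_G Y \<and> (\<forall>g\<in>G_grp. Y g \<in> m_sp) \<and>
    (\<forall>g\<in>G_grp. \<forall>h\<in>H_grp. Y (g \<bullet>\<^sub>G h) = Ad (mp_inv h) (Y g))}"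

text \<open>The Lie bracket of two vector fields on \<open>G/H\<close>, as the commutator of derivations of the smooth
  functions on \<open>G/H\<close>.\<close>

definition V_bracket :: "(mpair \<Rightarrow> mpair) \<Rightarrow> (mpair \<Rightarrow> mpair) \<Rightarrow> mpair \<Rightarrow> mpair"
  where "V_bracket X Y g = (THE z. z \<in> m_sp \<and>
    (\<forall>f\<in>V_funs. dir_deriv f g z =
       dir_deriv (\<lambda>a. dir_deriv f a (Y a)) g (X g) - dir_deriv (\<lambda>a. dir_deriv f a (X a)) g (Y g)))"

subsection \<open>The Levi-Civita connection and its curvature\<close>

text \<open>For a connection \<open>D\<close> on the tangent bundle of \<open>G/H\<close>, the covariant derivative of the vector
  field \<open>Y\<close> in the direction of the tangent vector \<open>[g,v]\<close> is \<open>[g, D g v Y]\<close>.\<close>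

type_synonym connection = "mpair \<Rightarrow> mpair \<Rightarrow> (mpair \<Rightarrow> mpair) \<Rightarrow> mpair"

definition affine_connection :: "connection \<Rightarrow> bool"
  where "affine_connection D \<longleftrightarrow>
    (\<forall>X\<in>V_fields. \<forall>Y\<in>V_fields. (\<lambda>g. D g (X g) Y) \<in> V_fields) \<and>
    (\<forall>g\<in>G_grp. \<forall>v\<in>m_sp. \<forall>w\<in>m_sp. \<forall>Y\<in>V_fields. \<forall>r s::real.
       D g (r *\<^sub>R v + s *\<^sub>R w) Y = r *\<^sub>R D g v Y + s *\<^sub>R D g w Y) \<and>
    (\<forall>g\<in>G_grp. \<forall>v\<in>m_sp. \<forall>Y\<in>V_fields. \<forall>Z\<in>V_fields.
       D g v (\<lambda>a. Y a + Z a) = D g v Y + D g v Z) \<and>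
    (\<forall>g\<in>G_grp. \<forall>v\<in>m_sp. \<forall>Y\<in>V_fields. \<forall>f\<in>V_funs.
       D g v (\<lambda>a. f a *\<^sub>R Y a) = dir_deriv f g v *\<^sub>R Y g + f g *\<^sub>R D g v Y)"

definition metric_compatible :: "real \<Rightarrow> real \<Rightarrow> real \<Rightarrow> connection \<Rightarrow> bool"
  where "metric_compatible \<alpha> \<beta> \<gamma> D \<longleftrightarrow>
    (\<forall>g\<in>G_grp. \<forall>v\<in>m_sp. \<forall>Y\<in>V_fields. \<forall>Z\<in>V_fields.
       dir_deriv (\<lambda>a. metric \<alpha> \<beta> \<gamma> (Y a) (Z a)) g v =
       metric \<alpha> \<beta> \<gamma> (D g v Y) (Z g) + metric \<alpha> \<beta> \<gamma> (Y g) (D g v Z))"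

definition torsion_free :: "connection \<Rightarrow> bool"
  where "torsion_free D \<longleftrightarrow>
    (\<forall>g\<in>G_grp. \<forall>X\<in>V_fields. \<forall>Y\<in>V_fields. D g (X g) Y - D g (Y g) X = V_bracket X Y g)"

text \<open>Such a connection exists and is unique, up to its irrelevant values at points outside \<open>G\<close>,
  vectors outside \<open>\<mm>\<close> and functions that are not vector fields.\<close>

definition levi_civita :: "real \<Rightarrow> real \<Rightarrow> real \<Rightarrow> connection"
  where "levi_civita \<alpha> \<beta> \<gamma> =
    (SOME D. affine_connection D \<and> metric_compatible \<alpha> \<beta> \<gamma> D \<and> torsion_free D)"

definition curvature_fields ::
    "connection \<Rightarrow> (mpair \<Rightarrow> mpair) \<Rightarrow> (mpair \<Rightarrow> mpair) \<Rightarrow> (mpair \<Rightarrow> mpair) \<Rightarrow> mpair \<Rightarrow> mpair"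
  where "curvature_fields D X Y Z g =
    D g (X g) (\<lambda>a. D a (Y a) Z) - D g (Y g) (\<lambda>a. D a (X a) Z) - D g (V_bracket X Y g) Z"

text \<open>Some extension of the tangent vector \<open>[g,v]\<close> to a vector field; the curvature tensor does not
  depend on the choice.\<close>

definition extend_vec :: "mpair \<Rightarrow> mpair \<Rightarrow> mpair \<Rightarrow> mpair"
  where "extend_vec g v = (SOME X. X \<in> V_fields \<and> X g = v)"

definition curvature :: "connection \<Rightarrow> mpair \<Rightarrow> mpair \<Rightarrow> mpair \<Rightarrow> mpair \<Rightarrow> mpair"
  where "curvature D g u v w =
    curvature_fields D (extend_vec g u) (extend_vec g v) (extend_vec g w) g"

text \<open>The Ricci tensor \<open>Ric(y,z) = tr(u \<mapsto> R(u,y)z)\<close> at the point \<open>gH\<close>.\<close>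

definition Ric :: "real \<Rightarrow> real \<Rightarrow> real \<Rightarrow> mpair \<Rightarrow> mpair \<Rightarrow> mpair \<Rightarrow> real"
  where "Ric \<alpha> \<beta> \<gamma> g y z =
    (\<Sum>i\<in>UNIV. metric \<alpha> \<beta> \<gamma>
       (curvature (levi_civita \<alpha> \<beta> \<gamma>) g (e_orth \<alpha> \<beta> \<gamma> i) y z) (e_orth \<alpha> \<beta> \<gamma> i))"

definition Scal :: "real \<Rightarrow> real \<Rightarrow> real \<Rightarrow> mpair \<Rightarrow> real"
  where "Scal \<alpha> \<beta> \<gamma> g = (\<Sum>i\<in>UNIV. Ric \<alpha> \<beta> \<gamma> g (e_orth \<alpha> \<beta> \<gamma> i) (e_orth \<alpha> \<beta> \<gamma> i))"

definition Einstein :: "real \<Rightarrow> real \<Rightarrow> real \<Rightarrow> bool"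
  where "Einstein \<alpha> \<beta> \<gamma> \<longleftrightarrow>
    (\<exists>k::real. \<forall>g\<in>G_grp. \<forall>y\<in>m_sp. \<forall>z\<in>m_sp. Ric \<alpha> \<beta> \<gamma> g y z = k * metric \<alpha> \<beta> \<gamma> y z)"

subsection \<open>Parallel transport and holonomy\<close>

definition C1_on :: "real \<Rightarrow> real \<Rightarrow> (real \<Rightarrow> 'b::real_normed_vector) \<Rightarrow> bool"
  where "C1_on a b f \<longleftrightarrow>
    (\<exists>f'. continuous_on {a..b} f' \<and>
          (\<forall>t\<in>{a..b}. (f has_vector_derivative f' t) (at t within {a..b})))"

text \<open>For a curve \<open>c\<close> in \<open>G\<close>, a vector field along the projected curve \<open>c(t) H\<close> is given by a curve
  \<open>v\<close> in \<open>\<mm>\<close> as \<open>[c t, v t]\<close>, and the velocity of \<open>c(t) H\<close> is \<open>[c t, (c(t)\<^sup>-\<^sup>1 c'(t))\<^sub>\<mm>]\<close>.\<close>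

definition velocity :: "real \<Rightarrow> real \<Rightarrow> (real \<Rightarrow> mpair) \<Rightarrow> real \<Rightarrow> mpair"
  where "velocity a b c t =
    m_part (mp_inv (c t) \<bullet>\<^sub>G vector_derivative c (at t within {a..b}))"

text \<open>A vector field along a curve is written as a combination, with coefficients \<open>\<phi> j\<close>, of vector
  fields \<open>E j\<close> on \<open>G/H\<close> restricted to the curve; its covariant derivative along the curve is
  then the sum over \<open>j\<close> of \<open>\<phi>\<^sub>j' E\<^sub>j\<close> plus \<open>\<phi>\<^sub>j\<close> times the derivative of \<open>E\<^sub>j\<close> in the
  direction of the velocity.\<close>

definition parallel_on :: "connection \<Rightarrow> real \<Rightarrow> real \<Rightarrow> (real \<Rightarrow> mpair) \<Rightarrow> (real \<Rightarrow> mpair) \<Rightarrow> bool"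
  where "parallel_on D a b c v \<longleftrightarrow>
    (\<exists>(n::nat) (E :: nat \<Rightarrow> mpair \<Rightarrow> mpair) (\<phi> :: nat \<Rightarrow> real \<Rightarrow> real) (\<phi>' :: nat \<Rightarrow> real \<Rightarrow> real).
       (\<forall>j<n. E j \<in> V_fields) \<and>
       (\<forall>j<n. \<forall>t\<in>{a..b}. (\<phi> j has_real_derivative \<phi>' j t) (at t within {a..b})) \<and>
       (\<forall>t\<in>{a..b}. v t = (\<Sum>j<n. \<phi> j t *\<^sub>R E j (c t))) \<and>
       (\<forall>t\<in>{a..b}.
          (\<Sum>j<n. \<phi>' j t *\<^sub>R E j (c t) + \<phi> j t *\<^sub>R D (c t) (velocity a b c t) (E j)) = 0))"

definition partition01 :: "nat \<Rightarrow> (nat \<Rightarrow> real) \<Rightarrow> bool"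
  where "partition01 n p \<longleftrightarrow> p 0 = 0 \<and> p n = 1 \<and> (\<forall>k<n. p k < p (Suc k))"

text \<open>Lifts to \<open>G\<close>, starting at the identity, of the piecewise \<open>C\<^sup>1\<close> loops in \<open>G/H\<close> at \<open>eH\<close>.\<close>

definition lifted_loops :: "(real \<Rightarrow> mpair) set"
  where "lifted_loops = {c. c ` {0..1} \<subseteq> G_grp \<and> c 0 = 1\<^sub>G \<and> c 1 \<in> H_grp \<and>
    (\<exists>n p. partition01 n p \<and> (\<forall>k<n. C1_on (p k) (p (Suc k)) c))}"

definition parallel_along :: "connection \<Rightarrow> (real \<Rightarrow> mpair) \<Rightarrow> (real \<Rightarrow> mpair) \<Rightarrow> bool"
  where "parallel_along D c v \<longleftrightarrow>
    (\<exists>n p. partition01 n p \<and>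
       (\<forall>k<n. C1_on (p k) (p (Suc k)) c \<and> parallel_on D (p k) (p (Suc k)) c v))"

text \<open>The holonomy group at \<open>eH\<close>, as matrices with respect to the orthonormal basis \<open>e\<^sub>1,\<dots>,e\<^sub>5\<close>. The
  vector \<open>[c 1, v 1]\<close> at the end of a lifted loop equals \<open>[e, Ad (c 1) (v 1)]\<close>, since \<open>c 1 \<in> H\<close>.\<close>

definition holonomy :: "real \<Rightarrow> real \<Rightarrow> real \<Rightarrow> (real^5^5) set"
  where "holonomy \<alpha> \<beta> \<gamma> = {A. \<exists>c\<in>lifted_loops. \<forall>j. \<exists>v.
     parallel_along (levi_civita \<alpha> \<beta> \<gamma>) c v \<and> v 0 = e_orth \<alpha> \<beta> \<gamma> j \<and>
     (\<forall>i. A $ i $ j = metric \<alpha> \<beta> \<gamma> (Ad (c 1) (v 1)) (e_orth \<alpha> \<beta> \<gamma> i))}"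

end

theory Submission
  imports Defs
begin

text \<open>
  A vector field on \<open>G/H\<close> is an \<open>H\<close>-equivariant map \<open>Y: G \<rightarrow> \<mm>\<close>, and the Levi-Civita connection is
  \<open>D\<^sub>v Y = dY(g v) + \<Lambda>(v) Y\<close> with the Nomizu map \<open>\<Lambda>\<close>, which is skew-symmetric and satisfies
  \<open>\<Lambda>(v) w - \<Lambda>(w) v = [v,w]\<^sub>\<mm>\<close>. Since left-invariant derivatives satisfy \<open>L\<^sub>X L\<^sub>Y - L\<^sub>Y L\<^sub>X = L\<^sub>[\<^sub>X\<^sub>,\<^sub>Y\<^sub>]\<close>
  and \<open>L\<^sub>Z Y = - [Z,Y]\<close> for \<open>Z \<in> \<hh>\<close>, the curvature is
  \<open>R(u,v) = [\<Lambda>(u),\<Lambda>(v)] - \<Lambda>([u,v]\<^sub>\<mm>) - ad [u,v]\<^sub>\<hh>\<close>, whose trace is the Ricci tensor. With \<open>c = 10\<^sup>1\<^sup>/\<^sup>3\<close>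
  the Einstein metric has \<open>\<beta> = (c + 2) / 25\<close> and \<open>\<gamma> = (c + 2)\<^sup>2 / (50 (c - 1))\<close>, and the Einstein
  equations reduce to \<open>c\<^sup>3 = 10\<close>.

  Along a curve with \<open>\<xi>\<^sup>-\<^sup>1 \<xi>' = X\<close> in \<open>G\<close> a parallel field solves \<open>v' = - \<Lambda>(X\<^sub>\<mm>) v - [X\<^sub>\<hh>,v]\<close>, so that parallel
  transport is orthogonal. For \<open>X = a\<^sub>1, a\<^sub>2, b\<^sub>1, b\<^sub>2\<close> it is a rotation in a coordinate plane containing
  \<open>e\<^sub>1\<close>, with non-zero speed. The flows of \<open>a\<^sub>i\<close> and \<open>b\<^sub>j\<close> commute in \<open>G\<close>, so their commutators close up
  to loops, and the commutator of a half turn with a rotation by \<open>t / 2\<close> is a rotation by \<open>t\<close>. Hence the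
  holonomy contains all rotations in the coordinate planes through \<open>e\<^sub>1\<close>, and these generate \<open>SO(5)\<close>.
\<close>

text \<open>The bracket of fields, the connection and the extension of tangent vectors are specified
  by \<open>THE\<close> and \<open>SOME\<close>, so they can be computed only after existence and,
  for the bracket and the connection, uniqueness are known. For \<open>V_bracket\<close> this takes
  enough \<open>H\<close>-invariant functions to separate the tangent vectors of the quotient, for
  \<open>levi_civita\<close> enough vector fields, and the fundamental fields supply these. The
  derivative within \<open>G_grp\<close> is a choice as well, determined only on tangent vectors,
  and is therefore tested along curves in \<open>G\<close>. Smoothness means iterated derivatives
  along left-invariant fields, without charts. The commutator of two such fields is therefore read
  off from the two-parameter map \<open>g exp(s X) exp(t Y)\<close>. For the holonomy, the flows
  used have zero component in \<open>\<hh>\<close> and constant velocity in \<open>\<mm>\<close>, so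
  the transport equation has constant coefficients and Rodrigues' formula solves it. The commutator
  of rotations is non-trivial because a half turn in a plane through \<open>e_1\<close> reverses
  \<open>e_1\<close>, and with it the sense of any rotation in another coordinate plane through
  \<open>e_1\<close>.\<close>

lemma bounded_bilinear_matrix_mult:
  "bounded_bilinear ((**) :: real^'n^'m \<Rightarrow> real^'k^'n \<Rightarrow> real^'k^'m)"
  unfolding bilinear_conv_bounded_bilinear [symmetric]
    by (auto simp: bilinear_def linear_iff matrix_add_ldistrib matrix_matrix_mult_def vec_eq_iff
        sum.distrib sum_distrib_left algebra_simps)

interpretation mat_mult: bounded_bilinear "(**) :: real^'n^'m \<Rightarrow> real^'k^'n \<Rightarrow> real^'k^'m"
  by (rule bounded_bilinear_matrix_mult)

lemma transpose_add: "transpose (A + B) = transpose A + transpose B"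
  and transpose_scaleR: "transpose (r *\<^sub>R A) = r *\<^sub>R transpose A"
  for A B :: "real^'n^'m"
  by (simp_all add: vec_eq_iff transpose_def)

subsection \<open>One-parameter groups of rotations\<close>

definition rot_gen :: "real^'n^'n \<Rightarrow> bool"
  where "rot_gen S \<longleftrightarrow> transpose S = - S \<and> S ** S ** S = - S"

definition rodr :: "real^'n^'n \<Rightarrow> real \<Rightarrow> real^'n^'n"
  where "rodr S t = mat 1 + sin t *\<^sub>R S + (1 - cos t) *\<^sub>R (S ** S)"

lemma rot_gen_0 [simp]: "rot_gen 0"
  by (simp add: rot_gen_def vec_eq_iff transpose_def)

lemma rodr_zero [simp]: "rodr 0 t = mat 1"
  by (simp add: rodr_def)

lemma rodr_0 [simp]: "rodr S 0 = mat 1"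
  by (simp add: rodr_def)

lemma rot_gen_powers:
  assumes "rot_gen S"
  shows "S ** (S ** S) = - S" "S ** S ** S = - S" "(S ** S) ** (S ** S) = - (S ** S)"
  using assms by (simp_all add: rot_gen_def matrix_mul_assoc mat_mult.minus_left)

lemma rodr_add:
  assumes "rot_gen S"
  shows "rodr S (s + t) = rodr S s ** rodr S t"
proof -
  define T where "T = S ** S"
  have T: "S ** S = T" "S ** T = - S" "T ** S = - S" "T ** T = - T"
    using rot_gen_powers [OF assms] by (simp_all add: T_def)
  have "rodr S s ** rodr S t =
    mat 1 + (sin s + sin t - sin s * (1 - cos t) - (1 - cos s) * sin t) *\<^sub>R S
     + ((1 - cos s) + (1 - cos t) + sin s * sin t - (1 - cos s) * (1 - cos t)) *\<^sub>R T"
    unfolding rodr_def T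
    by (simp only: mat_mult.add_left mat_mult.add_right mat_mult.scaleR_left mat_mult.scaleR_right T
        matrix_mul_lid matrix_mul_rid) (simp add: algebra_simps)
  also have "\<dots> = rodr S (s + t)"
    unfolding rodr_def T by (simp add: sin_add cos_add left_diff_distrib right_diff_distrib mult_ac)
  finally show ?thesis by simp
qed

lemma rodr_minus: "rot_gen S \<Longrightarrow> rodr S t ** rodr S (- t) = mat 1" "rot_gen S \<Longrightarrow> rodr S (- t) ** rodr S t = mat 1"
  using rodr_add [of S t "- t"] rodr_add [of S "- t" t] by auto

lemma rodr_transpose: "rot_gen S \<Longrightarrow> transpose (rodr S t) = rodr S (- t)"
  by (simp add: rodr_def transpose_add transpose_scaleR matrix_transpose_mul rot_gen_def mat_mult.minus_left mat_mult.minus_right)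

text \<open>The determinant is the square of the determinant at half the angle, which is 1 or
  -1.\<close>

lemma rodr_rotation:
  assumes "rot_gen S" shows "rotation_matrix (rodr S t)"
proof -
  have o: "orthogonal_matrix (rodr S t)" for t
    using assms by (simp add: orthogonal_matrix_def rodr_transpose rodr_minus)
  have "det (rodr S t) = det (rodr S (t/2)) * det (rodr S (t/2))"
    by (metis rodr_add [OF assms] det_mul field_sum_of_halves)
  also have "\<dots> = 1"
    using det_orthogonal_matrix [OF o [of "t/2"]] by auto
  finally show ?thesis using o by (simp add: rotation_matrix_def)
qed

lemma rodr_has_vector_derivative:
  assumes "rot_gen S"
  shows "(rodr S has_vector_derivative rodr S t ** S) (at t within T)"
proof -
  have "((\<lambda>t. mat 1 + sin t *\<^sub>R S + (1 - cos t) *\<^sub>R (S ** S)) has_vector_derivative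
      0 + cos t *\<^sub>R S + (0 - - sin t) *\<^sub>R (S ** S)) (at t within T)"
    by (auto intro!: derivative_eq_intros simp: has_real_derivative_iff_has_vector_derivative [symmetric])
  moreover have "0 + cos t *\<^sub>R S + (0 - - sin t) *\<^sub>R (S ** S) = rodr S t ** S"
    by (simp only: rodr_def mat_mult.add_left mat_mult.scaleR_left rot_gen_powers [OF assms] matrix_mul_lid)
      (simp add: algebra_simps)
  ultimately show ?thesis unfolding rodr_def [abs_def] by simp
qed

lemma rodr_commute_gen: "rot_gen S \<Longrightarrow> rodr S t ** S = S ** rodr S t"
  by (simp add: rodr_def mat_mult.add_left mat_mult.add_right mat_mult.scaleR_left mat_mult.scaleR_right rot_gen_powers)

lemma rotation_matrix_mult: "rotation_matrix A \<Longrightarrow> rotation_matrix B \<Longrightarrow> rotation_matrix (A ** B)"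
  by (simp add: rotation_matrix_def orthogonal_matrix_def matrix_transpose_mul det_mul)
    (metis matrix_mul_assoc matrix_mul_lid)

lemma rotation_matrix_transpose: "rotation_matrix A \<Longrightarrow> rotation_matrix (transpose A)"
  by (simp add: rotation_matrix_def det_transpose)

lemma orthogonal_matrix_inv: "orthogonal_matrix (A::real^'n^'n) \<Longrightarrow> matrix_inv A = transpose A"
proof -
  assume "orthogonal_matrix A"
  then have A: "A ** transpose A = mat 1" "transpose A ** A = mat 1"
    by (simp_all add: orthogonal_matrix_def)
  then have "A ** matrix_inv A = mat 1"
    unfolding matrix_inv_def by (metis (mono_tags, lifting) someI_ex)
  then show ?thesis
    by (metis A(2) matrix_mul_assoc matrix_mul_lid matrix_mul_rid)
qed

subsection \<open>Pairs of matrices\<close>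

lemma bounded_bilinear_mp_mult: "bounded_bilinear (\<bullet>\<^sub>G)"
proof -
  have "bilinear (\<bullet>\<^sub>G)"
    by (auto simp: bilinear_def linear_iff mp_mult_def mat_mult.add_left mat_mult.add_right
        mat_mult.scaleR_left mat_mult.scaleR_right)
  then show ?thesis by (simp add: bilinear_conv_bounded_bilinear)
qed

interpretation mp: bounded_bilinear "(\<bullet>\<^sub>G)"
  by (rule bounded_bilinear_mp_mult)

lemma mp_assoc: "x \<bullet>\<^sub>G y \<bullet>\<^sub>G z = x \<bullet>\<^sub>G (y \<bullet>\<^sub>G z)"
  by (simp add: mp_mult_def matrix_mul_assoc)

lemma mp_one_left [simp]: "1\<^sub>G \<bullet>\<^sub>G x = x" and mp_one_right [simp]: "x \<bullet>\<^sub>G 1\<^sub>G = x"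
  by (simp_all add: mp_mult_def mp_one_def)

text \<open>On \<open>G_grp\<close> this is the inverse, but it is linear on all pairs of matrices
  and hence differentiable without further work.\<close>

definition mp_transp :: "mpair \<Rightarrow> mpair"
  where "mp_transp x = (transpose (fst x), transpose (snd x))"

lemma bounded_linear_mp_transp: "bounded_linear mp_transp"
  by (intro linear_conv_bounded_linear [THEN iffD1])
    (auto simp: linear_iff mp_transp_def transpose_add transpose_scaleR)

lemma mp_transp_mult: "mp_transp (x \<bullet>\<^sub>G y) = mp_transp y \<bullet>\<^sub>G mp_transp x"
  by (simp add: mp_transp_def mp_mult_def matrix_transpose_mul)

lemma mp_transp_transp [simp]: "mp_transp (mp_transp x) = x"
  by (simp add: mp_transp_def)

lemma mp_inv_G: "g \<in> G_grp \<Longrightarrow> mp_inv g = mp_transp g"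
  by (auto simp: G_grp_def mp_inv_def mp_transp_def rotation_matrix_def orthogonal_matrix_inv)

lemma G_transp_mult: "g \<in> G_grp \<Longrightarrow> mp_transp g \<bullet>\<^sub>G g = 1\<^sub>G" "g \<in> G_grp \<Longrightarrow> g \<bullet>\<^sub>G mp_transp g = 1\<^sub>G"
  by (auto simp: G_grp_def mp_mult_def mp_one_def mp_transp_def rotation_matrix_def orthogonal_matrix_def)

lemma G_transp_cancel: 
  "g \<in> G_grp \<Longrightarrow> mp_transp g \<bullet>\<^sub>G (g \<bullet>\<^sub>G x) = x" "g \<in> G_grp \<Longrightarrow> g \<bullet>\<^sub>G (mp_transp g \<bullet>\<^sub>G x) = x"
  by (simp_all add: mp_assoc [symmetric] G_transp_mult)

lemma G_one [simp, intro]: "1\<^sub>G \<in> G_grp"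
  by (simp add: G_grp_def mp_one_def rotation_matrix_def orthogonal_matrix_id)

lemma G_mult [intro]: "g \<in> G_grp \<Longrightarrow> h \<in> G_grp \<Longrightarrow> g \<bullet>\<^sub>G h \<in> G_grp"
  by (auto simp: G_grp_def mp_mult_def rotation_matrix_mult)

lemma mem_G_alg: "X \<in> G_alg \<longleftrightarrow> mp_transp X = - X"
  by (cases X) (auto simp: G_alg_def mp_transp_def)

lemma mp_transp_simps: "mp_transp (x + y) = mp_transp x + mp_transp y" "mp_transp (x - y) = mp_transp x - mp_transp y"
    "mp_transp (- x) = - mp_transp x" "mp_transp (r *\<^sub>R x) = r *\<^sub>R mp_transp x" "mp_transp 0 = 0"
  using bounded_linear.linear [OF bounded_linear_mp_transp]
  by (auto simp: linear_add linear_diff linear_neg linear_scale linear_0)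

lemma subspace_G_alg: "subspace G_alg"
  by (auto simp: subspace_def mem_G_alg mp_transp_simps)

lemma bracket_G_alg: "X \<in> G_alg \<Longrightarrow> Y \<in> G_alg \<Longrightarrow> bracket X Y \<in> G_alg"
  by (simp add: mem_G_alg bracket_def mp_transp_simps mp_transp_mult mp.minus_left mp.minus_right)

lemma conj_G_alg: "g \<in> G_grp \<Longrightarrow> X \<in> G_alg \<Longrightarrow> mp_transp g \<bullet>\<^sub>G X \<bullet>\<^sub>G g \<in> G_alg"
  by (simp add: mem_G_alg mp_transp_mult mp.minus_left mp.minus_right mp_assoc)

lemma Ad_G_alg: "g \<in> G_grp \<Longrightarrow> X \<in> G_alg \<Longrightarrow> Ad g X \<in> G_alg"
  by (simp add: Ad_def mp_inv_G mem_G_alg mp_transp_mult mp.minus_left mp.minus_right mp_assoc)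

section \<open>One-parameter subgroups of the product group\<close>

definition mp_rodr :: "mpair \<Rightarrow> real \<Rightarrow> mpair"
  where "mp_rodr X t = (rodr (fst X) t, rodr (snd X) t)"

definition mp_rot_gen :: "mpair \<Rightarrow> bool"
  where "mp_rot_gen X \<longleftrightarrow> rot_gen (fst X) \<and> rot_gen (snd X)"

lemma mp_rodr_0 [simp]: "mp_rodr X 0 = 1\<^sub>G"
  by (simp add: mp_rodr_def mp_one_def)

context
  fixes X assumes X: "mp_rot_gen X"
begin

lemma mp_rot_gen_alg: "X \<in> G_alg"
  using X by (cases X) (auto simp: G_alg_def mp_rot_gen_def rot_gen_def)

lemma mp_rodr_add: "mp_rodr X (s + t) = mp_rodr X s \<bullet>\<^sub>G mp_rodr X t"
  using X by (simp add: mp_rodr_def mp_mult_def mp_rot_gen_def rodr_add)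

lemma mp_rodr_G: "mp_rodr X t \<in> G_grp"
  using X by (simp add: mp_rodr_def mp_rot_gen_def G_grp_def rodr_rotation)

lemma mp_rodr_deriv: "(mp_rodr X has_vector_derivative mp_rodr X t \<bullet>\<^sub>G X) (at t within T)"
  using X unfolding mp_rodr_def [abs_def] mp_mult_def mp_rot_gen_def
  by (auto intro!: has_vector_derivative_Pair rodr_has_vector_derivative)

end

section \<open>The standard basis of the Lie algebra\<close>

lemma E_mat_transpose: "transpose (E_mat i j) = - E_mat i j" if "i \<noteq> j"
  using that by (auto simp: E_mat_def transpose_def vec_eq_iff)

lemma rot_gen_s_mat: "rot_gen (s_mat i)"
proof -
  have "transpose (s_mat i) = - s_mat i"
    by (simp add: s_mat_def E_mat_transpose)
  moreover have "s_mat i ** s_mat i ** s_mat i = - s_mat i"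
    using exhaust_3 [of i]
    by (auto simp: s_mat_def E_mat_def vec_eq_iff forall_3 matrix_matrix_mult_def sum_3)
  ultimately show ?thesis by (simp add: rot_gen_def)
qed

lemma mp_rot_gen_basis [simp]: "mp_rot_gen (a_vec i)" "mp_rot_gen (b_vec i)"
  by (simp_all add: mp_rot_gen_def a_vec_def b_vec_def rot_gen_s_mat)

lemma skew_decomp: 
  assumes "transpose A = - (A::real^3^3)"
  shows "A = (A $ 3 $ 2) *\<^sub>R s_mat 1 + (A $ 1 $ 3) *\<^sub>R s_mat 2 + (A $ 2 $ 1) *\<^sub>R s_mat 3"
proof -
  have *: "A $ j $ i = - A $ i $ j" for i j
    using arg_cong [OF assms, of "\<lambda>M. M $ i $ j"] by (simp add: transpose_def)
  have "A $ i $ i = 0" for i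
    using * [of i i] by simp
  then show ?thesis
    using * [of 2 1] * [of 1 3] * [of 3 2]
    by (simp add: vec_eq_iff forall_3 s_mat_def E_mat_def)
qed

lemma G_alg_decomp: 
  assumes "X \<in> G_alg"
  shows "X = (fst X $ 3 $ 2) *\<^sub>R a_vec 1 + (fst X $ 1 $ 3) *\<^sub>R a_vec 2 + (fst X $ 2 $ 1) *\<^sub>R a_vec 3
    + (snd X $ 3 $ 2) *\<^sub>R b_vec 1 + (snd X $ 1 $ 3) *\<^sub>R b_vec 2 + (snd X $ 2 $ 1) *\<^sub>R b_vec 3"
  using assms skew_decomp [of "fst X"] skew_decomp [of "snd X"]
  by (cases X) (auto simp: G_alg_def a_vec_def b_vec_def)

lemma G_alg_basis [simp]: "a_vec i \<in> G_alg" "b_vec i \<in> G_alg"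
  by (simp_all add: mp_rot_gen_alg)

lemma G_alg_eq_span: "G_alg = span (range a_vec \<union> range b_vec)"
proof
  show "G_alg \<subseteq> span (range a_vec \<union> range b_vec)"
  proof
    fix X assume "X \<in> G_alg"
    from G_alg_decomp [OF this] show "X \<in> span (range a_vec \<union> range b_vec)"
      by (metis (no_types, lifting) UnI1 UnI2 rangeI span_add span_base span_scale)
  qed
  show "span (range a_vec \<union> range b_vec) \<subseteq> G_alg"
    by (intro span_minimal subspace_G_alg) auto
qed

subsection \<open>Derivatives along the group\<close>

lemma dir_deriv_curve:
  assumes "f differentiable (at (c t) within G_grp)" "c ` T \<subseteq> G_grp"
    and "(c has_vector_derivative c t \<bullet>\<^sub>G X) (at t within T)"
  shows "((\<lambda>s. f (c s)) has_vector_derivative dir_deriv f (c t) X) (at t within T)"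
proof -
  let ?L = "frechet_derivative f (at (c t) within G_grp)"
  have L: "(f has_derivative ?L) (at (c t) within G_grp)"
    using assms(1) frechet_derivative_works by blast
  have "((\<lambda>s. f (c s)) has_derivative (\<lambda>s. ?L (s *\<^sub>R (c t \<bullet>\<^sub>G X)))) (at t within T)"
    by (rule has_derivative_in_compose [OF assms(3) [unfolded has_vector_derivative_def] has_derivative_subset [OF L assms(2)]])
  then show ?thesis
    by (simp add: has_vector_derivative_def dir_deriv_def linear_scale [OF has_derivative_linear [OF L]])
qed

text \<open>Any two derivatives within \<open>G_grp\<close> agree on
  \<open>g \<bullet>\<^sub>G X\<close> for a generator \<open>X\<close>, since both give the
  derivative along the curve \<open>g exp(t X)\<close>, which stays in \<open>G\<close>. By
  linearity they agree on the span of the generators, which is the Lie algebra.\<close>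

lemma dir_deriv_eq:
  assumes f: "(f has_derivative f') (at g within G_grp)" and g: "g \<in> G_grp" and X: "X \<in> G_alg"
  shows "dir_deriv f g X = f' (g \<bullet>\<^sub>G X)"
proof -
  let ?L = "frechet_derivative f (at g within G_grp)"
  have L: "(f has_derivative ?L) (at g within G_grp)"
    using f frechet_derivative_works differentiableI by blast
  have lin: "linear (\<lambda>X. h (g \<bullet>\<^sub>G X))" if "linear h" for h :: "mpair \<Rightarrow> 'a"
    by (intro linearI) (simp_all add: mp.add_right mp.scaleR_right linear_add [OF that] linear_scale [OF that])
  have eq: "?L (g \<bullet>\<^sub>G X) = f' (g \<bullet>\<^sub>G X)" if X: "mp_rot_gen X" for X
  proof -
    define c where "c t = g \<bullet>\<^sub>G mp_rodr X t" for t
    have c: "(c has_vector_derivative g \<bullet>\<^sub>G X) (at 0)" "range c \<subseteq> G_grp" "c 0 = g"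
      using bounded_linear.has_vector_derivative [OF mp.bounded_linear_right [of g] mp_rodr_deriv [OF X, of 0 UNIV]]
      by (auto simp: c_def [abs_def] G_mult g mp_rodr_G [OF X])
    have "((\<lambda>t. f (c t)) has_vector_derivative h (g \<bullet>\<^sub>G X)) (at 0)"
      if h: "(f has_derivative h) (at g within G_grp)" for h
      using has_derivative_in_compose [OF c(1) [unfolded has_vector_derivative_def]
          has_derivative_subset [OF h [folded c(3)] c(2)]]
      by (simp add: has_vector_derivative_def linear_scale [OF has_derivative_linear [OF h]])
    from vector_derivative_unique_at [OF this [OF L] this [OF f]] show ?thesis .
  qed
  have "?L (g \<bullet>\<^sub>G X) = f' (g \<bullet>\<^sub>G X)"
    by (rule linear_eq_on_span [OF lin [OF has_derivative_linear [OF L]] lin [OF has_derivative_linear [OF f]]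
          eq, of "range a_vec \<union> range b_vec"])
      (use X in \<open>auto simp: G_alg_eq_span\<close>)
  then show ?thesis by (simp add: dir_deriv_def)
qed

text \<open>No tangency of \<open>X\<close> is required: both functions have the same set of
  derivatives within \<open>G_grp\<close>, so the choice operator returns the same map.\<close>

lemma dir_deriv_cong:
  assumes "\<And>a. a \<in> G_grp \<Longrightarrow> f a = h a" "g \<in> G_grp"
  shows "dir_deriv f g X = dir_deriv h g X"
proof -
  have "(f has_derivative F) (at g within G_grp) \<longleftrightarrow> (h has_derivative F) (at g within G_grp)" for F
    using assms has_derivative_transform by (metis (mono_tags, lifting))
  then show ?thesis by (simp add: dir_deriv_def frechet_derivative_def)
qed

lemma differentiable_G_cong:
  assumes "f differentiable (at g within G_grp)" "g \<in> G_grp" "\<And>a. a \<in> G_grp \<Longrightarrow> h a = f a" 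
  shows "h differentiable (at g within G_grp)"
  using assms has_derivative_transform by (metis (mono_tags, lifting) differentiable_def)

lemma dir_deriv_linear:
  assumes "f differentiable (at g within G_grp)"
  shows "linear (dir_deriv f g)"
proof -
  have L: "linear (frechet_derivative f (at g within G_grp))"
    using assms has_derivative_linear frechet_derivative_works by blast
  show ?thesis
    by (intro linearI) (simp_all add: dir_deriv_def mp.add_right mp.scaleR_right linear_add [OF L] linear_scale [OF L])
qed

lemma has_dir_deriv_linear:
  assumes "bounded_linear F" "f differentiable (at g within G_grp)"
  shows "((\<lambda>a. F (f a)) has_derivative (\<lambda>x. F (frechet_derivative f (at g within G_grp) x))) (at g within G_grp)"
  using assms bounded_linear.has_derivative frechet_derivative_works by blast

context
  fixes g X assumes g: "g \<in> G_grp" and X: "X \<in> G_alg"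
begin

lemma dir_deriv_bounded_linear:
  assumes "bounded_linear F" "f differentiable (at g within G_grp)"
  shows "dir_deriv (\<lambda>a. F (f a)) g X = F (dir_deriv f g X)"
  using dir_deriv_eq [OF has_dir_deriv_linear [OF assms] g X] by (simp add: dir_deriv_def)

lemma dir_deriv_add:
  assumes "f differentiable (at g within G_grp)" "h differentiable (at g within G_grp)"
  shows "dir_deriv (\<lambda>a. f a + h a) g X = dir_deriv f g X + dir_deriv h g X"
  using dir_deriv_eq [OF has_derivative_add [OF assms [unfolded frechet_derivative_works]] g X]
  by (simp add: dir_deriv_def)

lemma dir_deriv_diff:
  assumes "f differentiable (at g within G_grp)" "h differentiable (at g within G_grp)"
  shows "dir_deriv (\<lambda>a. f a - h a) g X = dir_deriv f g X - dir_deriv h g X"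
  using dir_deriv_eq [OF has_derivative_diff [OF assms [unfolded frechet_derivative_works]] g X]
  by (simp add: dir_deriv_def)

lemma dir_deriv_sum:
  assumes "\<And>i. i \<in> I \<Longrightarrow> f i differentiable (at g within G_grp)"
  shows "dir_deriv (\<lambda>a. \<Sum>i\<in>I. f i a) g X = (\<Sum>i\<in>I. dir_deriv (f i) g X)"
  using dir_deriv_eq [OF has_derivative_sum [of I f "\<lambda>i. frechet_derivative (f i) (at g within G_grp)"] g X]
    assms [unfolded frechet_derivative_works] by (simp add: dir_deriv_def)

lemma dir_deriv_bilinear:
  assumes "bounded_bilinear B" "f differentiable (at g within G_grp)" "h differentiable (at g within G_grp)"
  shows "dir_deriv (\<lambda>a. B (f a) (h a)) g X = B (f g) (dir_deriv h g X) + B (dir_deriv f g X) (h g)"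
  using dir_deriv_eq [OF bounded_bilinear.FDERIV [OF assms(1) assms(2,3) [unfolded frechet_derivative_works]] g X]
  by (simp add: dir_deriv_def)

lemma dir_deriv_const: "dir_deriv (\<lambda>a. k) g X = 0"
  by (rule dir_deriv_eq [OF has_derivative_const g X])

lemma dir_deriv_of_linear:
  assumes "bounded_linear F"
  shows "dir_deriv F g X = F (g \<bullet>\<^sub>G X)"
  by (rule dir_deriv_eq [OF bounded_linear.has_derivative [OF assms has_derivative_ident] g X])

end

lemma differentiable_bilinear_G:
  assumes "bounded_bilinear B" "f differentiable (at g within T)" "h differentiable (at g within T)"
  shows "(\<lambda>a. B (f a) (h a)) differentiable (at g within T)"
  using bounded_bilinear.FDERIV [OF assms(1) assms(2,3) [unfolded frechet_derivative_works]]
  by (rule differentiableI)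

subsection \<open>Smooth functions on the group\<close>

lemma smooth_G_differentiable: "smooth_G f \<Longrightarrow> g \<in> G_grp \<Longrightarrow> f differentiable (at g within G_grp)"
  using smooth_G.simps by blast

lemma smooth_G_dir_deriv: "smooth_G f \<Longrightarrow> X \<in> G_alg \<Longrightarrow> smooth_G (\<lambda>g. dir_deriv f g X)"
  by (subst (asm) smooth_G.simps) blast

lemma smooth_G_continuous_on: "smooth_G f \<Longrightarrow> continuous_on G_grp f"
  by (meson continuous_on_eq_continuous_within differentiable_imp_continuous_within smooth_G_differentiable)

text \<open>Coinduction up to equality on \<open>G_grp\<close>. The differentiation rules hold only
  at points of \<open>G\<close>, whereas the plain coinduction rule would demand equality of
  functions on all pairs of matrices.\<close>

lemma smooth_G_coinduct_upto:
  assumes "C f0" and eq: "\<And>g. g \<in> G_grp \<Longrightarrow> f g = f0 g"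
    and diff: "\<And>f g. C f \<Longrightarrow> g \<in> G_grp \<Longrightarrow> f differentiable (at g within G_grp)"
    and deriv: "\<And>f X. C f \<Longrightarrow> X \<in> G_alg \<Longrightarrow> \<exists>h. C h \<and> (\<forall>g\<in>G_grp. dir_deriv f g X = h g)"
  shows "smooth_G f"
proof -
  have "\<exists>h. C h \<and> (\<forall>g\<in>G_grp. f g = h g)" using assms(1) eq by (intro exI [of _ f0]) simp
  then show ?thesis
  proof (coinduction arbitrary: f rule: smooth_G.coinduct)
    case (smooth_G f)
    then obtain h where "C h \<and> (\<forall>g\<in>G_grp. f g = h g)" ..
    then have h: "C h" "\<And>g. g \<in> G_grp \<Longrightarrow> f g = h g" by simp_all
    have "\<exists>k. C k \<and> (\<forall>g\<in>G_grp. dir_deriv f g X = k g)" if X: "X \<in> G_alg" for X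
    proof -
      obtain k where "C k \<and> (\<forall>g\<in>G_grp. dir_deriv h g X = k g)" using deriv [OF h(1) X] ..
      then show ?thesis using dir_deriv_cong [of f h, OF h(2)] by (intro exI [of _ k]) simp
    qed
    moreover have "f differentiable (at g within G_grp)" if "g \<in> G_grp" for g
      using differentiable_G_cong [OF diff [OF h(1) that] that h(2)] .
    ultimately show ?case by (intro exI [of _ f]) simp
  qed
qed

lemma smooth_G_cong: "smooth_G f0 \<Longrightarrow> (\<And>g. g \<in> G_grp \<Longrightarrow> f g = f0 g) \<Longrightarrow> smooth_G f"
  by (erule smooth_G_coinduct_upto) (auto intro: smooth_G_differentiable smooth_G_dir_deriv)

lemma smooth_G_bounded_linear:
  assumes "smooth_G f" "bounded_linear F"
  shows "smooth_G (\<lambda>g. F (f g))"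
proof (rule smooth_G_coinduct_upto [where C = "\<lambda>h. \<exists>f. smooth_G f \<and> h = (\<lambda>g. F (f g))"])
  show "\<exists>h. (\<exists>f. smooth_G f \<and> h = (\<lambda>g. F (f g))) \<and> (\<forall>g\<in>G_grp. dir_deriv k g X = h g)"
    if "\<exists>f. smooth_G f \<and> k = (\<lambda>g. F (f g))" "X \<in> G_alg" for k X
  proof -
    from that obtain f where f: "smooth_G f" "k = (\<lambda>g. F (f g))" by blast
    then show ?thesis
      using dir_deriv_bounded_linear [OF _ that(2) assms(2) smooth_G_differentiable [OF f(1)]]
        smooth_G_dir_deriv [OF f(1) that(2)]
      by (intro exI [of _ "\<lambda>g. F (dir_deriv f g X)"]) auto
  qed
  show "k differentiable (at g within G_grp)" if "\<exists>f. smooth_G f \<and> k = (\<lambda>g. F (f g))" "g \<in> G_grp" for k g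
    using that differentiableI [OF has_dir_deriv_linear [OF assms(2) smooth_G_differentiable]] by blast
qed (use assms in auto)

lemma smooth_G_add:
  assumes "smooth_G f" "smooth_G h"
  shows "smooth_G (\<lambda>g. f g + h g)"
proof (rule smooth_G_coinduct_upto [where C = "\<lambda>k. \<exists>f h. smooth_G f \<and> smooth_G h \<and> k = (\<lambda>g. f g + h g)"])
  show "\<exists>h. (\<exists>f1 f2. smooth_G f1 \<and> smooth_G f2 \<and> h = (\<lambda>g. f1 g + f2 g)) \<and> (\<forall>g\<in>G_grp. dir_deriv k g X = h g)"
    if "\<exists>f1 f2. smooth_G f1 \<and> smooth_G f2 \<and> k = (\<lambda>g. f1 g + f2 g)" "X \<in> G_alg" for k X
  proof -
    from that obtain f1 f2 where f: "smooth_G f1" "smooth_G f2" "k = (\<lambda>g. f1 g + f2 g)" by blast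
    then show ?thesis
      using dir_deriv_add [OF _ that(2) smooth_G_differentiable [OF f(1)] smooth_G_differentiable [OF f(2)]]
        smooth_G_dir_deriv [OF f(1) that(2)] smooth_G_dir_deriv [OF f(2) that(2)]
      by (intro exI [of _ "\<lambda>g. dir_deriv f1 g X + dir_deriv f2 g X"]) auto
  qed
  show "k differentiable (at g within G_grp)"
    if "\<exists>f1 f2. smooth_G f1 \<and> smooth_G f2 \<and> k = (\<lambda>g. f1 g + f2 g)" "g \<in> G_grp" for k g
    using that differentiable_add [OF smooth_G_differentiable smooth_G_differentiable] by blast
qed (use assms in auto)

text \<open>Products alone are not closed under differentiation, as the Leibniz rule produces sums;
  closing them under addition gives an invariant for the coinduction.\<close>

inductive bilinear_comb :: "('b::real_normed_vector \<Rightarrow> 'c::real_normed_vector \<Rightarrow> 'd::real_normed_vector) \<Rightarrow> (mpair \<Rightarrow> 'd) \<Rightarrow> bool"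
  for B where
  "smooth_G f \<Longrightarrow> smooth_G h \<Longrightarrow> bilinear_comb B (\<lambda>g. B (f g) (h g))"
| "bilinear_comb B f \<Longrightarrow> bilinear_comb B h \<Longrightarrow> bilinear_comb B (\<lambda>g. f g + h g)"

lemma smooth_G_bilinear:
  assumes "bounded_bilinear B" "smooth_G f" "smooth_G h"
  shows "smooth_G (\<lambda>g. B (f g) (h g))"
proof (rule smooth_G_coinduct_upto [where C = "bilinear_comb B"])
  show diff: "f differentiable (at g within G_grp)" if "bilinear_comb B f" "g \<in> G_grp" for f g
    using that
    by induction (simp_all add: differentiable_bilinear_G [OF assms(1)] differentiable_add smooth_G_differentiable)
  show "\<exists>h. bilinear_comb B h \<and> (\<forall>g\<in>G_grp. dir_deriv f g X = h g)" if "bilinear_comb B f" "X \<in> G_alg" for f X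
    using that(1)
  proof induction
    case (1 f h)
    then show ?case
      using dir_deriv_bilinear [OF _ that(2) assms(1) smooth_G_differentiable [OF 1(1)] smooth_G_differentiable [OF 1(2)]]
      by (intro exI [of _ "\<lambda>g. B (f g) (dir_deriv h g X) + B (dir_deriv f g X) (h g)"])
        (auto intro!: bilinear_comb.intros smooth_G_dir_deriv that(2))
  next
    case (2 f h)
    then obtain f' h' where "bilinear_comb B f'" "\<forall>g\<in>G_grp. dir_deriv f g X = f' g"
      "bilinear_comb B h'" "\<forall>g\<in>G_grp. dir_deriv h g X = h' g" by blast
    then show ?case
      using dir_deriv_add [OF _ that(2) diff [OF 2(1)] diff [OF 2(2)]]
      by (intro exI [of _ "\<lambda>g. f' g + h' g"]) (auto intro!: bilinear_comb.intros)
  qed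
qed (use assms bilinear_comb.intros in auto)

lemma smooth_G_const: "smooth_G (\<lambda>g. k)"
  by (rule smooth_G_coinduct_upto [where C = "\<lambda>f. \<exists>k. f = (\<lambda>g. k)"])
    (auto simp: dir_deriv_const intro!: exI [of _ "\<lambda>g. 0"])

lemma smooth_G_of_linear:
  assumes "bounded_linear F" shows "smooth_G F"
proof (rule smooth_G_coinduct_upto [where C = bounded_linear])
  show "\<exists>h. bounded_linear h \<and> (\<forall>g\<in>G_grp. dir_deriv f g X = h g)" if "bounded_linear f" "X \<in> G_alg" for f :: "mpair \<Rightarrow> 'a" and X
    using dir_deriv_of_linear [OF _ that(2,1)] bounded_linear_compose [OF that(1) mp.bounded_linear_left [of X]]
    by (intro exI [of _ "\<lambda>g. f (g \<bullet>\<^sub>G X)"]) auto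
qed (use assms in \<open>auto intro: bounded_linear_imp_differentiable\<close>)

lemma smooth_G_scaleR: "smooth_G f \<Longrightarrow> smooth_G h \<Longrightarrow> smooth_G (\<lambda>g. f g *\<^sub>R h g)"
  by (rule smooth_G_bilinear [OF bounded_bilinear_scaleR])

lemma smooth_G_mult: "smooth_G f \<Longrightarrow> smooth_G h \<Longrightarrow> smooth_G (\<lambda>g. f g * h g :: real)"
  by (rule smooth_G_bilinear [OF bounded_bilinear_mult])

lemma smooth_G_diff: "smooth_G f \<Longrightarrow> smooth_G h \<Longrightarrow> smooth_G (\<lambda>g. f g - h g)"
  using smooth_G_add [OF _ smooth_G_bounded_linear [OF _ bounded_linear_minus [OF bounded_linear_ident]]] by fastforce

lemma smooth_G_sum: "(\<And>i. i \<in> I \<Longrightarrow> smooth_G (f i)) \<Longrightarrow> smooth_G (\<lambda>g. \<Sum>i\<in>I. f i g)"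
  by (induction I rule: infinite_finite_induct) (auto intro: smooth_G_const smooth_G_add)

subsection \<open>Derivatives along vector fields\<close>

text \<open>Projecting the standard basis of the space of pairs yields a finite spanning family of
  the Lie algebra, with inner products as coefficients.\<close>

definition skew_proj :: "mpair \<Rightarrow> mpair"
  where "skew_proj X = (1/2) *\<^sub>R (X - mp_transp X)"

lemma skew_proj_G_alg [simp]: "skew_proj X \<in> G_alg"
  by (simp add: skew_proj_def mem_G_alg mp_transp_simps algebra_simps)

lemma skew_proj_ident: "X \<in> G_alg \<Longrightarrow> skew_proj X = X"
  by (simp add: skew_proj_def mem_G_alg scaleR_2 [symmetric] del: scaleR_2)

lemma bounded_linear_skew_proj: "bounded_linear skew_proj"
  unfolding skew_proj_def
  by (intro bounded_linear_const_scaleR bounded_linear_sub bounded_linear_ident bounded_linear_mp_transp)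

text \<open>This splits a variable direction into scalar coefficients and fixed directions, to which
  the product rule applies.\<close>

lemma dir_deriv_basis_sum:
  assumes "f differentiable (at g within G_grp)" "X \<in> G_alg"
  shows "dir_deriv f g X = (\<Sum>b\<in>Basis. (X \<bullet> b) *\<^sub>R dir_deriv f g (skew_proj b))"
proof -
  have "X = skew_proj (\<Sum>b\<in>Basis. (X \<bullet> b) *\<^sub>R b)"
    using assms by (simp add: euclidean_representation skew_proj_ident)
  also have "\<dots> = (\<Sum>b\<in>Basis. (X \<bullet> b) *\<^sub>R skew_proj b)"
    using bounded_linear.linear [OF bounded_linear_skew_proj] by (simp add: linear_sum linear_scale)
  finally have "dir_deriv f g X = dir_deriv f g (\<Sum>b\<in>Basis. (X \<bullet> b) *\<^sub>R skew_proj b)"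
    by (rule arg_cong)
  also have "\<dots> = (\<Sum>b\<in>Basis. (X \<bullet> b) *\<^sub>R dir_deriv f g (skew_proj b))"
    by (simp add: linear_sum [OF dir_deriv_linear [OF assms(1)]] linear_scale [OF dir_deriv_linear [OF assms(1)]])
  finally show ?thesis .
qed

text \<open>Differentiating \<open>P (f a) = f a\<close> shows that derivatives stay in the linear
  subspace in which the values lie; it serves for the Lie algebra and for
  \<open>m_sp\<close>.\<close>

lemma dir_deriv_invariant:
  assumes "bounded_linear P" "f differentiable (at g within G_grp)" "g \<in> G_grp" "X \<in> G_alg"
    and "\<And>a. a \<in> G_grp \<Longrightarrow> P (f a) = f a"
  shows "P (dir_deriv f g X) = dir_deriv f g X"
  by (rule trans [OF dir_deriv_bounded_linear [OF assms(3,4,1,2), symmetric] dir_deriv_cong [OF assms(5) assms(3)]])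

context
  fixes f :: "mpair \<Rightarrow> 'b::real_normed_vector" and Y :: "mpair \<Rightarrow> mpair"
  assumes f: "smooth_G f" and Y: "smooth_G Y" "\<And>g. g \<in> G_grp \<Longrightarrow> Y g \<in> G_alg"
begin

lemma dir_deriv_field_sum:
  "g \<in> G_grp \<Longrightarrow> dir_deriv f g (Y g) = (\<Sum>b\<in>Basis. (Y g \<bullet> b) *\<^sub>R dir_deriv f g (skew_proj b))"
  by (rule dir_deriv_basis_sum [OF smooth_G_differentiable [OF f] Y(2)])

lemma smooth_G_field: "smooth_G (\<lambda>g. dir_deriv f g (Y g))"
  by (rule smooth_G_cong [OF _ dir_deriv_field_sum])
    (intro smooth_G_sum smooth_G_scaleR smooth_G_dir_deriv smooth_G_bounded_linear [OF Y(1)] f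
      bounded_linear_inner_left skew_proj_G_alg)

lemma dir_deriv_G_alg:
  assumes "g \<in> G_grp" "X \<in> G_alg" shows "dir_deriv Y g X \<in> G_alg"
  by (subst dir_deriv_invariant [OF bounded_linear_skew_proj smooth_G_differentiable [OF Y(1) assms(1)]
        assms skew_proj_ident [OF Y(2)], symmetric]) simp_all

text \<open>Product rule: the outer derivative falls either on the inner derivative of
  \<open>f\<close>, with the direction frozen at \<open>g\<close>, or on the direction.\<close>

lemma dir_deriv_field:
  assumes g: "g \<in> G_grp" and X: "X \<in> G_alg"
  shows "dir_deriv (\<lambda>a. dir_deriv f a (Y a)) g X =
    dir_deriv (\<lambda>a. dir_deriv f a (Y g)) g X + dir_deriv f g (dir_deriv Y g X)"
proof -
  let ?D = "\<lambda>b a. dir_deriv f a (skew_proj b)"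
  have D: "?D b differentiable (at g within G_grp)" for b
    by (rule smooth_G_differentiable [OF smooth_G_dir_deriv [OF f skew_proj_G_alg] g])
  have Yd: "Y differentiable (at g within G_grp)"
    by (rule smooth_G_differentiable [OF Y(1) g])
  have Yb: "(\<lambda>a. Y a \<bullet> b) differentiable (at g within G_grp)" for b
    by (rule differentiableI [OF has_dir_deriv_linear [OF bounded_linear_inner_left Yd]])
  have "dir_deriv (\<lambda>a. dir_deriv f a (Y a)) g X = dir_deriv (\<lambda>a. \<Sum>b\<in>Basis. (Y a \<bullet> b) *\<^sub>R ?D b a) g X"
    by (rule dir_deriv_cong [OF _ g]) (rule dir_deriv_field_sum)
  also have "\<dots> = (\<Sum>b\<in>Basis. dir_deriv (\<lambda>a. (Y a \<bullet> b) *\<^sub>R ?D b a) g X)"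
    by (rule dir_deriv_sum [OF g X differentiable_bilinear_G [OF bounded_bilinear_scaleR Yb D]])
  also have "\<dots> = (\<Sum>b\<in>Basis. (Y g \<bullet> b) *\<^sub>R dir_deriv (?D b) g X + (dir_deriv Y g X \<bullet> b) *\<^sub>R ?D b g)"
    by (intro sum.cong refl)
      (simp add: dir_deriv_bilinear [OF g X bounded_bilinear_scaleR Yb D]
        dir_deriv_bounded_linear [OF g X bounded_linear_inner_left Yd])
  also have "\<dots> = (\<Sum>b\<in>Basis. (Y g \<bullet> b) *\<^sub>R dir_deriv (?D b) g X) + dir_deriv f g (dir_deriv Y g X)"
    by (simp only: sum.distrib dir_deriv_basis_sum [OF smooth_G_differentiable [OF f g] dir_deriv_G_alg [OF g X], symmetric])
  also have "(\<Sum>b\<in>Basis. (Y g \<bullet> b) *\<^sub>R dir_deriv (?D b) g X) = dir_deriv (\<lambda>a. \<Sum>b\<in>Basis. (Y g \<bullet> b) *\<^sub>R ?D b a) g X"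
    by (rule trans [OF _ dir_deriv_sum [OF g X, symmetric]])
      (simp_all add: differentiableI [OF has_dir_deriv_linear [OF bounded_linear_scaleR_right D]]
        dir_deriv_bounded_linear [OF g X bounded_linear_scaleR_right D])
  also have "\<dots> = dir_deriv (\<lambda>a. dir_deriv f a (Y g)) g X"
    by (rule dir_deriv_cong [OF _ g], rule dir_deriv_basis_sum [OF smooth_G_differentiable [OF f] Y(2) [OF g], symmetric])
  finally show ?thesis .
qed

end

subsection \<open>Commutators of left-invariant vector fields\<close>

text \<open>Peano's version of the symmetry of mixed partial derivatives: only one of the two needs to be
  continuous.\<close>

lemma mixed_partials_eq:
  fixes F :: "real \<Rightarrow> real \<Rightarrow> real"
  assumes Ft: "\<And>s t. (F s has_real_derivative Ft s t) (at t)"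
    and Fts: "\<And>s t. ((\<lambda>s. Ft s t) has_real_derivative Fts s t) (at s)"
    and cont: "isCont (\<lambda>p. Fts (fst p) (snd p)) (0, 0)"
    and Fs: "\<And>t. ((\<lambda>s. F s t) has_real_derivative Fs t) (at 0)"
    and Fst: "(Fs has_real_derivative M) (at 0)"
  shows "M = Fts 0 0"
proof -
  have le: "\<bar>M - Fts 0 0\<bar> \<le> e" if e: "e > 0" for e
  proof -
    obtain d where d: "d > 0" "\<And>s t. dist (s, t) (0, 0) < d \<Longrightarrow> dist (Fts s t) (Fts 0 0) < e"
      using cont [unfolded continuous_at_eps_delta] e by (metis fst_conv snd_conv)
    define r where "r = d / 2"
    have r: "r > 0" using d by (simp add: r_def)
    have d2: "\<bar>Fts s t - Fts 0 0\<bar> < e" if "0 < s" "s < r" "0 < t" "t < r" for s t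
    proof -
      have "dist (s, t) (0, 0) \<le> \<bar>s\<bar> + \<bar>t\<bar>"
        by (simp add: dist_Pair_Pair) (metis real_sqrt_abs real_sqrt_ge_zero sqrt_sum_squares_le_sum_abs)
      with that have "dist (s, t) (0, 0) < d" by (auto simp: r_def)
      from d(2) [OF this] show ?thesis by (simp add: dist_real_def)
    qed
    have quot: "\<bar>((F s t - F 0 t) / s - (F s 0 - F 0 0) / s) / t - Fts 0 0\<bar> < e"
      if s: "0 < s" "s < r" and t: "0 < t" "t < r" for s t
    proof -
      \<comment> \<open>The second difference is handled by two mean value theorems, one in
        \<open>t\<close> for the difference in \<open>s\<close>, then one in
        \<open>s\<close>.\<close>
      obtain y where y: "0 < y" "y < t" "(F s t - F 0 t) - (F s 0 - F 0 0) = (t - 0) * (Ft s y - Ft 0 y)"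
        using MVT2 [OF t(1), of "\<lambda>t. F s t - F 0 t" "\<lambda>t. Ft s t - Ft 0 t"] DERIV_diff [OF Ft Ft] by blast
      obtain x where x: "0 < x" "x < s" "Ft s y - Ft 0 y = (s - 0) * Fts x y"
        using MVT2 [OF s(1), of "\<lambda>s. Ft s y" "\<lambda>s. Fts s y"] Fts by blast
      have "((F s t - F 0 t) / s - (F s 0 - F 0 0) / s) / t = Fts x y"
        using x y s t by (simp add: diff_divide_distrib [symmetric])
      then show ?thesis using d2 [of x y] x y s t by auto
    qed
    have lim_s: "((\<lambda>s. (F s t - F 0 t) / s) \<longlongrightarrow> Fs t) (at_right 0)" for t
      using Fs [of t] unfolding has_field_derivative_iff by (simp add: filterlim_at_split)
    \<comment> \<open>The limit in \<open>s\<close> is taken for fixed \<open>t\<close>; only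
      afterwards does \<open>t\<close> tend to 0.\<close>
    have step: "\<bar>(Fs t - Fs 0) / t - Fts 0 0\<bar> \<le> e" if t: "0 < t" "t < r" for t
    proof (rule tendsto_upperbound)
      show "((\<lambda>s. \<bar>((F s t - F 0 t) / s - (F s 0 - F 0 0) / s) / t - Fts 0 0\<bar>) \<longlongrightarrow> \<bar>(Fs t - Fs 0) / t - Fts 0 0\<bar>) (at_right 0)"
        using t by (intro tendsto_intros lim_s) auto
      show "\<forall>\<^sub>F s in at_right 0. \<bar>((F s t - F 0 t) / s - (F s 0 - F 0 0) / s) / t - Fts 0 0\<bar> \<le> e"
        using r quot t unfolding eventually_at_right_field by (intro exI [of _ r]) (auto intro!: less_imp_le)
    qed simp
    have lim_t: "((\<lambda>t. (Fs t - Fs 0) / t) \<longlongrightarrow> M) (at_right 0)"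
      using Fst unfolding has_field_derivative_iff by (simp add: filterlim_at_split)
    show ?thesis
    proof (rule tendsto_upperbound)
      show "((\<lambda>t. \<bar>(Fs t - Fs 0) / t - Fts 0 0\<bar>) \<longlongrightarrow> \<bar>M - Fts 0 0\<bar>) (at_right 0)"
        by (intro tendsto_intros lim_t)
      show "\<forall>\<^sub>F t in at_right 0. \<bar>(Fs t - Fs 0) / t - Fts 0 0\<bar> \<le> e"
        using r step unfolding eventually_at_right_field by (intro exI [of _ r]) auto
    qed simp
  qed
  have "\<bar>M - Fts 0 0\<bar> \<le> 0" by (rule field_le_epsilon) (use le in simp)
  then show ?thesis by simp
qed

lemma has_vector_derivative_real_iff:
  "(f has_vector_derivative d) (at x within S) \<longleftrightarrow> (f has_real_derivative d) (at x within S)"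
  by (simp add: has_real_derivative_iff_has_vector_derivative)

lemma mp_rodr_continuous: "mp_rot_gen X \<Longrightarrow> continuous_on T (mp_rodr X)"
  by (meson continuous_on_eq_continuous_within has_vector_derivative_continuous mp_rodr_deriv)

text \<open>For \<open>P s t = g exp(s X) exp(t Y)\<close> the partial derivative in
  \<open>t\<close> follows \<open>Y\<close>, while the one in \<open>s\<close> follows
  \<open>W t\<close>, the conjugate of \<open>X\<close> by \<open>exp(-t Y)\<close>. The derivative
  of \<open>W\<close> at 0 is \<open>bracket X Y\<close>, so equality of the mixed partials of
  \<open>f\<close> along \<open>P\<close> is the commutator formula.\<close>

lemma commutator_generators:
  fixes f :: "mpair \<Rightarrow> real"
  assumes f: "smooth_G f" and X: "mp_rot_gen X" and Y: "mp_rot_gen Y" and g: "g \<in> G_grp"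
  shows "dir_deriv (\<lambda>a. dir_deriv f a Y) g X - dir_deriv (\<lambda>a. dir_deriv f a X) g Y = dir_deriv f g (bracket X Y)"
proof -
  define P where "P s t = g \<bullet>\<^sub>G mp_rodr X s \<bullet>\<^sub>G mp_rodr Y t" for s t
  define W where "W t = mp_transp (mp_rodr Y t) \<bullet>\<^sub>G X \<bullet>\<^sub>G mp_rodr Y t" for t
  define h where "h a = dir_deriv f a Y" for a
  have XA: "X \<in> G_alg" and YA: "Y \<in> G_alg" using X Y mp_rot_gen_alg by auto
  have h: "smooth_G h" unfolding h_def by (rule smooth_G_dir_deriv [OF f YA])
  have PG: "P s t \<in> G_grp" for s t
    by (simp add: P_def G_mult g mp_rodr_G X Y)
  have WA: "W t \<in> G_alg" for t
    unfolding W_def by (intro conj_G_alg XA mp_rodr_G Y)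
  have W0: "W 0 = X" by (simp add: W_def mp_transp_def mp_one_def mp_mult_def)
  have Pt: "(P s has_vector_derivative P s t \<bullet>\<^sub>G Y) (at t)" for s t
    using bounded_linear.has_vector_derivative [OF mp.bounded_linear_right mp_rodr_deriv [OF Y],
        of "g \<bullet>\<^sub>G mp_rodr X s" t UNIV]
    unfolding P_def by (simp add: mp_assoc)
  have Ps: "((\<lambda>s. P s t) has_vector_derivative P s t \<bullet>\<^sub>G W t) (at s)" for s t
  proof -
    have "((\<lambda>s. (g \<bullet>\<^sub>G mp_rodr X s) \<bullet>\<^sub>G mp_rodr Y t) has_vector_derivative (g \<bullet>\<^sub>G (mp_rodr X s \<bullet>\<^sub>G X)) \<bullet>\<^sub>G mp_rodr Y t) (at s)"
      by (intro bounded_linear.has_vector_derivative [OF mp.bounded_linear_left]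
          bounded_linear.has_vector_derivative [OF mp.bounded_linear_right] mp_rodr_deriv X)
    moreover have "P s t \<bullet>\<^sub>G W t = (g \<bullet>\<^sub>G (mp_rodr X s \<bullet>\<^sub>G X)) \<bullet>\<^sub>G mp_rodr Y t"
      by (simp add: P_def W_def mp_assoc G_transp_cancel mp_rodr_G [OF Y])
    ultimately show ?thesis by (simp add: P_def)
  qed
  have W': "(W has_vector_derivative bracket X Y) (at 0)"
  proof -
    note D = mp_rodr_deriv [OF Y, of 0 UNIV]
    have "((\<lambda>t. mp_transp (mp_rodr Y t) \<bullet>\<^sub>G X) has_vector_derivative mp_transp (mp_rodr Y 0 \<bullet>\<^sub>G Y) \<bullet>\<^sub>G X) (at 0)"
      by (intro bounded_linear.has_vector_derivative [OF mp.bounded_linear_left]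
          bounded_linear.has_vector_derivative [OF bounded_linear_mp_transp] D)
    from mp.has_vector_derivative [OF this D]
    have "(W has_vector_derivative (mp_transp (mp_rodr Y 0) \<bullet>\<^sub>G X) \<bullet>\<^sub>G (mp_rodr Y 0 \<bullet>\<^sub>G Y)
        + mp_transp (mp_rodr Y 0 \<bullet>\<^sub>G Y) \<bullet>\<^sub>G X \<bullet>\<^sub>G mp_rodr Y 0) (at 0)"
      by (simp add: W_def [abs_def])
    moreover have "(mp_transp (mp_rodr Y 0) \<bullet>\<^sub>G X) \<bullet>\<^sub>G (mp_rodr Y 0 \<bullet>\<^sub>G Y)
        + mp_transp (mp_rodr Y 0 \<bullet>\<^sub>G Y) \<bullet>\<^sub>G X \<bullet>\<^sub>G mp_rodr Y 0 = bracket X Y"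
      using YA W0 unfolding W_def by (simp add: mem_G_alg bracket_def mp.minus_left)
    ultimately show ?thesis by simp
  qed
  have along_t: "((\<lambda>t. k (P s t)) has_real_derivative dir_deriv k (P s t) Y) (at t)" if "smooth_G k" for k :: "mpair \<Rightarrow> real" and s t
    unfolding has_vector_derivative_real_iff [symmetric]
    by (rule dir_deriv_curve [OF smooth_G_differentiable [OF that PG] _ Pt]) (auto simp: PG)
  have along_s: "((\<lambda>s. k (P s t)) has_real_derivative dir_deriv k (P s t) (W t)) (at s)" if "smooth_G k" for k :: "mpair \<Rightarrow> real" and s t
    unfolding has_vector_derivative_real_iff [symmetric]
    by (rule dir_deriv_curve [where c = "\<lambda>s. P s t", OF smooth_G_differentiable [OF that PG] _ Ps]) (auto simp: PG)
  have Pcont: "continuous_on UNIV (\<lambda>p. P (fst p) (snd p))"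
    unfolding P_def 
    by (intro mp.continuous_on continuous_intros continuous_on_compose2 [OF mp_rodr_continuous [OF X, of UNIV]]
        continuous_on_compose2 [OF mp_rodr_continuous [OF Y, of UNIV]]) auto
  have Wcont: "continuous_on UNIV W"
    unfolding W_def
    by (intro mp.continuous_on continuous_intros mp_rodr_continuous Y bounded_linear.continuous_on [OF bounded_linear_mp_transp])
  \<comment> \<open>The derivative at \<open>t = 0\<close> of the \<open>s\<close>-derivative at
    \<open>s = 0\<close>: the first summand differentiates \<open>f\<close> along a fixed direction,
    the second the direction \<open>W t\<close>.\<close>
  define M where "M = (\<Sum>b\<in>Basis. (X \<bullet> b) * dir_deriv (\<lambda>a. dir_deriv f a (skew_proj b)) g Y
        + (bracket X Y \<bullet> b) * dir_deriv f g (skew_proj b))"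
  have "M = dir_deriv h (P 0 0) (W 0)"
  proof (rule mixed_partials_eq [where F = "\<lambda>s t. f (P s t)" and Fts = "\<lambda>s t. dir_deriv h (P s t) (W t)"])
    show "((\<lambda>t. f (P s t)) has_real_derivative h (P s t)) (at t)" for s t
      using along_t [OF f] by (simp add: h_def)
    show "((\<lambda>s. h (P s t)) has_real_derivative dir_deriv h (P s t) (W t)) (at s)" for s t
      by (rule along_s [OF h])
    show "((\<lambda>s. f (P s t)) has_real_derivative dir_deriv f (P 0 t) (W t)) (at 0)" for t
      by (rule along_s [OF f])
    have "continuous_on UNIV (\<lambda>p. \<Sum>b\<in>Basis. (W (snd p) \<bullet> b) * dir_deriv h (P (fst p) (snd p)) (skew_proj b))"
      by (intro continuous_on_sum continuous_on_mult continuous_on_inner continuous_on_const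
          continuous_on_compose2 [OF Wcont] continuous_on_snd continuous_on_id
          continuous_on_compose2 [OF smooth_G_continuous_on [OF smooth_G_dir_deriv [OF h skew_proj_G_alg]] Pcont])
        (auto simp: PG)
    then have "continuous_on UNIV (\<lambda>p. dir_deriv h (P (fst p) (snd p)) (W (snd p)))"
      by (subst dir_deriv_basis_sum [OF smooth_G_differentiable [OF h PG] WA]) simp
    then show "isCont (\<lambda>p. dir_deriv h (P (fst p) (snd p)) (W (snd p))) (0, 0)"
      by (simp add: continuous_on_eq_continuous_at)
    have "((\<lambda>t. \<Sum>b\<in>Basis. (W t \<bullet> b) * dir_deriv f (P 0 t) (skew_proj b)) has_real_derivative
       (\<Sum>b\<in>Basis. (W 0 \<bullet> b) * dir_deriv (\<lambda>a. dir_deriv f a (skew_proj b)) (P 0 0) Y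
        + (bracket X Y \<bullet> b) * dir_deriv f (P 0 0) (skew_proj b))) (at 0)"
      by (intro DERIV_sum DERIV_mult' along_t smooth_G_dir_deriv [OF f skew_proj_G_alg]
          bounded_linear.has_vector_derivative [OF bounded_linear_inner_left W', unfolded has_vector_derivative_real_iff])
    then show "((\<lambda>t. dir_deriv f (P 0 t) (W t)) has_real_derivative M) (at 0)"
      by (subst dir_deriv_basis_sum [OF smooth_G_differentiable [OF f PG] WA]) (simp add: M_def W0 P_def)
  qed
  also have "\<dots> = dir_deriv h g X"
    by (simp add: W0 P_def)
  finally have "M = dir_deriv h g X" .
  moreover have "M = dir_deriv (\<lambda>a. dir_deriv f a X) g Y + dir_deriv f g (bracket X Y)"
  proof -
    have D: "(\<lambda>a. dir_deriv f a (skew_proj b)) differentiable (at g within G_grp)" for b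
      by (rule smooth_G_differentiable [OF smooth_G_dir_deriv [OF f skew_proj_G_alg] g])
    have "dir_deriv (\<lambda>a. dir_deriv f a X) g Y = dir_deriv (\<lambda>a. \<Sum>b\<in>Basis. (X \<bullet> b) *\<^sub>R dir_deriv f a (skew_proj b)) g Y"
      by (rule dir_deriv_cong [OF _ g]) (rule dir_deriv_basis_sum [OF smooth_G_differentiable [OF f] XA])
    also have "\<dots> = (\<Sum>b\<in>Basis. (X \<bullet> b) *\<^sub>R dir_deriv (\<lambda>a. dir_deriv f a (skew_proj b)) g Y)"
      by (rule trans [OF dir_deriv_sum [OF g YA]])
        (simp_all only: differentiableI [OF has_dir_deriv_linear [OF bounded_linear_scaleR_right D]]
          dir_deriv_bounded_linear [OF g YA bounded_linear_scaleR_right D])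
    finally show ?thesis
      by (simp add: M_def sum.distrib dir_deriv_basis_sum [OF smooth_G_differentiable [OF f g] bracket_G_alg [OF XA YA]])
  qed
  ultimately show ?thesis by (simp add: h_def [abs_def])
qed

lemma bracket_add: "bracket (X + X') Y = bracket X Y + bracket X' Y" "bracket X (Y + Y') = bracket X Y + bracket X Y'"
  and bracket_scaleR: "bracket (r *\<^sub>R X) Y = r *\<^sub>R bracket X Y" "bracket X (r *\<^sub>R Y) = r *\<^sub>R bracket X Y"
  by (simp_all add: bracket_def mp.add_left mp.add_right mp.scaleR_left mp.scaleR_right algebra_simps)

lemma bounded_bilinear_bracket: "bounded_bilinear bracket"
  unfolding bilinear_conv_bounded_bilinear [symmetric] bilinear_def
  by (intro conjI allI linearI) (simp_all only: bracket_add bracket_scaleR)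

lemma dir_deriv_dir_deriv_linear:
  fixes f :: "mpair \<Rightarrow> 'b::real_normed_vector"
  assumes f: "smooth_G f" and g: "g \<in> G_grp" and X: "X \<in> G_alg" "X' \<in> G_alg" and Y: "Y \<in> G_alg"
  shows "dir_deriv (\<lambda>a. dir_deriv f a (X + X')) g Y = dir_deriv (\<lambda>a. dir_deriv f a X) g Y + dir_deriv (\<lambda>a. dir_deriv f a X') g Y"
    and "dir_deriv (\<lambda>a. dir_deriv f a (r *\<^sub>R X)) g Y = r *\<^sub>R dir_deriv (\<lambda>a. dir_deriv f a X) g Y"
proof -
  note lin = dir_deriv_linear [OF smooth_G_differentiable [OF f]]
  note D = smooth_G_differentiable [OF smooth_G_dir_deriv [OF f] g]
  show "dir_deriv (\<lambda>a. dir_deriv f a (X + X')) g Y = dir_deriv (\<lambda>a. dir_deriv f a X) g Y + dir_deriv (\<lambda>a. dir_deriv f a X') g Y"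
    by (rule trans [OF dir_deriv_cong [OF linear_add [OF lin] g] dir_deriv_add [OF g Y D D]]) (use X in auto)
  show "dir_deriv (\<lambda>a. dir_deriv f a (r *\<^sub>R X)) g Y = r *\<^sub>R dir_deriv (\<lambda>a. dir_deriv f a X) g Y"
    by (rule trans [OF dir_deriv_cong [OF linear_scale [OF lin] g] dir_deriv_bounded_linear [OF g Y bounded_linear_scaleR_right D]])
      (use X in auto)
qed

lemma commutator_real:
  fixes f :: "mpair \<Rightarrow> real"
  assumes f: "smooth_G f" and g: "g \<in> G_grp" and "X \<in> G_alg" and "Y \<in> G_alg"
  shows "dir_deriv (\<lambda>a. dir_deriv f a Y) g X - dir_deriv (\<lambda>a. dir_deriv f a X) g Y = dir_deriv f g (bracket X Y)"
proof -
  let ?C = "\<lambda>X Y. dir_deriv (\<lambda>a. dir_deriv f a Y) g X - dir_deriv (\<lambda>a. dir_deriv f a X) g Y = dir_deriv f g (bracket X Y)"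
  let ?B = "range a_vec \<union> range b_vec"
  note lin = dir_deriv_linear [OF smooth_G_differentiable [OF f g]]
  note lin2 = dir_deriv_linear [OF smooth_G_differentiable [OF smooth_G_dir_deriv [OF f] g]]
  note DL = dir_deriv_dir_deriv_linear [OF f g]
  have zero: "dir_deriv (\<lambda>a. dir_deriv f a 0) g X = 0" if "X \<in> G_alg" for X
    using DL(2) [of 0 0 X 0] that by (auto simp: subspace_0 [OF subspace_G_alg])
  note simps = linear_add [OF lin] linear_scale [OF lin] linear_0 [OF lin] linear_add [OF lin2] linear_scale [OF lin2]
    linear_0 [OF lin2] DL zero bracket_add bracket_scaleR bounded_bilinear.zero_left [OF bounded_bilinear_bracket]
    bounded_bilinear.zero_right [OF bounded_bilinear_bracket] subspace_add [OF subspace_G_alg] subspace_scale [OF subspace_G_alg]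
    subspace_0 [OF subspace_G_alg]
  have gen: "mp_rot_gen Z" if "Z \<in> ?B" for Z using that by auto
  \<comment> \<open>Membership in \<open>G_alg\<close> is carried through the induction, because
    linearity of the second derivatives in the inner direction is available only there.\<close>
  have 1: "X \<in> G_alg \<and> ?C X Y" if Y: "Y \<in> ?B" and X: "X \<in> span ?B" for X Y
    using X
  proof (induction rule: span_induct)
    case base
    have "Y \<in> G_alg" using Y by auto
    then show ?case
      by (auto simp: subspace_def simps) (simp_all add: algebra_simps)
  next
    case (step Z)
    then show ?case
      using commutator_generators [OF f gen gen g] Y mp_rot_gen_alg [OF gen] by blast
  qed
  have "Y \<in> G_alg \<and> ?C X Y" if X: "X \<in> G_alg" and Y: "Y \<in> span ?B"
    using Y
  proof (induction rule: span_induct)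
    case base
    show ?case
      using X by (auto simp: subspace_def simps) (simp_all add: algebra_simps)
  next
    case (step Z)
    then show ?case
      using 1 X mp_rot_gen_alg [OF gen] G_alg_eq_span by blast
  qed
  then show ?thesis using assms G_alg_eq_span by blast
qed

lemma commutator:
  fixes f :: "mpair \<Rightarrow> 'b::euclidean_space"
  assumes f: "smooth_G f" and g: "g \<in> G_grp" and X: "X \<in> G_alg" and Y: "Y \<in> G_alg"
  shows "dir_deriv (\<lambda>a. dir_deriv f a Y) g X - dir_deriv (\<lambda>a. dir_deriv f a X) g Y = dir_deriv f g (bracket X Y)"
proof (rule euclidean_eqI)
  fix b :: 'b assume "b \<in> Basis"
  note L = bounded_linear_inner_left [of b]
  have 1: "dir_deriv f a Z \<bullet> b = dir_deriv (\<lambda>a. f a \<bullet> b) a Z" if "Z \<in> G_alg" "a \<in> G_grp" for a Z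
    by (rule dir_deriv_bounded_linear [OF that(2,1) L smooth_G_differentiable [OF f that(2)], symmetric])
  have 2: "dir_deriv (\<lambda>a. dir_deriv f a Z) g Z' \<bullet> b = dir_deriv (\<lambda>a. dir_deriv (\<lambda>a. f a \<bullet> b) a Z) g Z'"
    if "Z \<in> G_alg" "Z' \<in> G_alg" for Z Z'
    by (rule trans [OF dir_deriv_bounded_linear [OF g that(2) L smooth_G_differentiable [OF smooth_G_dir_deriv [OF f that(1)] g], symmetric]
          dir_deriv_cong [OF 1 [OF that(1)] g]])
  show "(dir_deriv (\<lambda>a. dir_deriv f a Y) g X - dir_deriv (\<lambda>a. dir_deriv f a X) g Y) \<bullet> b = dir_deriv f g (bracket X Y) \<bullet> b"
    using commutator_real [OF smooth_G_bounded_linear [OF f L] g X Y] 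
    by (simp add: inner_diff_left 1 2 X Y g bracket_G_alg)
qed

subsection \<open>Coordinates on the Lie algebra\<close>

lemma exhaust_5: fixes x :: 5 obtains "x = 1" | "x = 2" | "x = 3" | "x = 4" | "x = 5"
proof (induct x)
  case (of_int z)
  then have "z = 0 \<or> z = 1 \<or> z = 2 \<or> z = 3 \<or> z = 4" by auto
  then show ?case using of_int by auto
qed

lemma forall_5: "(\<forall>i::5. P i) \<longleftrightarrow> P 1 \<and> P 2 \<and> P 3 \<and> P 4 \<and> P 5"
  by (metis exhaust_5)

lemma UNIV_5: "UNIV = {1, 2, 3, 4, 5::5}"
  using exhaust_5 by auto

lemma sum_5: "sum f (UNIV :: 5 set) = f 1 + f 2 + f 3 + f 4 + f 5"
  unfolding UNIV_5 by (simp add: ac_simps)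

definition vec5 :: "real \<Rightarrow> real \<Rightarrow> real \<Rightarrow> real \<Rightarrow> real \<Rightarrow> real^5"
  where "vec5 a b c d e = (\<chi> i. if i = 1 then a else if i = 2 then b else if i = 3 then c else if i = 4 then d else e)"

lemma vec5_nth [simp]: "vec5 a b c d e $ 1 = a" "vec5 a b c d e $ 2 = b" "vec5 a b c d e $ 3 = c"
    "vec5 a b c d e $ 4 = d" "vec5 a b c d e $ 5 = e"
  by (simp_all add: vec5_def)

lemma vec5_eq_iff: "x = y \<longleftrightarrow> x $ 1 = y $ 1 \<and> x $ 2 = y $ 2 \<and> x $ 3 = y $ 3 \<and> x $ 4 = y $ 4 \<and> x $ 5 = (y :: real^5) $ 5"
  by (simp add: vec_eq_iff forall_5)

text \<open>The entries used are the coefficients of \<open>s_mat 1\<close>, \<open>s_mat 2\<close>,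
  \<open>s_mat 3\<close>. The divisor 5 comes from \<open>5 a_3 = e_tilde0 - 2 e_tilde 1\<close> and
  \<open>5 b_3 = 2 e_tilde0 + e_tilde 1\<close>, which also explain the fifths in
  \<open>m_brk\<close> and \<open>h_brk\<close>.\<close>

definition m_coord :: "mpair \<Rightarrow> real^5"
  where "m_coord X = vec5 ((snd X $ 2 $ 1 - 2 * fst X $ 2 $ 1) / 5) (fst X $ 3 $ 2) (fst X $ 1 $ 3) (snd X $ 3 $ 2) (snd X $ 1 $ 3)"

definition h_coord :: "mpair \<Rightarrow> real"
  where "h_coord X = (fst X $ 2 $ 1 + 2 * snd X $ 2 $ 1) / 5"

definition m_vec :: "real^5 \<Rightarrow> mpair"
  where "m_vec x = (\<Sum>i\<in>UNIV. x $ i *\<^sub>R e_tilde i)"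

lemma linear_m_coord: "linear m_coord"
  by (intro linearI) (simp_all add: m_coord_def vec5_eq_iff field_simps)

lemma linear_h_coord: "linear h_coord"
  by (intro linearI) (simp_all add: h_coord_def field_simps)

lemma linear_m_vec: "linear m_vec"
  by (intro linearI) (simp_all add: m_vec_def scaleR_left_distrib sum.distrib scaleR_sum_right)

lemmas bounded_linear_m_coord = linear_m_coord [unfolded linear_conv_bounded_linear]
lemmas bounded_linear_m_vec = linear_m_vec [unfolded linear_conv_bounded_linear]

lemma m_vec_def': "m_vec x = ((x $ 2) *\<^sub>R s_mat 1 + (x $ 3) *\<^sub>R s_mat 2 - (2 * x $ 1) *\<^sub>R s_mat 3,
    (x $ 4) *\<^sub>R s_mat 1 + (x $ 5) *\<^sub>R s_mat 2 + (x $ 1) *\<^sub>R s_mat 3)"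
  by (simp add: m_vec_def sum_5 e_tilde_def a_vec_def b_vec_def)

lemma e_tilde0_def': "e_tilde0 = (s_mat 3, 2 *\<^sub>R s_mat 3)"
  by (simp add: e_tilde0_def a_vec_def b_vec_def)

lemma s_mat_nth: "s_mat 1 $ i $ j = (if i = 3 \<and> j = 2 then 1 else if i = 2 \<and> j = 3 then - 1 else 0)"
    "s_mat 2 $ i $ j = (if i = 1 \<and> j = 3 then 1 else if i = 3 \<and> j = 1 then - 1 else 0)"
    "s_mat 3 $ i $ j = (if i = 2 \<and> j = 1 then 1 else if i = 1 \<and> j = 2 then - 1 else 0)"
  by (simp_all add: s_mat_def E_mat_def)

lemma m_coord_m_vec [simp]: "m_coord (m_vec x) = x"
  and h_coord_m_vec [simp]: "h_coord (m_vec x) = 0"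
  and m_coord_e_tilde0 [simp]: "m_coord e_tilde0 = 0"
  and h_coord_e_tilde0 [simp]: "h_coord e_tilde0 = 1"
  by (simp_all add: m_coord_def h_coord_def m_vec_def' e_tilde0_def' s_mat_nth vec5_eq_iff)

lemma m_vec_axis: "m_vec (axis i 1) = e_tilde i"
proof -
  have "m_vec (axis i 1) = (\<Sum>j\<in>UNIV. if j = i then e_tilde j else 0)"
    unfolding m_vec_def by (intro sum.cong) (auto simp: axis_def)
  then show ?thesis by simp
qed

lemma m_coord_e_tilde: "m_coord (e_tilde i) = axis i 1"
  by (metis m_coord_m_vec m_vec_axis)

lemma e_tilde_G_alg [simp]: "e_tilde i \<in> G_alg" "e_tilde0 \<in> G_alg"
  by (simp_all add: e_tilde_def e_tilde0_def subspace_add subspace_diff subspace_scale subspace_G_alg)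

lemma m_vec_G_alg [simp]: "m_vec x \<in> G_alg"
  unfolding m_vec_def by (intro subspace_sum subspace_G_alg subspace_scale) simp

lemma inj_e_tilde: "inj e_tilde"
  by (metis (no_types, lifting) axis_eq_axis injI m_coord_e_tilde zero_neq_one)

lemma m_sp_eq: "m_sp = range m_vec"
proof
  show "m_sp \<subseteq> range m_vec"
    unfolding m_sp_def
    by (rule span_minimal) (auto simp: linear_subspace_image [OF linear_m_vec] m_vec_axis [symmetric])
  show "range m_vec \<subseteq> m_sp"
    unfolding m_sp_def m_vec_def by (intro image_subsetI span_sum span_scale span_base rangeI)
qed

lemma m_vec_m_sp [simp]: "m_vec x \<in> m_sp"
  by (simp add: m_sp_eq)

lemma m_sp_iff: "X \<in> m_sp \<longleftrightarrow> m_vec (m_coord X) = X"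
  by (metis m_coord_m_vec m_sp_eq rangeE rangeI)

lemma m_vec_coord: "X \<in> m_sp \<Longrightarrow> m_vec (m_coord X) = X"
  by (simp add: m_sp_iff)

lemma m_sp_G_alg: "X \<in> m_sp \<Longrightarrow> X \<in> G_alg"
  by (metis m_sp_iff m_vec_G_alg)

lemma subspace_m_sp: "subspace m_sp"
  by (simp add: m_sp_def)

lemma reductive_decomp:
  assumes "X \<in> G_alg" shows "X = m_vec (m_coord X) + h_coord X *\<^sub>R e_tilde0"
  by (subst G_alg_decomp [OF assms])
    (simp add: m_vec_def' e_tilde0_def' m_coord_def h_coord_def a_vec_def b_vec_def
      scaleR_left_distrib [symmetric] scaleR_left_diff_distrib [symmetric] field_simps)

lemma G_alg_eqI:
  assumes "X \<in> G_alg" "Y \<in> G_alg" "m_coord X = m_coord Y" "h_coord X = h_coord Y" shows "X = Y"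
  using reductive_decomp [OF assms(1)] reductive_decomp [OF assms(2)] assms(3,4) by simp

lemma m_part_eq:
  assumes "X \<in> G_alg" shows "m_part X = m_vec (m_coord X)"
  unfolding m_part_def
proof (rule the_equality)
  show "m_vec (m_coord X) \<in> m_sp \<and> X - m_vec (m_coord X) \<in> H_alg"
    using reductive_decomp [OF assms] by (simp add: H_alg_def span_singleton) (metis add_diff_cancel_left' rangeI)
  fix Y assume Y: "Y \<in> m_sp \<and> X - Y \<in> H_alg"
  then obtain r where "X - Y = r *\<^sub>R e_tilde0" by (auto simp: H_alg_def span_singleton)
  then have "m_coord (X - Y) = 0" by (simp add: linear_scale [OF linear_m_coord])
  then have "m_coord X = m_coord Y" by (simp add: linear_diff [OF linear_m_coord])
  then show "Y = m_vec (m_coord X)" using Y by (simp add: m_vec_coord)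
qed

lemma independent_e_tilde: "independent (range e_tilde)"
proof -
  have "range e_tilde = m_vec ` Basis"
    unfolding Basis_vec_def by (auto simp: m_vec_axis [symmetric])
  moreover have "inj m_vec"
    by (metis injI m_coord_m_vec)
  ultimately show ?thesis
    using linear_independent_injective_image [OF linear_m_vec independent_Basis] inj_on_subset by auto
qed

lemma representation_m_vec: "representation (range e_tilde) (m_vec x) (e_tilde j) = x $ j"
proof -
  have "representation (range e_tilde) (m_vec x) = (\<lambda>v. \<Sum>i\<in>UNIV. representation (range e_tilde) (x $ i *\<^sub>R e_tilde i) v)"
    unfolding m_vec_def by (rule representation_sum [OF independent_e_tilde]) (auto intro: span_scale span_base)
  then have "representation (range e_tilde) (m_vec x) (e_tilde j) = (\<Sum>i\<in>UNIV. x $ i * (if e_tilde j = e_tilde i then 1 else 0))"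
    by (simp add: representation_scale [OF independent_e_tilde] span_base representation_basis [OF independent_e_tilde])
  also have "\<dots> = (\<Sum>i\<in>UNIV. if i = j then x $ i else 0)"
    by (intro sum.cong) (use inj_e_tilde in \<open>auto dest: injD\<close>)
  finally show ?thesis by simp
qed

definition inner5 :: "real \<Rightarrow> real \<Rightarrow> real \<Rightarrow> real^5 \<Rightarrow> real^5 \<Rightarrow> real"
  where "inner5 \<alpha> \<beta> \<gamma> x y = \<alpha> * x $ 1 * y $ 1 + \<beta> * (x $ 2 * y $ 2 + x $ 3 * y $ 3) + \<gamma> * (x $ 4 * y $ 4 + x $ 5 * y $ 5)"

lemma metric_m_vec: "metric \<alpha> \<beta> \<gamma> (m_vec x) (m_vec y) = inner5 \<alpha> \<beta> \<gamma> x y"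
  by (simp add: metric_def representation_m_vec sum_5 metric_diag_def inner5_def algebra_simps)

lemma metric_m_sp: "X \<in> m_sp \<Longrightarrow> Y \<in> m_sp \<Longrightarrow> metric \<alpha> \<beta> \<gamma> X Y = inner5 \<alpha> \<beta> \<gamma> (m_coord X) (m_coord Y)"
  by (metis m_vec_coord metric_m_vec)

definition m_brk :: "real^5 \<Rightarrow> real^5 \<Rightarrow> real^5"
  where "m_brk x y = vec5 (- 2/5 * (x $ 2 * y $ 3 - x $ 3 * y $ 2) + 1/5 * (x $ 4 * y $ 5 - x $ 5 * y $ 4))
    (2 * (x $ 1 * y $ 3 - x $ 3 * y $ 1)) (- 2 * (x $ 1 * y $ 2 - x $ 2 * y $ 1))
    (- (x $ 1 * y $ 5 - x $ 5 * y $ 1)) (x $ 1 * y $ 4 - x $ 4 * y $ 1)"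

definition h_brk :: "real^5 \<Rightarrow> real^5 \<Rightarrow> real"
  where "h_brk x y = 1/5 * (x $ 2 * y $ 3 - x $ 3 * y $ 2) + 2/5 * (x $ 4 * y $ 5 - x $ 5 * y $ 4)"

text \<open>The adjoint action of \<open>e_tilde0\<close>: it turns the plane of \<open>a_1\<close>,
  \<open>a_2\<close> with speed 1 and that of \<open>b_1\<close>, \<open>b_2\<close> with speed 2,
  as dictated by \<open>A\<close> mapping to the pair of \<open>A\<close> and its square.\<close>

definition ad_h :: "real^5 \<Rightarrow> real^5"
  where "ad_h y = vec5 0 (- y $ 3) (y $ 2) (- 2 * y $ 5) (2 * y $ 4)"

lemma bracket_m_vec: "bracket (m_vec x) (m_vec y) = m_vec (m_brk x y) + h_brk x y *\<^sub>R e_tilde0"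
proof (rule G_alg_eqI)
  show "m_vec (m_brk x y) + h_brk x y *\<^sub>R e_tilde0 \<in> G_alg"
    by (simp add: subspace_add subspace_scale subspace_G_alg)
  show "m_coord (bracket (m_vec x) (m_vec y)) = m_coord (m_vec (m_brk x y) + h_brk x y *\<^sub>R e_tilde0)"
    unfolding linear_add [OF linear_m_coord] linear_scale [OF linear_m_coord] m_coord_m_vec m_coord_e_tilde0
    by (simp add: bracket_def mp_mult_def m_vec_def' m_coord_def m_brk_def
      matrix_matrix_mult_def sum_3 s_mat_nth vec5_eq_iff field_simps)
  show "h_coord (bracket (m_vec x) (m_vec y)) = h_coord (m_vec (m_brk x y) + h_brk x y *\<^sub>R e_tilde0)"
    unfolding linear_add [OF linear_h_coord] linear_scale [OF linear_h_coord] h_coord_m_vec h_coord_e_tilde0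
    by (simp add: bracket_def mp_mult_def m_vec_def' h_coord_def h_brk_def
      matrix_matrix_mult_def sum_3 s_mat_nth field_simps)
qed (simp add: bracket_G_alg)

subsection \<open>The isotropy group\<close>

lemma mat_exp_rodr:
  assumes "rot_gen S" shows "mat_exp (t *\<^sub>R S) = rodr S t"
proof -
  define T where "T = S ** S"
  have T: "S ** S = T" "S ** T = - S"
    using rot_gen_powers [OF assms] by (simp_all add: T_def)
  have ST: "S ** (a *\<^sub>R S + (- b) *\<^sub>R T + d *\<^sub>R (mat 1 + T)) = a *\<^sub>R T + b *\<^sub>R S" for a b d
    by (simp add: mat_mult.add_right mat_mult.diff_right mat_mult.scaleR_right T)
  \<comment> \<open>The last summand corrects the constant term of the cosine series from
    \<open>- T\<close> to \<open>mat 1\<close>. It does not propagate, since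
    \<open>S ** (mat 1 + T) = 0\<close>.\<close>
  have pow: "(1 / fact n) *\<^sub>R (((**) (t *\<^sub>R S) ^^ n) (mat 1)) =
      (sin_coeff n * t ^ n) *\<^sub>R S + (- (cos_coeff n * t ^ n)) *\<^sub>R T + (if n = 0 then 1 else 0) *\<^sub>R (mat 1 + T)" for n
  proof (induction n)
    case 0
    then show ?case by (simp add: sin_coeff_def cos_coeff_def)
  next
    case (Suc n)
    have "(1 / fact (Suc n)) *\<^sub>R (((**) (t *\<^sub>R S) ^^ Suc n) (mat 1)) =
      (t / Suc n) *\<^sub>R (S ** ((1 / fact n) *\<^sub>R (((**) (t *\<^sub>R S) ^^ n) (mat 1))))"
      by (simp add: mat_mult.scaleR_left mat_mult.scaleR_right)
    also have "\<dots> = (t / Suc n) *\<^sub>R ((sin_coeff n * t ^ n) *\<^sub>R T + (cos_coeff n * t ^ n) *\<^sub>R S)"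
      unfolding Suc by (simp only: ST)
    also have "\<dots> = (sin_coeff (Suc n) * t ^ Suc n) *\<^sub>R S + (- (cos_coeff (Suc n) * t ^ Suc n)) *\<^sub>R T
        + (if Suc n = 0 then 1 else 0) *\<^sub>R (mat 1 + T)"
      by (simp add: sin_coeff_Suc cos_coeff_Suc scaleR_add_right mult_ac)
    finally show ?case .
  qed
  have "(\<lambda>n. (sin_coeff n * t ^ n) *\<^sub>R S + (- (cos_coeff n * t ^ n)) *\<^sub>R T + (if n = 0 then 1 else 0) *\<^sub>R (mat 1 + T))
      sums (sin t *\<^sub>R S + (- cos t) *\<^sub>R T + 1 *\<^sub>R (mat 1 + T))"
  proof (intro sums_add sums_scaleR_left)
    show "(\<lambda>n. sin_coeff n * t ^ n) sums sin t"
      using sin_converges [of t] by simp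
    show "(\<lambda>n. - (cos_coeff n * t ^ n)) sums - cos t"
      using sums_minus [OF cos_converges [of t]] by simp
    show "(\<lambda>n. if n = 0 then 1 else 0) sums (1::real)"
      using sums_single [of 0 "\<lambda>_. 1::real"] by simp
  qed
  also have "sin t *\<^sub>R S + (- cos t) *\<^sub>R T + 1 *\<^sub>R (mat 1 + T) = rodr S t"
    by (simp add: rodr_def T algebra_simps)
  finally show ?thesis
    unfolding mat_exp_def pow by (simp add: sums_iff)
qed

definition h_elem :: "real \<Rightarrow> mpair"
  where "h_elem t = (rodr (s_mat 3) t, rodr (s_mat 3) (2 * t))"

lemma H_grp_eq: "H_grp = range h_elem"
proof -
  have "(mat_exp (t *\<^sub>R s_mat 3), mat_exp (t *\<^sub>R s_mat 3) ** mat_exp (t *\<^sub>R s_mat 3)) = h_elem t" for t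
    unfolding mat_exp_rodr [OF rot_gen_s_mat] rodr_add [OF rot_gen_s_mat, symmetric] h_elem_def by (simp only: mult_2)
  then show ?thesis unfolding H_grp_def SO2_def image_image by simp
qed

lemma h_elem_G [simp]: "h_elem t \<in> G_grp"
  by (simp add: h_elem_def G_grp_def rodr_rotation rot_gen_s_mat)

lemma mp_inv_h_elem: "mp_inv (h_elem t) = h_elem (- t)"
  by (simp add: mp_inv_G mp_transp_def) (simp add: h_elem_def rodr_transpose rot_gen_s_mat)

lemma h_elem_0 [simp]: "h_elem 0 = 1\<^sub>G"
  by (simp add: h_elem_def mp_one_def)

lemma h_elem_deriv: "(h_elem has_vector_derivative h_elem t \<bullet>\<^sub>G e_tilde0) (at t within T)"
proof -
  have "((\<lambda>t. rodr (s_mat 3) (2 * t)) has_vector_derivative 2 *\<^sub>R (rodr (s_mat 3) (2 * t) ** s_mat 3)) (at t within T)"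
    using vector_diff_chain_within [of "\<lambda>t. 2 * t" 2 t T "rodr (s_mat 3)", OF _ rodr_has_vector_derivative [OF rot_gen_s_mat]]
    by (simp add: o_def has_vector_derivative_real_iff DERIV_cmult_Id)
  then show ?thesis
    unfolding h_elem_def [abs_def] e_tilde0_def' mp_mult_def
    by (auto intro!: has_vector_derivative_Pair rodr_has_vector_derivative rot_gen_s_mat simp: mat_mult.scaleR_right)
qed

text \<open>The isotropy representation in coordinates: a trivial line and two planes of weights 1
  and 2.\<close>

definition h_rot :: "real \<Rightarrow> real^5 \<Rightarrow> real^5"
  where "h_rot t x = vec5 (x $ 1) (cos t * x $ 2 - sin t * x $ 3) (sin t * x $ 2 + cos t * x $ 3)
     (cos (2 * t) * x $ 4 - sin (2 * t) * x $ 5) (sin (2 * t) * x $ 4 + cos (2 * t) * x $ 5)"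

lemma rodr_s_mat_3: "rodr (s_mat 3) t $ i $ j =
  (if i = 1 \<and> j = 1 \<or> i = 2 \<and> j = 2 then cos t else if i = 3 \<and> j = 3 then 1
   else if i = 2 \<and> j = 1 then sin t else if i = 1 \<and> j = 2 then - sin t else 0)"
  using exhaust_3 [of i] exhaust_3 [of j]
  by (auto simp: rodr_def mat_def matrix_matrix_mult_def sum_3 s_mat_nth)

lemma Ad_h_elem_e_tilde0: "Ad (h_elem t) e_tilde0 = e_tilde0"
  using rodr_minus [OF rot_gen_s_mat [of 3]] 
  unfolding Ad_def mp_inv_h_elem unfolding e_tilde0_def' mp_mult_def h_elem_def 
  by (simp add: rodr_commute_gen rot_gen_s_mat mat_mult.scaleR_left mat_mult.scaleR_right matrix_mul_assoc [symmetric])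

lemma rodr_conj_s_mat:
  "rodr (s_mat 3) t ** s_mat 1 ** rodr (s_mat 3) (- t) = cos t *\<^sub>R s_mat 1 + sin t *\<^sub>R s_mat 2"
  "rodr (s_mat 3) t ** s_mat 2 ** rodr (s_mat 3) (- t) = cos t *\<^sub>R s_mat 2 - sin t *\<^sub>R s_mat 1"
  "rodr (s_mat 3) t ** s_mat 3 ** rodr (s_mat 3) (- t) = s_mat 3"
proof -
  show "rodr (s_mat 3) t ** s_mat 1 ** rodr (s_mat 3) (- t) = cos t *\<^sub>R s_mat 1 + sin t *\<^sub>R s_mat 2"
    "rodr (s_mat 3) t ** s_mat 2 ** rodr (s_mat 3) (- t) = cos t *\<^sub>R s_mat 2 - sin t *\<^sub>R s_mat 1"
    by (simp_all add: vec_eq_iff forall_3 matrix_matrix_mult_def sum_3 s_mat_nth rodr_s_mat_3)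
  show "rodr (s_mat 3) t ** s_mat 3 ** rodr (s_mat 3) (- t) = s_mat 3"
    by (simp add: rodr_commute_gen rot_gen_s_mat rodr_minus matrix_mul_assoc [symmetric])
qed

lemma Ad_h_elem: "Ad (h_elem t) (m_vec x) = m_vec (h_rot t x)"
  unfolding Ad_def mp_inv_h_elem unfolding h_elem_def m_vec_def' mp_mult_def
  by (simp add: mat_mult.add_left mat_mult.add_right mat_mult.diff_left mat_mult.diff_right
      mat_mult.scaleR_left mat_mult.scaleR_right rodr_conj_s_mat h_rot_def algebra_simps)

subsection \<open>Vector fields and functions on the quotient\<close>

lemma m_coord_Ad_h_elem:
  assumes "X \<in> G_alg"
  shows "m_coord (Ad (h_elem t) X) = h_rot t (m_coord X)"
proof -
  have "linear (Ad (h_elem t))"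
    by (intro linearI) (simp_all add: Ad_def mp.add_left mp.add_right mp.scaleR_left mp.scaleR_right)
  then have "Ad (h_elem t) X = m_vec (h_rot t (m_coord X)) + h_coord X *\<^sub>R e_tilde0"
    by (subst reductive_decomp [OF assms]) (simp add: linear_add linear_scale Ad_h_elem Ad_h_elem_e_tilde0)
  then show ?thesis
    by (simp add: linear_add [OF linear_m_coord] linear_scale [OF linear_m_coord])
qed

lemma V_fields_smooth: "Y \<in> V_fields \<Longrightarrow> smooth_G Y"
  by (simp add: V_fields_def)

lemma V_fields_m_sp: "Y \<in> V_fields \<Longrightarrow> g \<in> G_grp \<Longrightarrow> Y g \<in> m_sp"
  by (simp add: V_fields_def)

lemma V_fields_G_alg: "Y \<in> V_fields \<Longrightarrow> g \<in> G_grp \<Longrightarrow> Y g \<in> G_alg"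
  by (simp add: V_fields_m_sp m_sp_G_alg)

lemma V_fields_equivariant:
  assumes "Y \<in> V_fields" "g \<in> G_grp"
  shows "Y (g \<bullet>\<^sub>G h_elem t) = Ad (h_elem (- t)) (Y g)"
  using assms by (auto simp: V_fields_def H_grp_eq mp_inv_h_elem)

lemma V_fields_coord:
  assumes "Y \<in> V_fields" "g \<in> G_grp"
  shows "Y (g \<bullet>\<^sub>G h_elem t) = m_vec (h_rot (- t) (m_coord (Y g)))"
  by (subst V_fields_equivariant [OF assms], subst m_vec_coord [OF V_fields_m_sp [OF assms], symmetric]) (rule Ad_h_elem)

lemma V_fieldsI:
  assumes "smooth_G Y" "\<And>g. g \<in> G_grp \<Longrightarrow> Y g \<in> m_sp"
    "\<And>g t. g \<in> G_grp \<Longrightarrow> m_coord (Y (g \<bullet>\<^sub>G h_elem t)) = h_rot (- t) (m_coord (Y g))"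
  shows "Y \<in> V_fields"
proof -
  have "Y (g \<bullet>\<^sub>G h_elem t) = Ad (h_elem (- t)) (Y g)" if g: "g \<in> G_grp" for g t
  proof -
    have "Y (g \<bullet>\<^sub>G h_elem t) = m_vec (h_rot (- t) (m_coord (Y g)))"
      using m_vec_coord [OF assms(2) [OF G_mult [OF g h_elem_G]], of t] assms(3) [OF g, of t] by simp
    also have "\<dots> = Ad (h_elem (- t)) (m_vec (m_coord (Y g)))"
      by (simp only: Ad_h_elem)
    finally show ?thesis by (simp only: m_vec_coord [OF assms(2) [OF g]])
  qed
  then show ?thesis using assms(1,2) by (auto simp: V_fields_def H_grp_eq mp_inv_h_elem)
qed

lemma V_funs_invariant: "f \<in> V_funs \<Longrightarrow> g \<in> G_grp \<Longrightarrow> f (g \<bullet>\<^sub>G h_elem t) = f g"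
  by (simp add: V_funs_def H_grp_eq)

lemma dir_deriv_m_sp:
  assumes "Y \<in> V_fields" "g \<in> G_grp" "X \<in> G_alg"
  shows "dir_deriv Y g X \<in> m_sp"
  unfolding m_sp_iff
  by (rule dir_deriv_invariant [OF bounded_linear_compose [OF bounded_linear_m_vec bounded_linear_m_coord, unfolded o_def]
        smooth_G_differentiable [OF V_fields_smooth [OF assms(1)] assms(2)] assms(2,3)])
    (rule m_vec_coord [OF V_fields_m_sp [OF assms(1)]])

lemma vec5_has_vector_derivative:
  assumes "(a has_real_derivative a') (at t within T)" "(b has_real_derivative b') (at t within T)"
    "(c has_real_derivative c') (at t within T)" "(d has_real_derivative d') (at t within T)"
    "(e has_real_derivative e') (at t within T)"
  shows "((\<lambda>t. vec5 (a t) (b t) (c t) (d t) (e t)) has_vector_derivative vec5 a' b' c' d' e') (at t within T)"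
proof -
  have *: "vec5 a b c d e = a *\<^sub>R axis 1 1 + b *\<^sub>R axis 2 1 + c *\<^sub>R axis 3 1 + d *\<^sub>R axis 4 1 + e *\<^sub>R axis 5 1" for a b c d e
    by (simp add: vec5_eq_iff axis_def)
  show ?thesis unfolding *
    by (intro has_vector_derivative_add bounded_linear.has_vector_derivative [OF bounded_linear_scaleR_left]
        assms [folded has_vector_derivative_real_iff])
qed

lemma h_rot_deriv: "((\<lambda>t. h_rot (- t) x) has_vector_derivative - ad_h x) (at 0)"
proof -
  have "((\<lambda>t. h_rot (- t) x) has_vector_derivative vec5 0 (x $ 3) (- x $ 2) (2 * x $ 5) (- 2 * x $ 4)) (at 0)"
    unfolding h_rot_def by (intro vec5_has_vector_derivative; auto intro!: derivative_eq_intros)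
  moreover have "vec5 0 (x $ 3) (- x $ 2) (2 * x $ 5) (- 2 * x $ 4) = - ad_h x"
    by (simp add: ad_h_def vec5_eq_iff)
  ultimately show ?thesis by simp
qed

lemma dir_deriv_e_tilde0_curve:
  assumes "smooth_G f" "g \<in> G_grp"
  shows "((\<lambda>t. f (g \<bullet>\<^sub>G h_elem t)) has_vector_derivative dir_deriv f g e_tilde0) (at 0)"
proof -
  have "((\<lambda>t. f (g \<bullet>\<^sub>G h_elem t)) has_vector_derivative dir_deriv f (g \<bullet>\<^sub>G h_elem 0) e_tilde0) (at 0 within UNIV)"
  proof (rule dir_deriv_curve)
    show "f differentiable at (g \<bullet>\<^sub>G h_elem 0) within G_grp"
      using smooth_G_differentiable [OF assms] by simp
    show "range (\<lambda>t. g \<bullet>\<^sub>G h_elem t) \<subseteq> G_grp"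
      using assms(2) by (auto intro!: G_mult)
    show "((\<lambda>t. g \<bullet>\<^sub>G h_elem t) has_vector_derivative g \<bullet>\<^sub>G h_elem 0 \<bullet>\<^sub>G e_tilde0) (at 0)"
      using bounded_linear.has_vector_derivative [OF mp.bounded_linear_right h_elem_deriv, of g 0 UNIV] by (simp add: mp_assoc)
  qed
  then show ?thesis by simp
qed

text \<open>Infinitesimal equivariance: the field is differentiated along the fibre, where
  equivariance fixes its values.\<close>

lemma V_fields_dir_e_tilde0:
  assumes "Y \<in> V_fields" "g \<in> G_grp"
  shows "dir_deriv Y g e_tilde0 = - m_vec (ad_h (m_coord (Y g)))"
proof (rule vector_derivative_unique_at)
  show "((\<lambda>t. Y (g \<bullet>\<^sub>G h_elem t)) has_vector_derivative dir_deriv Y g e_tilde0) (at 0)"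
    by (rule dir_deriv_e_tilde0_curve [OF V_fields_smooth [OF assms(1)] assms(2)])
  show "((\<lambda>t. Y (g \<bullet>\<^sub>G h_elem t)) has_vector_derivative - m_vec (ad_h (m_coord (Y g)))) (at 0)"
    unfolding V_fields_coord [OF assms] linear_neg [OF linear_m_vec, symmetric]
    by (rule bounded_linear.has_vector_derivative [OF bounded_linear_m_vec h_rot_deriv])
qed

lemma V_funs_dir_e_tilde0:
  assumes "f \<in> V_funs" "g \<in> G_grp"
  shows "dir_deriv f g e_tilde0 = 0"
proof (rule vector_derivative_unique_at)
  show "((\<lambda>t. f (g \<bullet>\<^sub>G h_elem t)) has_vector_derivative dir_deriv f g e_tilde0) (at 0)"
    using assms by (intro dir_deriv_e_tilde0_curve) (auto simp: V_funs_def)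
  show "((\<lambda>t. f (g \<bullet>\<^sub>G h_elem t)) has_vector_derivative 0) (at 0)"
    unfolding V_funs_invariant [OF assms] by (rule has_vector_derivative_const)
qed

text \<open>Right translation by \<open>h\<close> carries the left-invariant field of
  \<open>X\<close> to that of the conjugate of \<open>X\<close> by the inverse of
  \<open>h\<close>.\<close>

lemma dir_deriv_right_translate:
  assumes "smooth_G f" "g \<in> G_grp" "h \<in> G_grp" "X \<in> G_alg"
  shows "dir_deriv (\<lambda>a. f (a \<bullet>\<^sub>G h)) g X = dir_deriv f (g \<bullet>\<^sub>G h) (mp_transp h \<bullet>\<^sub>G X \<bullet>\<^sub>G h)"
proof -
  let ?L = "frechet_derivative f (at (g \<bullet>\<^sub>G h) within G_grp)"
  have L: "(f has_derivative ?L) (at (g \<bullet>\<^sub>G h) within G_grp)"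
    using smooth_G_differentiable [OF assms(1) G_mult [OF assms(2,3)]] frechet_derivative_works by blast
  have "((\<lambda>a. f (a \<bullet>\<^sub>G h)) has_derivative (\<lambda>v. ?L (v \<bullet>\<^sub>G h))) (at g within G_grp)"
    by (rule has_derivative_in_compose [OF bounded_linear_imp_has_derivative [OF mp.bounded_linear_left]
          has_derivative_subset [OF L]]) (use assms in auto)
  from dir_deriv_eq [OF this assms(2,4)]
  have "dir_deriv (\<lambda>a. f (a \<bullet>\<^sub>G h)) g X = ?L (g \<bullet>\<^sub>G X \<bullet>\<^sub>G h)" .
  also have "g \<bullet>\<^sub>G X \<bullet>\<^sub>G h = (g \<bullet>\<^sub>G h) \<bullet>\<^sub>G (mp_transp h \<bullet>\<^sub>G X \<bullet>\<^sub>G h)"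
    by (simp add: mp_assoc G_transp_cancel assms)
  finally show ?thesis by (simp add: dir_deriv_def)
qed

lemma h_elem_transp: "mp_transp (h_elem t) = h_elem (- t)"
  by (metis h_elem_G mp_inv_G mp_inv_h_elem)

lemma Ad_h_elem_eq: "Ad (h_elem (- t)) X = mp_transp (h_elem t) \<bullet>\<^sub>G X \<bullet>\<^sub>G h_elem t"
  by (simp add: Ad_def mp_inv_h_elem h_elem_transp)

lemma bounded_linear_Ad: "bounded_linear (Ad g)"
  unfolding Ad_def by (rule bounded_linear_compose [OF mp.bounded_linear_left mp.bounded_linear_right])

lemma V_fields_deriv_equivariant:
  assumes Y: "Y \<in> V_fields" and g: "g \<in> G_grp" and X: "X \<in> G_alg"
  shows "dir_deriv Y (g \<bullet>\<^sub>G h_elem t) (Ad (h_elem (- t)) X) = Ad (h_elem (- t)) (dir_deriv Y g X)"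
proof -
  have "dir_deriv Y (g \<bullet>\<^sub>G h_elem t) (Ad (h_elem (- t)) X) = dir_deriv (\<lambda>a. Y (a \<bullet>\<^sub>G h_elem t)) g X"
    by (simp add: Ad_h_elem_eq dir_deriv_right_translate [OF V_fields_smooth [OF Y] g h_elem_G X])
  also have "\<dots> = dir_deriv (\<lambda>a. Ad (h_elem (- t)) (Y a)) g X"
    by (rule dir_deriv_cong [OF V_fields_equivariant [OF Y] g])
  also have "\<dots> = Ad (h_elem (- t)) (dir_deriv Y g X)"
    by (rule dir_deriv_bounded_linear [OF g X bounded_linear_Ad smooth_G_differentiable [OF V_fields_smooth [OF Y] g]])
  finally show ?thesis .
qed

text \<open>The fundamental vector field of \<open>A\<close>; on \<open>G\<close> the inverse of \<open>g\<close> is its transpose.\<close>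

definition killing :: "mpair \<Rightarrow> mpair \<Rightarrow> mpair"
  where "killing A g = m_vec (m_coord (mp_transp g \<bullet>\<^sub>G A \<bullet>\<^sub>G g))"

lemma killing_V_fields: 
  assumes A: "A \<in> G_alg" shows "killing A \<in> V_fields"
proof (rule V_fieldsI)
  have "smooth_G (\<lambda>g. (mp_transp g \<bullet>\<^sub>G A) \<bullet>\<^sub>G g)"
    by (intro smooth_G_bilinear [OF bounded_bilinear_mp_mult] smooth_G_of_linear bounded_linear_ident
        bounded_linear_compose [OF mp.bounded_linear_left bounded_linear_mp_transp])
  then show "smooth_G (killing A)"
    unfolding killing_def [abs_def]
    by (intro smooth_G_bounded_linear [OF smooth_G_bounded_linear [OF _ bounded_linear_m_coord] bounded_linear_m_vec])
  show "m_coord (killing A (g \<bullet>\<^sub>G h_elem t)) = h_rot (- t) (m_coord (killing A g))" if g: "g \<in> G_grp" for g t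
  proof -
    have "mp_transp (g \<bullet>\<^sub>G h_elem t) \<bullet>\<^sub>G A \<bullet>\<^sub>G (g \<bullet>\<^sub>G h_elem t) = Ad (h_elem (- t)) (mp_transp g \<bullet>\<^sub>G A \<bullet>\<^sub>G g)"
      by (simp add: Ad_h_elem_eq mp_transp_mult mp_assoc)
    then show ?thesis
      using m_coord_Ad_h_elem [OF conj_G_alg [OF g A], of "- t"] by (simp add: killing_def)
  qed
qed (simp add: killing_def)

lemma killing_extends: "g \<in> G_grp \<Longrightarrow> v \<in> m_sp \<Longrightarrow> killing (Ad g v) g = v"
  by (simp add: killing_def Ad_def mp_inv_G mp_assoc G_transp_cancel G_transp_mult m_vec_coord)

text \<open>The choice ranges over a non-empty set: the fundamental field of \<open>Ad g v\<close>
  takes the value \<open>v\<close> at \<open>g\<close>.\<close>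

lemma extend_vec:
  assumes "g \<in> G_grp" "v \<in> m_sp"
  shows "extend_vec g v \<in> V_fields" "extend_vec g v g = v"
proof -
  have "\<exists>X. X \<in> V_fields \<and> X g = v"
    using killing_V_fields [OF Ad_G_alg [OF assms(1) m_sp_G_alg [OF assms(2)]]] killing_extends [OF assms] by blast
  from someI_ex [OF this] show "extend_vec g v \<in> V_fields" "extend_vec g v g = v"
    unfolding extend_vec_def by auto
qed

subsection \<open>The Lie bracket of vector fields\<close>

lemma mult_rodr_s_mat_3:
  "(A ** rodr (s_mat 3) t) $ i $ 3 = A $ i $ 3"
  "(A ** rodr (s_mat 3) t) $ i $ 1 = cos t * A $ i $ 1 + sin t * A $ i $ 2"
  "(A ** rodr (s_mat 3) t) $ i $ 2 = cos t * A $ i $ 2 - sin t * A $ i $ 1"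
  by (simp_all add: matrix_matrix_mult_def sum_3 rodr_s_mat_3)

text \<open>The functions on \<open>G/H\<close> below are the third columns of the two rotations \<open>A\<close>, \<open>B\<close> and the
  imaginary part of \<open>(A\<^sub>1\<^sub>1 + i A\<^sub>1\<^sub>2)\<^sup>2 (B\<^sub>1\<^sub>1 - i B\<^sub>1\<^sub>2)\<close>, translated to the point \<open>g\<close>.\<close>

lemma V_funs_separate:
  assumes g: "g \<in> G_grp" and z: "z \<in> m_sp" and eq: "\<And>f. f \<in> V_funs \<Longrightarrow> dir_deriv f g z = 0"
  shows "z = 0"
proof -
  define k where "k a = mp_transp g \<bullet>\<^sub>G a" for a
  define A where "A i j a = fst (k a) $ i $ j" for i j a
  define B where "B i j a = snd (k a) $ i $ j" for i j a
  note za = m_sp_G_alg [OF z]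
  have kb: "bounded_linear k" unfolding k_def by (rule mp.bounded_linear_right)
  have lin: "bounded_linear (A i j)" "bounded_linear (B i j)" for i j
    unfolding A_def [abs_def] B_def [abs_def]
    by (intro bounded_linear_vec_nth [THEN bounded_linear_compose] bounded_linear_fst_comp bounded_linear_snd_comp kb)+
  note smooth = smooth_G_of_linear [OF lin(1)] smooth_G_of_linear [OF lin(2)]
  have k_mult: "k (a \<bullet>\<^sub>G h) = k a \<bullet>\<^sub>G h" for a h by (simp add: k_def mp_assoc)
  have kg: "k (g \<bullet>\<^sub>G X) = X" "k g = 1\<^sub>G" for X by (simp_all add: k_def G_transp_cancel G_transp_mult g)
  have inv: "A i 3 (a \<bullet>\<^sub>G h_elem t) = A i 3 a" "B i 3 (a \<bullet>\<^sub>G h_elem t) = B i 3 a"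
    "A i 1 (a \<bullet>\<^sub>G h_elem t) = cos t * A i 1 a + sin t * A i 2 a" "A i 2 (a \<bullet>\<^sub>G h_elem t) = cos t * A i 2 a - sin t * A i 1 a"
    "B i 1 (a \<bullet>\<^sub>G h_elem t) = cos (2 * t) * B i 1 a + sin (2 * t) * B i 2 a" "B i 2 (a \<bullet>\<^sub>G h_elem t) = cos (2 * t) * B i 2 a - sin (2 * t) * B i 1 a"
    for i a t
    by (simp_all add: A_def B_def k_mult) (simp_all add: mp_mult_def h_elem_def mult_rodr_s_mat_3)
  define F where "F a = 2 * (A 1 1 a * A 1 2 a) * B 1 1 a - (A 1 1 a * A 1 1 a - A 1 2 a * A 1 2 a) * B 1 2 a" for a
  have F_inv: "F (a \<bullet>\<^sub>G h_elem t) = F a" for a t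
  proof -
    \<comment> \<open>Under \<open>h_elem t\<close> the complex number with parts
      \<open>A 1 1\<close>, \<open>A 1 2\<close> gains the phase \<open>exp(-i t)\<close>, the
      conjugate one built from \<open>B\<close> gains \<open>exp(2 i t)\<close>. In the product the
      phases cancel, leaving a power of \<open>c * c + s * s\<close>.\<close>
    have *: "2 * ((c * x + s * y) * (c * y - s * x)) * ((c * c - s * s) * u + (2 * s * c) * v)
       - ((c * x + s * y) * (c * x + s * y) - (c * y - s * x) * (c * y - s * x)) * ((c * c - s * s) * v - (2 * s * c) * u)
       = (c * c + s * s) * (c * c + s * s) * (2 * (x * y) * u - (x * x - y * y) * v)" for c s x y u v :: real
      by (simp add: algebra_simps)
    have 1: "cos t * cos t + sin t * sin t = 1"
      using sin_cos_squared_add2 [of t] by (simp add: power2_eq_square)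
    have "cos (2 * t) = cos t * cos t - sin t * sin t" "sin (2 * t) = 2 * sin t * cos t"
      by (simp_all add: cos_double sin_double power2_eq_square)
    then show ?thesis
      unfolding F_def inv using * [of "cos t" _ "sin t", unfolded 1] by simp
  qed
  have "smooth_G F"
    unfolding F_def [abs_def] by (intro smooth_G_diff smooth_G_mult smooth smooth_G_const)
  then have FV: "F \<in> V_funs" using F_inv by (auto simp: V_funs_def H_grp_eq)
  have AV: "A i 3 \<in> V_funs" "B i 3 \<in> V_funs" for i
    using smooth inv by (auto simp: V_funs_def H_grp_eq)
  have dA: "dir_deriv (A i j) g z = fst z $ i $ j" and dB: "dir_deriv (B i j) g z = snd z $ i $ j" for i j
    using dir_deriv_of_linear [OF g za lin(1)] dir_deriv_of_linear [OF g za lin(2)] by (simp_all add: A_def B_def kg)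
  have val: "A 1 1 g = 1" "A 1 2 g = 0" "B 1 1 g = 1" "B 1 2 g = 0"
    by (simp_all add: A_def B_def kg mp_one_def mat_def)
  note mult = bounded_bilinear_mult
  note sd = smooth_G_mult smooth smooth_G_const smooth_G_diff
  \<comment> \<open>This differential vanishes on \<open>e_tilde0\<close> and equals 5 on
    \<open>e_tilde 1\<close>, the one direction in \<open>\<mm>\<close> that the third columns do
    not detect.\<close>
  have "dir_deriv F g z = 2 * fst z $ 1 $ 2 - snd z $ 1 $ 2"
    unfolding F_def [abs_def]
    by (simp add: dir_deriv_diff [OF g za] dir_deriv_bilinear [OF g za mult] smooth_G_differentiable [OF _ g] sd
        dir_deriv_const [OF g za] val dA dB)
  then have "2 * fst z $ 1 $ 2 - snd z $ 1 $ 2 = 0"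
    using eq [OF FV] by simp
  moreover have "fst z $ 1 $ 3 = 0" "fst z $ 2 $ 3 = 0" "snd z $ 1 $ 3 = 0" "snd z $ 2 $ 3 = 0"
    unfolding dA [symmetric] dB [symmetric] using eq AV by blast+
  moreover obtain x where x: "z = m_vec x" using z by (auto simp: m_sp_eq)
  ultimately have "x $ 1 = 0" "x $ 3 = 0" "- x $ 2 = 0" "x $ 5 = 0" "- x $ 4 = 0"
    by (simp_all add: m_vec_def' s_mat_nth)
  then have "x = 0" by (simp add: vec5_eq_iff)
  then show ?thesis using x linear_0 [OF linear_m_vec] by simp
qed

text \<open>The commutator computed on \<open>G\<close> has a further component along
  \<open>e_tilde0\<close>, but \<open>H\<close>-invariant functions have zero derivative in that
  direction. Uniqueness holds because these functions separate the vectors of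
  \<open>m_sp\<close>.\<close>

lemma V_bracket_eq:
  assumes X: "X \<in> V_fields" and Y: "Y \<in> V_fields" and g: "g \<in> G_grp"
  shows "V_bracket X Y g = dir_deriv Y g (X g) - dir_deriv X g (Y g) + m_vec (m_brk (m_coord (X g)) (m_coord (Y g)))"
    (is "_ = ?B")
  unfolding V_bracket_def
proof (rule the_equality)
  note Xm = V_fields_m_sp [OF X g] and Ym = V_fields_m_sp [OF Y g]
  note Xa = V_fields_G_alg [OF X g] and Ya = V_fields_G_alg [OF Y g]
  note Xs = V_fields_smooth [OF X] and Ys = V_fields_smooth [OF Y]
  have B: "?B \<in> m_sp"
    by (intro subspace_add subspace_diff subspace_m_sp dir_deriv_m_sp X Y Xa Ya g m_vec_m_sp)
  have br: "bracket (X g) (Y g) = m_vec (m_brk (m_coord (X g)) (m_coord (Y g))) + h_brk (m_coord (X g)) (m_coord (Y g)) *\<^sub>R e_tilde0"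
    using bracket_m_vec [of "m_coord (X g)" "m_coord (Y g)"] by (simp add: m_vec_coord Xm Ym)
  have *: "dir_deriv f g ?B =
       dir_deriv (\<lambda>a. dir_deriv f a (Y a)) g (X g) - dir_deriv (\<lambda>a. dir_deriv f a (X a)) g (Y g)"
    if f: "f \<in> V_funs" for f
  proof -
    have fs: "smooth_G f" using f by (simp add: V_funs_def)
    note lin = dir_deriv_linear [OF smooth_G_differentiable [OF fs g]]
    have "dir_deriv (\<lambda>a. dir_deriv f a (Y a)) g (X g) - dir_deriv (\<lambda>a. dir_deriv f a (X a)) g (Y g)
      = (dir_deriv (\<lambda>a. dir_deriv f a (Y g)) g (X g) - dir_deriv (\<lambda>a. dir_deriv f a (X g)) g (Y g))
        + (dir_deriv f g (dir_deriv Y g (X g)) - dir_deriv f g (dir_deriv X g (Y g)))"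
      by (simp add: dir_deriv_field [OF fs Ys V_fields_G_alg [OF Y] g Xa] dir_deriv_field [OF fs Xs V_fields_G_alg [OF X] g Ya])
    also have "\<dots> = dir_deriv f g ?B"
      unfolding commutator [OF fs g Xa Ya] br
      by (simp add: linear_add [OF lin] linear_diff [OF lin] linear_scale [OF lin] V_funs_dir_e_tilde0 [OF f g])
    finally show ?thesis by simp
  qed
  show "?B \<in> m_sp \<and> (\<forall>f\<in>V_funs. dir_deriv f g ?B =
       dir_deriv (\<lambda>a. dir_deriv f a (Y a)) g (X g) - dir_deriv (\<lambda>a. dir_deriv f a (X a)) g (Y g))"
    using B * by blast
  fix z assume z: "z \<in> m_sp \<and> (\<forall>f\<in>V_funs. dir_deriv f g z =
       dir_deriv (\<lambda>a. dir_deriv f a (Y a)) g (X g) - dir_deriv (\<lambda>a. dir_deriv f a (X a)) g (Y g))"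
  have "z - ?B = 0"
  proof (rule V_funs_separate [OF g])
    show "z - ?B \<in> m_sp" using z B by (simp add: subspace_diff subspace_m_sp)
    show "dir_deriv f g (z - ?B) = 0" if f: "f \<in> V_funs" for f
    proof -
      have "smooth_G f" using f by (simp add: V_funs_def)
      then have "dir_deriv f g (z - ?B) = dir_deriv f g z - dir_deriv f g ?B"
        using linear_diff [OF dir_deriv_linear [OF smooth_G_differentiable [OF _ g]]] by blast
      then show ?thesis using z f * [OF f] by simp
    qed
  qed
  then show "z = ?B" by simp
qed

subsection \<open>The Levi-Civita connection\<close>

text \<open>The Nomizu map of the Levi-Civita connection in the basis \<open>e_tilde\<close>; for the metric with
  parameters \<open>\<alpha>\<close>, \<open>\<beta>\<close>, \<open>\<gamma>\<close> the Koszul formula gives \<open>p = \<alpha> / (5 \<beta>)\<close> and \<open>q = \<alpha> / (10 \<gamma>)\<close>.\<close>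

definition nomizu :: "real \<Rightarrow> real \<Rightarrow> real^5 \<Rightarrow> real^5 \<Rightarrow> real^5"
  where "nomizu p q x y = vec5
    ((x $ 3 * y $ 2 - x $ 2 * y $ 3) / 5 + (x $ 4 * y $ 5 - x $ 5 * y $ 4) / 10)
    (- p * x $ 3 * y $ 1 - (p - 2) * x $ 1 * y $ 3)
    (p * x $ 2 * y $ 1 + (p - 2) * x $ 1 * y $ 2)
    (q * x $ 5 * y $ 1 - (1 - q) * x $ 1 * y $ 5)
    (- q * x $ 4 * y $ 1 + (1 - q) * x $ 1 * y $ 4)"

lemma bounded_bilinear_nomizu: "bounded_bilinear (nomizu p q)"
  unfolding bilinear_conv_bounded_bilinear [symmetric] bilinear_def
  by (intro conjI allI linearI) (simp_all add: nomizu_def vec5_eq_iff field_simps)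

interpretation nomizu: bounded_bilinear "nomizu p q" for p q
  by (rule bounded_bilinear_nomizu)

lemma nomizu_torsion: "nomizu p q x y - nomizu p q y x = m_brk x y"
  by (simp add: nomizu_def m_brk_def vec5_eq_iff field_simps)

lemma nomizu_skew:
  assumes "\<beta> > 0" "\<gamma> > 0"
  shows "inner5 \<alpha> \<beta> \<gamma> (nomizu (\<alpha> / (5 * \<beta>)) (\<alpha> / (10 * \<gamma>)) x y) z
    + inner5 \<alpha> \<beta> \<gamma> y (nomizu (\<alpha> / (5 * \<beta>)) (\<alpha> / (10 * \<gamma>)) x z) = 0"
  using assms by (simp add: nomizu_def inner5_def field_simps)

lemma nomizu_h_rot: "nomizu p q (h_rot t x) (h_rot t y) = h_rot t (nomizu p q x y)"
proof -
  \<comment> \<open>The first component of the Nomizu map is a combination of two determinants of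
    size 2, one per isotropy plane, and rotations preserve these. In the other components at most
    one factor of each product is rotated.\<close>
  have rot: "(c * a - s * b) * (s * a' + c * b') - (s * a + c * b) * (c * a' - s * b') = (c * c + s * s) * (a * b' - b * a')"
    for a b a' b' c s :: real by (simp add: algebra_simps)
  have 1: "cos u * cos u + sin u * sin u = 1" for u :: real
    using sin_cos_squared_add2 [of u] by (simp add: power2_eq_square)
  have "nomizu p q (h_rot t x) (h_rot t y) $ 1 = 
     - ((h_rot t x $ 2 * h_rot t y $ 3 - h_rot t x $ 3 * h_rot t y $ 2) / 5) + (h_rot t x $ 4 * h_rot t y $ 5 - h_rot t x $ 5 * h_rot t y $ 4) / 10"
    by (simp add: nomizu_def diff_divide_distrib)
  also have "\<dots> = nomizu p q x y $ 1"
    by (simp add: h_rot_def rot 1) (simp add: nomizu_def diff_divide_distrib)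
  finally show ?thesis
    by (simp add: vec5_eq_iff) (simp add: nomizu_def h_rot_def algebra_simps)
qed

lemma inner5_simps: 
  "inner5 \<alpha> \<beta> \<gamma> (x + y) z = inner5 \<alpha> \<beta> \<gamma> x z + inner5 \<alpha> \<beta> \<gamma> y z"
  "inner5 \<alpha> \<beta> \<gamma> (x - y) z = inner5 \<alpha> \<beta> \<gamma> x z - inner5 \<alpha> \<beta> \<gamma> y z"
  "inner5 \<alpha> \<beta> \<gamma> (r *\<^sub>R x) z = r * inner5 \<alpha> \<beta> \<gamma> x z"
  "inner5 \<alpha> \<beta> \<gamma> z (x + y) = inner5 \<alpha> \<beta> \<gamma> z x + inner5 \<alpha> \<beta> \<gamma> z y"
  "inner5 \<alpha> \<beta> \<gamma> z (r *\<^sub>R x) = r * inner5 \<alpha> \<beta> \<gamma> z x"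
  by (simp_all add: inner5_def algebra_simps)

lemma inner5_commute: "inner5 \<alpha> \<beta> \<gamma> x y = inner5 \<alpha> \<beta> \<gamma> y x"
  by (simp add: inner5_def algebra_simps)

lemma bounded_bilinear_inner5: "bounded_bilinear (inner5 \<alpha> \<beta> \<gamma>)"
  unfolding bilinear_conv_bounded_bilinear [symmetric] bilinear_def
  by (intro conjI allI linearI) (simp_all add: inner5_simps)

lemma inner5_definite:
  assumes "\<alpha> > 0" "\<beta> > 0" "\<gamma> > 0" "inner5 \<alpha> \<beta> \<gamma> x x = 0"
  shows "x = 0"
proof -
  have nn: "0 \<le> \<alpha> * (x $ 1 * x $ 1)" "0 \<le> \<beta> * (x $ 2 * x $ 2)" "0 \<le> \<beta> * (x $ 3 * x $ 3)"
    "0 \<le> \<gamma> * (x $ 4 * x $ 4)" "0 \<le> \<gamma> * (x $ 5 * x $ 5)"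
    using assms by simp_all
  have "\<alpha> * (x $ 1 * x $ 1) + \<beta> * (x $ 2 * x $ 2) + \<beta> * (x $ 3 * x $ 3) + \<gamma> * (x $ 4 * x $ 4) + \<gamma> * (x $ 5 * x $ 5) = 0"
    using assms(4) by (simp add: inner5_def algebra_simps)
  with nn have "\<alpha> * (x $ 1 * x $ 1) = 0" "\<beta> * (x $ 2 * x $ 2) = 0" "\<beta> * (x $ 3 * x $ 3) = 0"
    "\<gamma> * (x $ 4 * x $ 4) = 0" "\<gamma> * (x $ 5 * x $ 5) = 0"
    by linarith+
  then show ?thesis using assms(1-3) by (simp add: vec5_eq_iff)
qed

definition invariant_conn :: "real \<Rightarrow> real \<Rightarrow> connection"
  where "invariant_conn p q g v Y = dir_deriv Y g v + m_vec (nomizu p q (m_coord v) (m_coord (Y g)))"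

lemma invariant_conn_field:
  assumes X: "X \<in> V_fields" and Y: "Y \<in> V_fields"
  shows "(\<lambda>g. invariant_conn p q g (X g) Y) \<in> V_fields"
proof (rule V_fieldsI)
  note Xs = V_fields_smooth [OF X] and Ys = V_fields_smooth [OF Y]
  have "smooth_G (\<lambda>g. nomizu p q (m_coord (X g)) (m_coord (Y g)))"
    by (intro smooth_G_bilinear [OF bounded_bilinear_nomizu] smooth_G_bounded_linear [OF Xs bounded_linear_m_coord]
        smooth_G_bounded_linear [OF Ys bounded_linear_m_coord])
  then show "smooth_G (\<lambda>g. invariant_conn p q g (X g) Y)"
    unfolding invariant_conn_def
    by (intro smooth_G_add smooth_G_field [OF Ys Xs V_fields_G_alg [OF X]] smooth_G_bounded_linear [OF _ bounded_linear_m_vec])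
  show "invariant_conn p q g (X g) Y \<in> m_sp" if g: "g \<in> G_grp" for g
    unfolding invariant_conn_def
    by (intro subspace_add [OF subspace_m_sp] dir_deriv_m_sp Y g V_fields_G_alg [OF X] m_vec_m_sp)
  show "m_coord (invariant_conn p q (g \<bullet>\<^sub>G h_elem t) (X (g \<bullet>\<^sub>G h_elem t)) Y) = h_rot (- t) (m_coord (invariant_conn p q g (X g) Y))"
    if g: "g \<in> G_grp" for g t
  proof -
    note Xa = V_fields_G_alg [OF X g]
    have "linear (h_rot (- t))"
      by (intro linearI) (simp_all add: h_rot_def vec5_eq_iff algebra_simps)
    moreover have "m_coord (dir_deriv Y (g \<bullet>\<^sub>G h_elem t) (X (g \<bullet>\<^sub>G h_elem t))) = h_rot (- t) (m_coord (dir_deriv Y g (X g)))"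
      unfolding V_fields_equivariant [OF X g] V_fields_deriv_equivariant [OF Y g Xa]
      by (rule m_coord_Ad_h_elem [OF m_sp_G_alg [OF dir_deriv_m_sp [OF Y g Xa]]])
    ultimately show ?thesis
      unfolding invariant_conn_def
      by (simp add: linear_add [OF linear_m_coord] V_fields_coord [OF X g] V_fields_coord [OF Y g] nomizu_h_rot linear_add)
  qed
qed

lemma affine_connection_invariant: "affine_connection (invariant_conn p q)"
  unfolding affine_connection_def
proof (intro conjI ballI allI)
  fix g v w Y and r s :: real
  assume g: "g \<in> G_grp" and Y: "Y \<in> V_fields"
  show "invariant_conn p q g (r *\<^sub>R v + s *\<^sub>R w) Y = r *\<^sub>R invariant_conn p q g v Y + s *\<^sub>R invariant_conn p q g w Y"
    using dir_deriv_linear [OF smooth_G_differentiable [OF V_fields_smooth [OF Y] g]]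
    by (simp add: invariant_conn_def linear_add linear_scale linear_m_coord linear_m_vec nomizu.add_left nomizu.scaleR_left scaleR_add_right)
next
  fix g v Y Z
  assume g: "g \<in> G_grp" and v: "v \<in> m_sp" and Y: "Y \<in> V_fields" and Z: "Z \<in> V_fields"
  show "invariant_conn p q g v (\<lambda>a. Y a + Z a) = invariant_conn p q g v Y + invariant_conn p q g v Z"
    using dir_deriv_add [OF g m_sp_G_alg [OF v] smooth_G_differentiable [OF V_fields_smooth [OF Y] g]
        smooth_G_differentiable [OF V_fields_smooth [OF Z] g]]
    by (simp add: invariant_conn_def linear_add linear_m_coord linear_m_vec nomizu.add_right)
next
  fix g v Y f
  assume g: "g \<in> G_grp" and v: "v \<in> m_sp" and Y: "Y \<in> V_fields" and f: "f \<in> V_funs"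
  have "smooth_G f" using f by (simp add: V_funs_def)
  from dir_deriv_bilinear [OF g m_sp_G_alg [OF v] bounded_bilinear_scaleR smooth_G_differentiable [OF this g]
      smooth_G_differentiable [OF V_fields_smooth [OF Y] g]]
  show "invariant_conn p q g v (\<lambda>a. f a *\<^sub>R Y a) = dir_deriv f g v *\<^sub>R Y g + f g *\<^sub>R invariant_conn p q g v Y"
    by (simp add: invariant_conn_def linear_scale linear_m_coord linear_m_vec nomizu.scaleR_right scaleR_add_right)
qed (rule invariant_conn_field)

lemma torsion_free_invariant: "torsion_free (invariant_conn p q)"
  unfolding torsion_free_def
proof (intro ballI)
  fix g X Y assume "g \<in> G_grp" and "X \<in> V_fields" and "Y \<in> V_fields"
  then show "invariant_conn p q g (X g) Y - invariant_conn p q g (Y g) X = V_bracket X Y g"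
    by (simp add: V_bracket_eq invariant_conn_def nomizu_torsion [of p q, symmetric] linear_diff [OF linear_m_vec])
qed

lemma metric_compatible_invariant:
  assumes "\<beta> > 0" "\<gamma> > 0"
  shows "metric_compatible \<alpha> \<beta> \<gamma> (invariant_conn (\<alpha> / (5 * \<beta>)) (\<alpha> / (10 * \<gamma>)))"
  unfolding metric_compatible_def
proof (intro ballI)
  fix g v Y Z
  assume g: "g \<in> G_grp" and v: "v \<in> m_sp" and Y: "Y \<in> V_fields" and Z: "Z \<in> V_fields"
  let ?D = "invariant_conn (\<alpha> / (5 * \<beta>)) (\<alpha> / (10 * \<gamma>)) g v"
  note va = m_sp_G_alg [OF v]
  note Yd = smooth_G_differentiable [OF V_fields_smooth [OF Y] g] 
  note Zd = smooth_G_differentiable [OF V_fields_smooth [OF Z] g]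
  note Ym = V_fields_m_sp [OF Y g] and Zm = V_fields_m_sp [OF Z g]
  have D: "?D Y \<in> m_sp" "?D Z \<in> m_sp"
    unfolding invariant_conn_def by (intro subspace_add [OF subspace_m_sp] dir_deriv_m_sp Y Z g va m_vec_m_sp)+
  have c: "m_coord (?D Y) = m_coord (dir_deriv Y g v) + nomizu (\<alpha> / (5 * \<beta>)) (\<alpha> / (10 * \<gamma>)) (m_coord v) (m_coord (Y g))"
    "m_coord (?D Z) = m_coord (dir_deriv Z g v) + nomizu (\<alpha> / (5 * \<beta>)) (\<alpha> / (10 * \<gamma>)) (m_coord v) (m_coord (Z g))"
    by (simp_all add: invariant_conn_def linear_add [OF linear_m_coord])
  have "dir_deriv (\<lambda>a. metric \<alpha> \<beta> \<gamma> (Y a) (Z a)) g v = dir_deriv (\<lambda>a. inner5 \<alpha> \<beta> \<gamma> (m_coord (Y a)) (m_coord (Z a))) g v"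
    by (rule dir_deriv_cong [OF metric_m_sp [OF V_fields_m_sp [OF Y] V_fields_m_sp [OF Z]] g])
  also have "\<dots> = inner5 \<alpha> \<beta> \<gamma> (m_coord (Y g)) (m_coord (dir_deriv Z g v)) + inner5 \<alpha> \<beta> \<gamma> (m_coord (dir_deriv Y g v)) (m_coord (Z g))"
    using dir_deriv_bilinear [OF g va bounded_bilinear_inner5 differentiableI [OF has_dir_deriv_linear [OF bounded_linear_m_coord Yd]]
        differentiableI [OF has_dir_deriv_linear [OF bounded_linear_m_coord Zd]]]
    by (simp add: dir_deriv_bounded_linear [OF g va bounded_linear_m_coord] Yd Zd)
  also have "\<dots> = metric \<alpha> \<beta> \<gamma> (?D Y) (Z g) + metric \<alpha> \<beta> \<gamma> (Y g) (?D Z)"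
    using nomizu_skew [OF assms, of \<alpha> "m_coord v" "m_coord (Y g)" "m_coord (Z g)"]
    by (simp add: metric_m_sp D Ym Zm c inner5_simps)
  finally show "dir_deriv (\<lambda>a. metric \<alpha> \<beta> \<gamma> (Y a) (Z a)) g v = metric \<alpha> \<beta> \<gamma> (?D Y) (Z g) + metric \<alpha> \<beta> \<gamma> (Y g) (?D Z)" .
qed

text \<open>The axioms control the values only for a field differentiated along a field, so the
  single vector \<open>v\<close> is first extended.\<close>

lemma affine_connection_m_sp:
  assumes "affine_connection D" "g \<in> G_grp" "v \<in> m_sp" "Y \<in> V_fields"
  shows "D g v Y \<in> m_sp"
proof -
  have "(\<lambda>a. D a (extend_vec g v a) Y) \<in> V_fields"
    using assms(1,4) extend_vec(1) [OF assms(2,3)] by (simp add: affine_connection_def)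
  from V_fields_m_sp [OF this assms(2)] show ?thesis
    by (simp add: extend_vec(2) [OF assms(2,3)])
qed

text \<open>The difference of two such connections is a trilinear form which is symmetric in the first two
  arguments and skew-symmetric in the last two, and hence vanishes.\<close>

lemma levi_civita_unique:
  assumes pos: "\<alpha> > 0" "\<beta> > 0" "\<gamma> > 0"
    and D: "affine_connection D" "metric_compatible \<alpha> \<beta> \<gamma> D" "torsion_free D"
    and D': "affine_connection D'" "metric_compatible \<alpha> \<beta> \<gamma> D'" "torsion_free D'"
    and g: "g \<in> G_grp" and v: "v \<in> m_sp" and Y: "Y \<in> V_fields"
  shows "D g v Y = D' g v Y"
proof -
  note mem = affine_connection_m_sp [OF D(1) g] affine_connection_m_sp [OF D'(1) g]
  define S where "S v Y = m_coord (D g v Y - D' g v Y)" for v Y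
  define T where "T X Y Z = inner5 \<alpha> \<beta> \<gamma> (S (X g) Y) (m_coord (Z g))" for X Y Z :: "mpair \<Rightarrow> mpair"
  have skew: "T X Y Z = - T X Z Y" if XYZ: "X \<in> V_fields" "Y \<in> V_fields" "Z \<in> V_fields" for X Y Z
  proof -
    note m = XYZ [THEN V_fields_m_sp, OF g]
    have "dir_deriv (\<lambda>a. metric \<alpha> \<beta> \<gamma> (Y a) (Z a)) g (X g) =
        metric \<alpha> \<beta> \<gamma> (D g (X g) Y) (Z g) + metric \<alpha> \<beta> \<gamma> (Y g) (D g (X g) Z)"
      if "metric_compatible \<alpha> \<beta> \<gamma> D" for D
      using that g m(1) XYZ(2,3) unfolding metric_compatible_def by blast
    from trans [OF sym [OF this [OF D(2)]] this [OF D'(2)]]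
    have "metric \<alpha> \<beta> \<gamma> (D g (X g) Y) (Z g) + metric \<alpha> \<beta> \<gamma> (Y g) (D g (X g) Z)
      = metric \<alpha> \<beta> \<gamma> (D' g (X g) Y) (Z g) + metric \<alpha> \<beta> \<gamma> (Y g) (D' g (X g) Z)" .
    then show ?thesis
      unfolding T_def S_def linear_diff [OF linear_m_coord] inner5_simps
      by (simp add: metric_m_sp m XYZ mem inner5_commute [of _ _ _ "m_coord (Y g)"])
  qed
  have swap: "T X Y Z = T Y X Z" if XY: "X \<in> V_fields" "Y \<in> V_fields" for X Y Z
  proof -
    have "D g (X g) Y - D g (Y g) X = V_bracket X Y g" if "torsion_free D" for D
      using that g XY unfolding torsion_free_def by blast
    from trans [OF this [OF D(3)] sym [OF this [OF D'(3)]]]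
    have "D g (X g) Y - D g (Y g) X = D' g (X g) Y - D' g (Y g) X" .
    then have "D g (X g) Y - D' g (X g) Y = D g (Y g) X - D' g (Y g) X" by (simp add: algebra_simps)
    then show ?thesis by (simp add: T_def S_def)
  qed
  \<comment> \<open>Alternating the two symmetries: \<open>T X Y Z = - T X Z Y = - T Z X Y = T Z Y X
    = T Y Z X = - T Y X Z = - T X Y Z\<close>.\<close>
  have T0: "T X Y Z = 0" if XYZ: "X \<in> V_fields" "Y \<in> V_fields" "Z \<in> V_fields" for X Y Z
    using skew [OF XYZ] swap [OF XYZ(1,3), of Y] skew [OF XYZ(3,1,2)] swap [OF XYZ(3,2), of X] skew [OF XYZ(2,3,1)]
      swap [OF XYZ(2,1), of Z] by linarith
  have m: "D g v Y - D' g v Y \<in> m_sp"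
    by (simp add: mem v Y subspace_diff subspace_m_sp)
  note X = extend_vec [OF g v] and Z = extend_vec [OF g m]
  \<comment> \<open>The third field is taken to extend the difference of the two derivatives itself,
    so that definiteness of the metric applies.\<close>
  have "inner5 \<alpha> \<beta> \<gamma> (S v Y) (S v Y) = 0"
    using T0 [OF X(1) Y Z(1)] by (simp add: T_def X Z S_def)
  from inner5_definite [OF pos this] show ?thesis
    using m_vec_coord [OF m] linear_0 [OF linear_m_vec] by (simp add: S_def)
qed

context
  fixes \<alpha> \<beta> \<gamma> :: real
  assumes pos: "\<alpha> > 0" "\<beta> > 0" "\<gamma> > 0"
begin

lemma levi_civita:
  "affine_connection (levi_civita \<alpha> \<beta> \<gamma>)" "metric_compatible \<alpha> \<beta> \<gamma> (levi_civita \<alpha> \<beta> \<gamma>)" "torsion_free (levi_civita \<alpha> \<beta> \<gamma>)"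
proof -
  have "\<exists>D. affine_connection D \<and> metric_compatible \<alpha> \<beta> \<gamma> D \<and> torsion_free D"
    using affine_connection_invariant metric_compatible_invariant [OF pos(2,3)] torsion_free_invariant by blast
  from someI_ex [OF this]
  show "affine_connection (levi_civita \<alpha> \<beta> \<gamma>)" "metric_compatible \<alpha> \<beta> \<gamma> (levi_civita \<alpha> \<beta> \<gamma>)" "torsion_free (levi_civita \<alpha> \<beta> \<gamma>)"
    unfolding levi_civita_def by auto
qed

lemma levi_civita_eq:
  "g \<in> G_grp \<Longrightarrow> v \<in> m_sp \<Longrightarrow> Y \<in> V_fields \<Longrightarrow>
    levi_civita \<alpha> \<beta> \<gamma> g v Y = invariant_conn (\<alpha> / (5 * \<beta>)) (\<alpha> / (10 * \<gamma>)) g v Y"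
  by (rule levi_civita_unique [OF pos levi_civita affine_connection_invariant metric_compatible_invariant [OF pos(2,3)] torsion_free_invariant])

end

subsection \<open>Curvature\<close>

definition curv5 :: "real \<Rightarrow> real \<Rightarrow> real^5 \<Rightarrow> real^5 \<Rightarrow> real^5 \<Rightarrow> real^5"
  where "curv5 p q u v w = nomizu p q u (nomizu p q v w) - nomizu p q v (nomizu p q u w)
    - nomizu p q (m_brk u v) w - h_brk u v *\<^sub>R ad_h w"

text \<open>The derivatives of \<open>Y\<close> and the second derivatives of \<open>Z\<close> are
  kept apart from the tensorial terms: they are what skew-symmetrization and the bracket term of the
  curvature must remove.\<close>

lemma second_covariant_derivative:
  assumes g: "g \<in> G_grp" and X: "X \<in> V_fields" and Y: "Y \<in> V_fields" and Z: "Z \<in> V_fields"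
  shows "invariant_conn p q g (X g) (\<lambda>a. invariant_conn p q a (Y a) Z) =
    dir_deriv (\<lambda>a. dir_deriv Z a (Y g)) g (X g) + dir_deriv Z g (dir_deriv Y g (X g))
    + m_vec (nomizu p q (m_coord (Y g)) (m_coord (dir_deriv Z g (X g))) + nomizu p q (m_coord (dir_deriv Y g (X g))) (m_coord (Z g))
       + nomizu p q (m_coord (X g)) (m_coord (dir_deriv Z g (Y g)) + nomizu p q (m_coord (Y g)) (m_coord (Z g))))"
proof -
  note Xa = V_fields_G_alg [OF X g]
  note Ys = V_fields_smooth [OF Y] and Zs = V_fields_smooth [OF Z]
  note Yd = smooth_G_differentiable [OF Ys g] and Zd = smooth_G_differentiable [OF Zs g]
  note Yc = differentiableI [OF has_dir_deriv_linear [OF bounded_linear_m_coord Yd]]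
  note Zc = differentiableI [OF has_dir_deriv_linear [OF bounded_linear_m_coord Zd]]
  note N = differentiable_bilinear_G [OF bounded_bilinear_nomizu Yc Zc]
  have "dir_deriv (\<lambda>a. invariant_conn p q a (Y a) Z) g (X g) = dir_deriv (\<lambda>a. dir_deriv Z a (Y a)) g (X g)
     + dir_deriv (\<lambda>a. m_vec (nomizu p q (m_coord (Y a)) (m_coord (Z a)))) g (X g)"
    unfolding invariant_conn_def
    by (rule dir_deriv_add [OF g Xa smooth_G_differentiable [OF smooth_G_field [OF Zs Ys V_fields_G_alg [OF Y]] g]
          differentiableI [OF has_dir_deriv_linear [OF bounded_linear_m_vec N]]])
  also have "dir_deriv (\<lambda>a. m_vec (nomizu p q (m_coord (Y a)) (m_coord (Z a)))) g (X g)
      = m_vec (nomizu p q (m_coord (Y g)) (m_coord (dir_deriv Z g (X g))) + nomizu p q (m_coord (dir_deriv Y g (X g))) (m_coord (Z g)))"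
    by (simp add: dir_deriv_bounded_linear [OF g Xa bounded_linear_m_vec N]
        dir_deriv_bilinear [OF g Xa bounded_bilinear_nomizu Yc Zc]
        dir_deriv_bounded_linear [OF g Xa bounded_linear_m_coord] Yd Zd)
  finally show ?thesis
    by (simp add: invariant_conn_def [of p q g "X g"] dir_deriv_field [OF Zs Ys V_fields_G_alg [OF Y] g Xa]
        linear_add [OF linear_m_vec])
      (simp add: invariant_conn_def linear_add [OF linear_m_coord])
qed

lemma curvature_fields_invariant:
  assumes g: "g \<in> G_grp" and X: "X \<in> V_fields" and Y: "Y \<in> V_fields" and Z: "Z \<in> V_fields"
  shows "curvature_fields (invariant_conn p q) X Y Z g = m_vec (curv5 p q (m_coord (X g)) (m_coord (Y g)) (m_coord (Z g)))"
proof -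
  note Xa = V_fields_G_alg [OF X g] and Ya = V_fields_G_alg [OF Y g] and Zs = V_fields_smooth [OF Z]
  note lin = dir_deriv_linear [OF smooth_G_differentiable [OF Zs g]]
  let ?x = "m_coord (X g)" and ?y = "m_coord (Y g)" and ?z = "m_coord (Z g)"
  have br: "bracket (X g) (Y g) = m_vec (m_brk ?x ?y) + h_brk ?x ?y *\<^sub>R e_tilde0"
    using bracket_m_vec [of ?x ?y] by (simp add: m_vec_coord V_fields_m_sp [OF X g] V_fields_m_sp [OF Y g])
  \<comment> \<open>The vertical part of the bracket differentiates \<open>Z\<close> along the
    fibre; by equivariance this is algebraic and becomes the isotropy term of
    \<open>curv5\<close>.\<close>
  have comm: "dir_deriv (\<lambda>a. dir_deriv Z a (Y g)) g (X g) = dir_deriv (\<lambda>a. dir_deriv Z a (X g)) g (Y g)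
     + dir_deriv Z g (m_vec (m_brk ?x ?y)) - h_brk ?x ?y *\<^sub>R m_vec (ad_h ?z)"
    using commutator [OF Zs g Xa Ya] unfolding br
    by (simp add: linear_add [OF lin] linear_scale [OF lin] V_fields_dir_e_tilde0 [OF Z g] algebra_simps)
  show ?thesis
    unfolding curvature_fields_def second_covariant_derivative [OF g X Y Z] second_covariant_derivative [OF g Y X Z]
      V_bracket_eq [OF X Y g] invariant_conn_def [of p q g "_ + _"] comm curv5_def
    by (simp add: linear_add [OF lin] linear_diff [OF lin] linear_add [OF linear_m_vec] linear_diff [OF linear_m_vec]
        linear_scale [OF linear_m_vec] linear_add [OF linear_m_coord] linear_diff [OF linear_m_coord]
        nomizu.add_left nomizu.diff_left nomizu.add_right)
qed

context
  fixes \<alpha> \<beta> \<gamma> :: real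
  assumes pos: "\<alpha> > 0" "\<beta> > 0" "\<gamma> > 0"
begin

text \<open>The two connections are known to agree only on vector fields and at points of
  \<open>G\<close>. Hence the inner derivative must first be seen to be a vector field, and the
  inner replacement takes place under a derivative within \<open>G_grp\<close>.\<close>

lemma curvature_levi_civita:
  assumes g: "g \<in> G_grp" and uvw: "u \<in> m_sp" "v \<in> m_sp" "w \<in> m_sp"
  shows "curvature (levi_civita \<alpha> \<beta> \<gamma>) g u v w =
    m_vec (curv5 (\<alpha> / (5 * \<beta>)) (\<alpha> / (10 * \<gamma>)) (m_coord u) (m_coord v) (m_coord w))"
proof -
  let ?D = "levi_civita \<alpha> \<beta> \<gamma>" and ?I = "invariant_conn (\<alpha> / (5 * \<beta>)) (\<alpha> / (10 * \<gamma>))"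
  note X = extend_vec [OF g uvw(1)] and Y = extend_vec [OF g uvw(2)] and Z = extend_vec [OF g uvw(3)]
  have inner: "?D a (Y a) Z = ?I a (Y a) Z" if "Y \<in> V_fields" "Z \<in> V_fields" "a \<in> G_grp" for a Y Z
    by (rule levi_civita_eq [OF pos that(3) V_fields_m_sp [OF that(1,3)] that(2)])
  have twice: "?D g (X g) (\<lambda>a. ?D a (Y a) Z) = ?I g (X g) (\<lambda>a. ?I a (Y a) Z)"
    if XYZ: "X \<in> V_fields" "Y \<in> V_fields" "Z \<in> V_fields" for X Y Z
  proof -
    have "(\<lambda>a. ?D a (Y a) Z) \<in> V_fields"
      using levi_civita(1) [OF pos] XYZ by (simp add: affine_connection_def)
    then have "?D g (X g) (\<lambda>a. ?D a (Y a) Z) = ?I g (X g) (\<lambda>a. ?D a (Y a) Z)"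
      by (rule levi_civita_eq [OF pos g V_fields_m_sp [OF XYZ(1) g]])
    also have "\<dots> = ?I g (X g) (\<lambda>a. ?I a (Y a) Z)"
      unfolding invariant_conn_def [of _ _ g "X g"]
      using dir_deriv_cong [of "\<lambda>a. ?D a (Y a) Z" "\<lambda>a. ?I a (Y a) Z", OF inner [OF XYZ(2,3)] g] inner [OF XYZ(2,3) g] by simp
    finally show ?thesis .
  qed
  have "V_bracket X Y g \<in> m_sp" if "X \<in> V_fields" "Y \<in> V_fields" for X Y
    unfolding V_bracket_eq [OF that g]
    by (intro subspace_add subspace_diff subspace_m_sp dir_deriv_m_sp that V_fields_G_alg g m_vec_m_sp)
  note bracket = this [OF X(1) Y(1)]
  have "curvature_fields ?D (extend_vec g u) (extend_vec g v) (extend_vec g w) g =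
      curvature_fields ?I (extend_vec g u) (extend_vec g v) (extend_vec g w) g"
    unfolding curvature_fields_def twice [OF X(1) Y(1) Z(1)] twice [OF Y(1) X(1) Z(1)]
      levi_civita_eq [OF pos g bracket Z(1)] by (rule refl)
  then show ?thesis
    unfolding curvature_def by (simp add: curvature_fields_invariant g X Y Z)
qed

lemma metric_diag_pos: "metric_diag \<alpha> \<beta> \<gamma> i > 0"
  using pos by (simp add: metric_diag_def)

lemma e_orth_eq: "e_orth \<alpha> \<beta> \<gamma> i = m_vec ((1 / sqrt (metric_diag \<alpha> \<beta> \<gamma> i)) *\<^sub>R axis i 1)"
  by (simp add: e_orth_def linear_scale [OF linear_m_vec] m_vec_axis)

lemma inner5_axis: "inner5 \<alpha> \<beta> \<gamma> x (axis i 1) = metric_diag \<alpha> \<beta> \<gamma> i * x $ i"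
  by (cases i rule: exhaust_5) (simp_all add: inner5_def axis_def metric_diag_def)

text \<open>A trace does not depend on the scaling of the basis: the two factors
  \<open>1 / sqrt d\<close> cancel the weight \<open>d\<close> of the metric, which survives only
  through the two Nomizu parameters.\<close>

lemma Ric_trace:
  assumes g: "g \<in> G_grp" and y: "y \<in> m_sp" and z: "z \<in> m_sp"
  shows "Ric \<alpha> \<beta> \<gamma> g y z = (\<Sum>i\<in>UNIV. curv5 (\<alpha> / (5 * \<beta>)) (\<alpha> / (10 * \<gamma>)) (axis i 1) (m_coord y) (m_coord z) $ i)"
  unfolding Ric_def
proof (rule sum.cong [OF refl])
  fix i :: 5
  have brk: "m_brk (r *\<^sub>R u) v = r *\<^sub>R m_brk u v" "h_brk (r *\<^sub>R u) v = r * h_brk u v" for r u v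
    by (simp_all add: m_brk_def h_brk_def vec5_eq_iff field_simps)
  have lin: "curv5 p q (r *\<^sub>R u) v w = r *\<^sub>R curv5 p q u v w" for p q r u v w
    by (simp add: curv5_def brk nomizu.scaleR_left nomizu.scaleR_right scaleR_diff_right)
  define d where "d = metric_diag \<alpha> \<beta> \<gamma> i"
  have d: "d > 0" unfolding d_def by (rule metric_diag_pos)
  have "metric \<alpha> \<beta> \<gamma> (curvature (levi_civita \<alpha> \<beta> \<gamma>) g (e_orth \<alpha> \<beta> \<gamma> i) y z) (e_orth \<alpha> \<beta> \<gamma> i)
    = (1 / sqrt d) * ((1 / sqrt d) * (d * curv5 (\<alpha> / (5 * \<beta>)) (\<alpha> / (10 * \<gamma>)) (axis i 1) (m_coord y) (m_coord z) $ i))"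
    by (simp only: curvature_levi_civita [OF g _ y z] e_orth_eq m_vec_m_sp metric_m_vec m_coord_m_vec lin inner5_simps inner5_axis d_def [symmetric])
  also have "\<dots> = curv5 (\<alpha> / (5 * \<beta>)) (\<alpha> / (10 * \<gamma>)) (axis i 1) (m_coord y) (m_coord z) $ i"
    using d by (simp add: field_simps real_sqrt_mult [symmetric])
  finally show "metric \<alpha> \<beta> \<gamma> (curvature (levi_civita \<alpha> \<beta> \<gamma>) g (e_orth \<alpha> \<beta> \<gamma> i) y z) (e_orth \<alpha> \<beta> \<gamma> i) =
     curv5 (\<alpha> / (5 * \<beta>)) (\<alpha> / (10 * \<gamma>)) (axis i 1) (m_coord y) (m_coord z) $ i" .
qed

end

section \<open>The Ricci tensor in coordinates and the Einstein metric\<close>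

lemma curv5_trace:
  "(\<Sum>i\<in>UNIV. curv5 p q (axis i 1) y z $ i) = (2 * p * p + 2 * q * q) * (y $ 1 * z $ 1)
    + (1 - 2 * p / 5) * (y $ 2 * z $ 2 + y $ 3 * z $ 3) + (1 - q / 5) * (y $ 4 * z $ 4 + y $ 5 * z $ 5)"
proof -
  have a: "axis i (1::real) $ j = (if j = i then 1 else 0)" for i j :: 5
    by (simp add: axis_def)
  show ?thesis
    unfolding sum_5 curv5_def
    by (simp add: nomizu_def m_brk_def h_brk_def ad_h_def a) (simp add: field_simps)
qed

lemma Ric_eq:
  assumes pos: "\<alpha> > 0" "\<beta> > 0" "\<gamma> > 0" and "g \<in> G_grp" "y \<in> m_sp" "z \<in> m_sp"
  shows "Ric \<alpha> \<beta> \<gamma> g y z = (2 * \<alpha>^2 / (25 * \<beta>^2) + \<alpha>^2 / (50 * \<gamma>^2)) * (m_coord y $ 1 * m_coord z $ 1)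
    + (1 - 2 * \<alpha> / (25 * \<beta>)) * (m_coord y $ 2 * m_coord z $ 2 + m_coord y $ 3 * m_coord z $ 3)
    + (1 - \<alpha> / (50 * \<gamma>)) * (m_coord y $ 4 * m_coord z $ 4 + m_coord y $ 5 * m_coord z $ 5)"
proof -
  have "2 * (\<alpha> / (5 * \<beta>)) * (\<alpha> / (5 * \<beta>)) + 2 * (\<alpha> / (10 * \<gamma>)) * (\<alpha> / (10 * \<gamma>)) = 2 * \<alpha>^2 / (25 * \<beta>^2) + \<alpha>^2 / (50 * \<gamma>^2)"
    by (simp add: power2_eq_square)
  then show ?thesis
    unfolding Ric_trace [OF assms] curv5_trace by simp
qed

lemma Ric_e_orth:
  assumes pos: "\<alpha> > 0" "\<beta> > 0" "\<gamma> > 0" and g: "g \<in> G_grp"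
  shows "i \<noteq> j \<Longrightarrow> Ric \<alpha> \<beta> \<gamma> g (e_orth \<alpha> \<beta> \<gamma> i) (e_orth \<alpha> \<beta> \<gamma> j) = 0"
    and "Ric \<alpha> \<beta> \<gamma> g (e_orth \<alpha> \<beta> \<gamma> i) (e_orth \<alpha> \<beta> \<gamma> i) =
      (if i = 1 then 2 * \<alpha> / (25 * \<beta>^2) + \<alpha> / (50 * \<gamma>^2)
       else if i = 2 \<or> i = 3 then 1 / \<beta> - 2 * \<alpha> / (25 * \<beta>^2) else 1 / \<gamma> - \<alpha> / (50 * \<gamma>^2))"
proof -
  have c: "m_coord (e_orth \<alpha> \<beta> \<gamma> i) $ j = (if j = i then 1 / sqrt (metric_diag \<alpha> \<beta> \<gamma> i) else 0)" for i j
    unfolding e_orth_eq [OF pos] m_coord_m_vec by (simp add: axis_def)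
  have m: "e_orth \<alpha> \<beta> \<gamma> i \<in> m_sp" for i
    by (simp add: e_orth_eq [OF pos])
  have sq: "1 / sqrt x * (1 / sqrt x) = 1 / x" if "x > 0" for x
    using that by (simp add: real_sqrt_mult [symmetric])
  show "i \<noteq> j \<Longrightarrow> Ric \<alpha> \<beta> \<gamma> g (e_orth \<alpha> \<beta> \<gamma> i) (e_orth \<alpha> \<beta> \<gamma> j) = 0"
    unfolding Ric_eq [OF pos g m m] c by (cases i rule: exhaust_5) auto
  show "Ric \<alpha> \<beta> \<gamma> g (e_orth \<alpha> \<beta> \<gamma> i) (e_orth \<alpha> \<beta> \<gamma> i) =
      (if i = 1 then 2 * \<alpha> / (25 * \<beta>^2) + \<alpha> / (50 * \<gamma>^2)
       else if i = 2 \<or> i = 3 then 1 / \<beta> - 2 * \<alpha> / (25 * \<beta>^2) else 1 / \<gamma> - \<alpha> / (50 * \<gamma>^2))"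
    unfolding Ric_eq [OF pos g m m] c
    using pos by (cases i rule: exhaust_5) (simp_all add: metric_diag_def field_simps power2_eq_square)
qed

text \<open>Everything becomes rational in \<open>c\<close>, the cube root of 10, and
  \<open>k\<close>, one fifth of the scalar curvature, is the Einstein constant. The three equations
  compare the coefficients of the Ricci form with those of \<open>k\<close> times the
  metric.\<close>

lemma Einstein_metric_values:
  fixes \<beta> \<gamma> :: real
  assumes \<beta>: "\<beta> = 18 / (25 * (10 powr (2/3) - 2 * 10 powr (1/3) + 4))"
    and \<gamma>: "\<gamma> = 3 * (9 + sqrt (21 + 12 * 10 powr (1/3) + 3 * 10 powr (2/3))) / (25 * (20 - 4 * 10 powr (1/3) - 10 powr (2/3)))"
  defines "k \<equiv> (1/5) * ((5/3)^3 * (10 - 2 * 10 powr (1/3) - 10 powr (2/3) / 2)) :: real"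
  shows "\<bar>\<beta> - 0.166177\<bar> < 0.0000005" "\<bar>\<gamma> - 0.299009\<bar> < 0.0000005" "\<beta> > 0" "\<gamma> > 0"
    "2 / (25 * \<beta>^2) + 1 / (50 * \<gamma>^2) = k" "1 - 2 / (25 * \<beta>) = k * \<beta>" "1 - 1 / (50 * \<gamma>) = k * \<gamma>"
    "\<bar>(5/3)^3 * (10 - 2 * 10 powr (1/3) - 10 powr (2/3) / 2) - (15.60340835::real)\<bar> < 0.000000005"
proof -
  define c where "c = (10::real) powr (1/3)"
  have c2: "10 powr (2/3) = c^2" and c3: "c^3 = 10"
    by (simp_all add: c_def powr_power)
  have cpos: "c > 0" by (simp add: c_def)
  \<comment> \<open>An enclosure of width \<open>10^(-11)\<close>, far finer than the three
    numerical claims require.\<close>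
  have "2.15443469003 ^ 3 < c ^ 3" "c ^ 3 < 2.15443469004 ^ 3"
    unfolding c3 by (simp_all add: power3_eq_cube)
  then have l: "2.15443469003 < c" and u: "c < 2.15443469004"
    using cpos power_less_imp_less_base [of "2.15443469003" 3 c] power_less_imp_less_base [of c 3 "2.15443469004"] by simp_all
  have cc: "2.15443469003 * 2.15443469003 < c * c" "c * c < 2.15443469004 * 2.15443469004"
    using l u by (intro mult_strict_mono; simp)+
  have ccc: "c * (c * c) = 10" using c3 by (simp add: power3_eq_cube)
  \<comment> \<open>The product is the sum of cubes \<open>c^3 + 8\<close>; it clears the
    denominator of \<open>\<beta>\<close>.\<close>
  have r1: "(c^2 - 2 * c + 4) * (c + 2) = 18"
    using ccc by (simp add: algebra_simps power2_eq_square)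
  have \<beta>c: "\<beta> = (c + 2) / 25"
  proof -
    have "c^2 - 2 * c + 4 \<noteq> 0" using r1 by auto
    then show ?thesis unfolding \<beta> c2 c_def [symmetric] using r1 by (simp add: field_simps)
  qed
  have r2: "sqrt (21 + 12 * c + 3 * c^2) = c^2 + c + 1"
  proof (rule real_sqrt_unique)
    have "c^4 = 10 * c" using ccc by (simp add: power4_eq_xxxx algebra_simps)
    then show "(c^2 + c + 1)^2 = 21 + 12 * c + 3 * c^2"
      using c3 by (simp add: power2_eq_square algebra_simps power3_eq_cube power4_eq_xxxx)
  qed (use cpos in simp)
  have r3: "(c + 2)^2 * (20 - 4 * c - c^2) = 54 * c"
  proof -
    have "c * (c * (c * c)) = 10 * c" using ccc by simp
    then show ?thesis using ccc by (simp add: power2_eq_square algebra_simps)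
  qed
  have r4: "(c^2 + c + 10) * (c - 1) = 9 * c"
    using ccc by (simp add: algebra_simps power2_eq_square)
  have \<gamma>c: "\<gamma> = (c + 2)^2 / (50 * (c - 1))"
  proof -
    have nz: "20 - 4 * c - c^2 \<noteq> 0" using r3 cpos by auto
    have "3 * (9 + (c^2 + c + 1)) * (50 * (c - 1)) = 150 * ((c^2 + c + 10) * (c - 1))" by (simp add: algebra_simps)
    also have "\<dots> = 25 * ((c + 2)^2 * (20 - 4 * c - c^2))" unfolding r3 r4 by simp
    finally show ?thesis
      unfolding \<gamma> c2 c_def [symmetric] r2 using nz l by (simp add: frac_eq_eq)
  qed
  \<comment> \<open>Expanded, this is just \<open>c^3 = 10\<close>. It is the relation that makes
    the equations for the first and for the last two basis vectors hold with the same
    \<open>k\<close> as the equation for the middle two.\<close>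
  have r5: "(c - 2) * (c + 2)^2 = 2 * (c - 1)^2"
    using ccc by (simp add: algebra_simps power2_eq_square)
  have k: "k = 25 * c / (c + 2)^2"
  proof -
    have "c * (c * (c * c)) = 10 * c" using ccc by simp
    then have "27 * c = (c + 2)^2 * (10 - 2 * c - c^2 / 2)"
      using ccc by (simp add: power2_eq_square field_simps)
    then show ?thesis
      unfolding k_def c2 c_def [symmetric] using cpos by (simp add: field_simps power3_eq_cube)
  qed
  show "\<beta> > 0" "\<gamma> > 0" unfolding \<beta>c \<gamma>c using l by simp_all
  show "\<bar>\<beta> - 0.166177\<bar> < 0.0000005" unfolding \<beta>c using l u by (simp add: abs_if field_simps)
  have "0.2990085 * (50 * (c - 1)) < (c + 2)^2" "(c + 2)^2 < 0.2990095 * (50 * (c - 1))"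
    unfolding power2_eq_square using cc l u by (simp_all add: algebra_simps)
  then have "0.2990085 < \<gamma>" "\<gamma> < 0.2990095"
    unfolding \<gamma>c using l by (simp_all add: pos_less_divide_eq pos_divide_less_eq)
  then show "\<bar>\<gamma> - 0.299009\<bar> < 0.0000005" by (intro abs_less_iff [THEN iffD2] conjI) simp_all
  show "\<bar>(5/3)^3 * (10 - 2 * 10 powr (1/3) - 10 powr (2/3) / 2) - (15.60340835::real)\<bar> < 0.000000005"
  proof -
    have "(5/3)^3 * (10 - 2 * c - c^2 / 2) = 1250 / 27 - 250 / 27 * c - 125 / 54 * (c * c)"
      by (simp add: power3_eq_cube power2_eq_square)
    moreover have "1250 / 27 - 250 / 27 * c - 125 / 54 * (c * c) < 15.60340835 + 0.000000005"
        "15.60340835 - 0.000000005 < 1250 / 27 - 250 / 27 * c - 125 / 54 * (c * c)"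
      using cc l u by simp_all
    ultimately show ?thesis
      unfolding c2 c_def [symmetric] by (intro abs_less_iff [THEN iffD2] conjI) simp_all
  qed
  have nz: "c + 2 \<noteq> 0" "c - 1 \<noteq> 0" using l by simp_all
  show "1 - 2 / (25 * \<beta>) = k * \<beta>"
  proof -
    have "k * \<beta> = c / (c + 2)" unfolding \<beta>c k using nz by (simp add: divide_simps power2_eq_square)
    moreover have "1 - 2 / (25 * \<beta>) = c / (c + 2)" unfolding \<beta>c using nz by (simp add: field_simps)
    ultimately show ?thesis by simp
  qed
  show "1 - 1 / (50 * \<gamma>) = k * \<gamma>"
  proof -
    have "((c + 2)^2 - (c - 1)) * (2 * (c - 1)) = c * (c + 2)^2"
      using r5 by (simp add: power2_eq_square algebra_simps)
    then have "1 - (c - 1) / (c + 2)^2 = c / (2 * (c - 1))"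
      using nz by (simp add: field_simps)
    moreover have *: "1 / (50 * (s / (50 * d))) = d / s" "25 * c / s * (s / (50 * d)) = c / (2 * d)"
      if "s \<noteq> 0" "d \<noteq> 0" for s d :: real
      using that by (simp_all add: field_simps)
    moreover have "1 / (50 * \<gamma>) = (c - 1) / (c + 2)^2" "k * \<gamma> = c / (2 * (c - 1))"
      unfolding \<gamma>c k by (rule *; use nz in simp)+
    ultimately show ?thesis by simp
  qed
  show "2 / (25 * \<beta>^2) + 1 / (50 * \<gamma>^2) = k"
  proof -
    have **: "1 / (50 * (s / (50 * d))^2) = 50 * d^2 / (s * s)" for s d :: real
      by (simp add: power2_eq_square)
    have *: "2 / (25 * \<beta>^2) = 50 / (c + 2)^2" "1 / (50 * \<gamma>^2) = 50 * (c - 1)^2 / ((c + 2)^2 * (c + 2)^2)"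
      using ** [of "(c + 2)^2" "c - 1"] unfolding \<beta>c \<gamma>c by (simp_all add: power_divide)
    have "50 * (c - 1)^2 = 25 * ((c - 2) * (c + 2)^2)" unfolding r5 by simp
    moreover have "25 * (d * s) / (s * s) = 25 * d / s" if "s \<noteq> 0" for s d :: real
      using that by simp
    ultimately have "50 * (c - 1)^2 / ((c + 2)^2 * (c + 2)^2) = 25 * (c - 2) / (c + 2)^2"
      using nz by (metis power_not_zero)
    then show ?thesis unfolding * k by (simp add: add_divide_distrib [symmetric] algebra_simps)
  qed
qed

text \<open>Skew-symmetry is tested on \<open>a_1\<close>, \<open>a_2\<close> and
  \<open>e_tilde 1\<close>, where it reads \<open>- 2 \<alpha> / 5 = - 2 \<beta>\<close>.\<close>

lemma naturally_reductive_imp: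
  assumes "naturally_reductive \<alpha> \<beta> \<gamma>" shows "\<alpha> = 5 * \<beta>"
proof -
  have T: "metric \<alpha> \<beta> \<gamma> (m_part (bracket (m_vec x) (m_vec y))) (m_vec z) = inner5 \<alpha> \<beta> \<gamma> (m_brk x y) z" for x y z
    by (subst m_part_eq [OF bracket_G_alg])
      (simp_all add: bracket_m_vec linear_add [OF linear_m_coord] linear_scale [OF linear_m_coord] metric_m_vec)
  have "metric \<alpha> \<beta> \<gamma> (m_part (bracket X Y)) Z = - metric \<alpha> \<beta> \<gamma> (m_part (bracket X Z)) Y"
    if "X \<in> m_sp" "Y \<in> m_sp" "Z \<in> m_sp" for X Y Z
    using assms that unfolding naturally_reductive_def Let_def by blast
  from this [of "m_vec (axis 2 1)" "m_vec (axis 3 1)" "m_vec (axis 1 1)"]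
  have "inner5 \<alpha> \<beta> \<gamma> (m_brk (axis 2 1) (axis 3 1)) (axis 1 1) = - inner5 \<alpha> \<beta> \<gamma> (m_brk (axis 2 1) (axis 1 1)) (axis 3 1)"
    by (simp add: T)
  then show ?thesis by (simp add: inner5_def m_brk_def axis_def)
qed

subsection \<open>Generation of the rotation group by plane rotations\<close>

definition plane_gen :: "'n \<Rightarrow> 'n \<Rightarrow> real^'n^'n"
  where "plane_gen i j = (\<chi> r c. if r = j \<and> c = i then 1 else if r = i \<and> c = j then - 1 else 0)"

definition plane_rot :: "'n \<Rightarrow> 'n \<Rightarrow> real \<Rightarrow> real^'n^'n"
  where "plane_rot i j t = rodr (plane_gen i j) t"

lemma plane_gen_vec:
  assumes "i \<noteq> j"
  shows "(plane_gen i j *v x) $ r = (if r = j then x $ i else if r = i then - x $ j else 0)"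
proof -
  have "(plane_gen i j *v x) $ r = (\<Sum>c\<in>UNIV. if c = i then if r = j then x $ c else 0 else if c = j then if r = i then - x $ c else 0 else 0)"
    unfolding matrix_vector_mult_def plane_gen_def by (auto intro!: sum.cong simp: assms)
  also have "\<dots> = (\<Sum>c\<in>UNIV. (if c = i then if r = j then x $ c else 0 else 0) + (if c = j then if r = i then - x $ c else 0 else 0))"
    using assms by (intro sum.cong) auto
  also have "\<dots> = (if r = j then x $ i else if r = i then - x $ j else 0)"
    using assms by (simp add: sum.distrib)
  finally show ?thesis .
qed

lemma matrix_vector_mult_minus: "(- B) *v x = - (B *v x)" for B :: "real^'n^'m"
  by (simp add: matrix_vector_mult_def vec_eq_iff sum_negf)

lemma rot_gen_plane_gen:
  assumes "i \<noteq> j" shows "rot_gen (plane_gen i j)"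
proof -
  have "transpose (plane_gen i j) = - plane_gen i j"
    using assms by (auto simp: plane_gen_def transpose_def vec_eq_iff)
  moreover have "plane_gen i j ** plane_gen i j ** plane_gen i j = - plane_gen i j"
    unfolding matrix_eq
    by (auto simp: matrix_vector_mul_assoc [symmetric] vec_eq_iff plane_gen_vec assms matrix_vector_mult_minus)
  ultimately show ?thesis by (simp add: rot_gen_def)
qed

lemma plane_rot_vec:
  assumes "i \<noteq> j"
  shows "(plane_rot i j t *v x) $ r = (if r = i then cos t * x $ i - sin t * x $ j
    else if r = j then sin t * x $ i + cos t * x $ j else x $ r)"
proof -
  have "plane_rot i j t *v x = x + sin t *\<^sub>R (plane_gen i j *v x) + (1 - cos t) *\<^sub>R (plane_gen i j *v (plane_gen i j *v x))"
    by (simp add: plane_rot_def rodr_def matrix_vector_mult_add_rdistrib scaleR_matrix_vector_assoc [symmetric] matrix_vector_mul_assoc)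
  then have "(plane_rot i j t *v x) $ r = x $ r + sin t * (plane_gen i j *v x) $ r
      + (1 - cos t) * (plane_gen i j *v (plane_gen i j *v x)) $ r"
    by simp
  also have "\<dots> = (if r = i then cos t * x $ i - sin t * x $ j else if r = j then sin t * x $ i + cos t * x $ j else x $ r)"
    using assms by (simp add: plane_gen_vec algebra_simps)
  finally show ?thesis .
qed

lemma plane_rot_mult:
  assumes "i \<noteq> j"
  shows "(plane_rot i j t ** A) $ r $ c = (if r = i then cos t * A $ i $ c - sin t * A $ j $ c
    else if r = j then sin t * A $ i $ c + cos t * A $ j $ c else A $ r $ c)"
proof -
  have "(plane_rot i j t ** A) $ r $ c = (plane_rot i j t *v column c A) $ r"
    by (simp add: matrix_matrix_mult_def matrix_vector_mult_def column_def)
  then show ?thesis by (simp add: plane_rot_vec assms column_def)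
qed

lemma rotation_plane_rot: "i \<noteq> j \<Longrightarrow> rotation_matrix (plane_rot i j t)"
  by (simp add: plane_rot_def rodr_rotation rot_gen_plane_gen)

lemma plane_rot_swap: "i \<noteq> j \<Longrightarrow> plane_rot j i t = plane_rot i j (- t)"
  by (simp add: matrix_eq vec_eq_iff plane_rot_vec)

text \<open>The quarter turn takes the \<open>k\<close>-axis to the \<open>i\<close>-axis and fixes
  the \<open>j\<close>-axis, so conjugation moves the plane of rotation.\<close>

lemma plane_rot_conj:
  assumes "i \<noteq> j" "k \<noteq> i" "k \<noteq> j"
  shows "plane_rot k i (pi / 2) ** (plane_rot k j t ** plane_rot k i (- (pi / 2))) = plane_rot i j t"
  using assms by (simp add: matrix_eq matrix_vector_mul_assoc [symmetric] vec_eq_iff plane_rot_vec)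

text \<open>Minus the polar angle of the point with coordinates \<open>a\<close>, \<open>b\<close>:
  the rotation moves that point to the non-negative first axis.\<close>

lemma zeroing_angle:
  fixes a b :: real
  obtains t where "sin t * a + cos t * b = 0" "cos t * a - sin t * b \<ge> 0"
proof (cases "a = 0 \<and> b = 0")
  case True
  then show ?thesis using that [of 0] by simp
next
  case False
  define r where "r = sqrt (a^2 + b^2)"
  have r: "r > 0" "r^2 = a^2 + b^2"
    using False by (auto simp: r_def sum_power2_gt_zero_iff)
  then have "(a / r)^2 + (- b / r)^2 = 1"
    by (simp add: power_divide add_divide_distrib [symmetric] r(2) [symmetric])
  then obtain t where t: "a / r = cos t" "- b / r = sin t"
    by (rule sincos_total_2pi)
  have "cos t * a - sin t * b = (a^2 + b^2) / r"
    by (simp add: t [symmetric] power2_eq_square add_divide_distrib)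
  then show ?thesis
    using r by (intro that [of t]) (simp_all add: t [symmetric] field_simps)
qed

text \<open>Columns are made standard one after the other by Givens rotations; the determinant settles the
  sign left in the last one.\<close>

lemma plane_rotations_generate:
  fixes P :: "(real^'n^'n) set" and A :: "real^'n^'n"
  assumes rot: "\<And>B. B \<in> P \<Longrightarrow> rotation_matrix B" and one: "mat 1 \<in> P"
    and mult: "\<And>B C. B \<in> P \<Longrightarrow> C \<in> P \<Longrightarrow> B ** C \<in> P"
    and gen: "\<And>i j t. i \<noteq> j \<Longrightarrow> plane_rot i j t \<in> P"
    and A: "rotation_matrix A"
  shows "A \<in> P"
proof -
  define std where "std S C \<longleftrightarrow> (\<forall>k\<in>S. \<forall>r. C $ r $ k = (if r = k then 1 else 0))" for S and C :: "real^'n^'n"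
  have rotA: "rotation_matrix (B ** transpose A)" if "B \<in> P" for B
    using rot [OF that] A by (intro rotation_matrix_mult rotation_matrix_transpose)
  \<comment> \<open>Rows \<open>k\<close> and \<open>j\<close> lie outside \<open>S\<close>, where
    the standard columns have zeros, so these columns survive. The sign of the diagonal entry is
    controlled only if some rotation was applied, that is for non-empty \<open>J\<close>.\<close>
  have clear: "\<exists>B\<in>P. std S (B ** transpose A) \<and> (\<forall>j\<in>J. (B ** transpose A) $ j $ k = 0) \<and> (J \<noteq> {} \<longrightarrow> (B ** transpose A) $ k $ k \<ge> 0)"
    if "finite J" "J \<inter> insert k S = {}" and k: "k \<notin> S" and B: "B \<in> P" "std S (B ** transpose A)" for J S k B
    using that(1,2)
  proof (induction J)
    case empty
    then show ?case using B by auto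
  next
    case (insert j J)
    then obtain B where B: "B \<in> P" "std S (B ** transpose A)" "\<forall>j\<in>J. (B ** transpose A) $ j $ k = 0" by auto
    define C where "C = B ** transpose A"
    have kj: "k \<noteq> j" "j \<notin> S" using insert by auto
    obtain t where t: "sin t * C $ k $ k + cos t * C $ j $ k = 0" "cos t * C $ k $ k - sin t * C $ j $ k \<ge> 0"
      by (rule zeroing_angle)
    define B' where "B' = plane_rot k j t ** B"
    have B'A: "B' ** transpose A = plane_rot k j t ** C" by (simp add: B'_def C_def matrix_mul_assoc)
    have "B' \<in> P" unfolding B'_def by (intro mult gen B kj)
    moreover have "std S (B' ** transpose A)"
      using B(2) k kj unfolding std_def B'A C_def [symmetric] by (auto simp: plane_rot_mult)
    moreover have "\<forall>j'\<in>insert j J. (B' ** transpose A) $ j' $ k = 0"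
      using B(3) insert.hyps insert.prems kj t(1) unfolding B'A C_def [symmetric] by (auto simp: plane_rot_mult)
    moreover have "(B' ** transpose A) $ k $ k \<ge> 0"
      using kj t(2) unfolding B'A by (simp add: plane_rot_mult)
    ultimately show ?case by blast
  qed
  have "\<exists>B\<in>P. std S (B ** transpose A)" if "finite S" for S
    using that
  proof (induction S)
    case empty
    then show ?case using one by (auto simp: std_def)
  next
    case (insert k S)
    then obtain B0 where "B0 \<in> P" "std S (B0 ** transpose A)" by blast
    from clear [OF _ _ insert.hyps(2) this, of "- insert k S"]
    obtain B where B: "B \<in> P" "std S (B ** transpose A)" "\<forall>j\<in>- insert k S. (B ** transpose A) $ j $ k = 0"
      "- insert k S \<noteq> {} \<longrightarrow> (B ** transpose A) $ k $ k \<ge> 0" by auto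
    define C where "C = B ** transpose A"
    note B = B [folded C_def]
    have rotC: "rotation_matrix C" unfolding C_def by (rule rotA [OF B(1)])
    then have "transpose C ** C = mat 1" by (simp add: rotation_matrix_def orthogonal_matrix_def)
    then have orth: "(\<Sum>r\<in>UNIV. C $ r $ a * C $ r $ b) = (if a = b then 1 else 0)" for a b
      by (simp add: vec_eq_iff matrix_matrix_mult_def transpose_def mat_def)
    \<comment> \<open>In the rows of \<open>S\<close> the entry vanishes by orthogonality to the
      columns that are already standard.\<close>
    have off: "C $ r $ k = 0" if "r \<noteq> k" for r
    proof (cases "r \<in> S")
      case True
      have "(\<Sum>s\<in>UNIV. C $ s $ r * C $ s $ k) = (\<Sum>s\<in>UNIV. if s = r then C $ s $ k else 0)"
        using B(2) True by (intro sum.cong) (auto simp: std_def)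
      then show ?thesis using orth [of r k] that by simp
    next
      case False
      then show ?thesis using B(3) that by auto
    qed
    have "(\<Sum>s\<in>UNIV. C $ s $ k * C $ s $ k) = (\<Sum>s\<in>UNIV. if s = k then C $ s $ k * C $ s $ k else 0)"
      using off by (intro sum.cong) auto
    then have sq: "C $ k $ k * C $ k $ k = 1" using orth [of k k] by simp
    have "C $ k $ k = 1"
    proof (cases "- insert k S = {}")
      case False
      then have "C $ k $ k \<ge> 0" using B(4) by blast
      moreover have "C $ k $ k = 1 \<or> C $ k $ k = - 1" using sq square_eq_1_iff by blast
      ultimately show ?thesis by auto
    next
      case True
      \<comment> \<open>In the last column no rotation fixes the sign. The matrix is now diagonal
        and its determinant is the remaining entry.\<close>
      have S: "b \<in> S" if "b \<noteq> k" for b using True that by auto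
      have offdiag: "C $ a $ b = 0" if "a \<noteq> b" for a b
        using B(2) off [of a] S [of b] that by (cases "b = k") (auto simp: std_def)
      have "det C = (\<Prod>i\<in>UNIV. C $ i $ i)"
        by (rule det_diagonal) (rule offdiag)
      also have "\<dots> = (\<Prod>i\<in>UNIV. if i = k then C $ k $ k else 1)"
        using B(2) S by (intro prod.cong) (auto simp: std_def)
      finally show ?thesis using rotC by (simp add: rotation_matrix_def)
    qed
    then have "std (insert k S) C" using B(2) off by (auto simp: std_def)
    then show ?case using B(1) C_def by blast
  qed
  from this [of UNIV] obtain B where B: "B \<in> P" "std UNIV (B ** transpose A)" by auto
  then have "B ** transpose A = mat 1" by (simp add: std_def vec_eq_iff mat_def)
  moreover have "transpose A ** A = mat 1" using A by (simp add: rotation_matrix_def orthogonal_matrix_def)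
  ultimately have "A = B" by (metis matrix_mul_assoc matrix_mul_lid matrix_mul_rid)
  then show ?thesis using B(1) by simp
qed

lemma pencil_rotations_generate:
  fixes P :: "(real^'n^'n) set" and A :: "real^'n^'n"
  assumes rot: "\<And>B. B \<in> P \<Longrightarrow> rotation_matrix B" and one: "mat 1 \<in> P"
    and mult: "\<And>B C. B \<in> P \<Longrightarrow> C \<in> P \<Longrightarrow> B ** C \<in> P"
    and gen: "\<And>j t. k \<noteq> j \<Longrightarrow> plane_rot k j t \<in> P"
    and A: "rotation_matrix A"
  shows "A \<in> P"
proof (rule plane_rotations_generate [OF rot one mult _ A])
  fix i j :: 'n and t assume ij: "i \<noteq> j"
  consider "i = k" | "j = k" | "k \<noteq> i" "k \<noteq> j" by blast
  then show "plane_rot i j t \<in> P"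
  proof cases
    case 3
    show ?thesis unfolding plane_rot_conj [OF ij 3, symmetric] by (intro mult gen 3)
  qed (use gen plane_rot_swap ij in metis)+
qed

subsection \<open>Parallel transport\<close>

text \<open>The term with \<open>ad_h\<close> accounts for lifts that are not horizontal: the
  velocity in \<open>G\<close> of a lifted loop may have a vertical part.\<close>

definition transp :: "real \<Rightarrow> real \<Rightarrow> mpair \<Rightarrow> real^5 \<Rightarrow> real^5"
  where "transp p q X y = nomizu p q (m_coord X) y + h_coord X *\<^sub>R ad_h y"

lemma linear_ad_h: "linear ad_h"
  by (intro linearI) (simp_all add: ad_h_def vec5_eq_iff)

lemma linear_transp: "linear (transp p q X)"
  by (intro linearI) (simp_all add: transp_def nomizu.add_right nomizu.scaleR_right linear_add [OF linear_ad_h]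
      linear_scale [OF linear_ad_h] algebra_simps)

lemma transp_skew:
  assumes "\<beta> > 0" "\<gamma> > 0"
  shows "inner5 \<alpha> \<beta> \<gamma> (transp (\<alpha> / (5 * \<beta>)) (\<alpha> / (10 * \<gamma>)) X x) y
    + inner5 \<alpha> \<beta> \<gamma> x (transp (\<alpha> / (5 * \<beta>)) (\<alpha> / (10 * \<gamma>)) X y) = 0"
proof -
  have "inner5 \<alpha> \<beta> \<gamma> (ad_h x) y + inner5 \<alpha> \<beta> \<gamma> x (ad_h y) = 0"
    by (simp add: inner5_def ad_h_def algebra_simps)
  then have "h_coord X * (inner5 \<alpha> \<beta> \<gamma> (ad_h x) y + inner5 \<alpha> \<beta> \<gamma> x (ad_h y)) = 0"
    by simp
  then show ?thesis
    using nomizu_skew [OF assms, of \<alpha> "m_coord X" x y] unfolding transp_def inner5_simps by (simp add: algebra_simps)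
qed

text \<open>Differentiating \<open>mp_transp (c s) \<bullet>\<^sub>G c s = 1\<^sub>G\<close> gives
  skew-symmetry.\<close>

lemma G_curve_velocity:
  assumes "a < b" and t: "t \<in> {a..b}" and G: "c ` {a..b} \<subseteq> G_grp"
    and c: "(c has_vector_derivative d) (at t within {a..b})"
  shows "mp_transp (c t) \<bullet>\<^sub>G d \<in> G_alg"
proof -
  have "((\<lambda>s. mp_transp (c s) \<bullet>\<^sub>G c s) has_vector_derivative mp_transp (c t) \<bullet>\<^sub>G d + mp_transp d \<bullet>\<^sub>G c t) (at t within {a..b})"
    by (rule mp.has_vector_derivative [OF bounded_linear.has_vector_derivative [OF bounded_linear_mp_transp c] c])
  moreover have "((\<lambda>s. mp_transp (c s) \<bullet>\<^sub>G c s) has_vector_derivative 0) (at t within {a..b})"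
  proof (rule has_vector_derivative_transform [OF t])
    show "((\<lambda>s. 1\<^sub>G) has_vector_derivative 0) (at t within {a..b})"
      by (rule has_vector_derivative_const)
  qed (use G in \<open>simp add: G_transp_mult image_subset_iff\<close>)
  ultimately have "mp_transp (c t) \<bullet>\<^sub>G d + mp_transp d \<bullet>\<^sub>G c t = 0"
    using vector_derivative_unique_within_closed_interval [OF assms(1), of t] t by simp
  then show ?thesis
    by (simp add: mem_G_alg mp_transp_mult eq_neg_iff_add_eq_0 add.commute)
qed

section \<open>Partitions of the unit interval\<close>

lemma partition_cover:
  fixes p :: "nat \<Rightarrow> real"
  assumes "partition01 n p" "t \<in> {0..1}"
  shows "\<exists>k<n. t \<in> {p k..p (Suc k)}"
proof -
  have "m \<le> n \<Longrightarrow> p 0 \<le> t \<Longrightarrow> t \<le> p m \<Longrightarrow> m > 0 \<Longrightarrow> \<exists>k<m. t \<in> {p k..p (Suc k)}" for m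
  proof (induction m)
    case (Suc m)
    show ?case
    proof (cases "t \<le> p m \<and> m > 0")
      case True
      then show ?thesis using Suc less_Suc_eq by (metis Suc_leD)
    next
      case False
      then have "p m \<le> t" using Suc.prems by (cases "m = 0") auto
      then show ?thesis using Suc.prems by (intro exI [of _ m]) auto
    qed
  qed simp
  from this [of n] show ?thesis using assms by (cases "n = 0") (auto simp: partition01_def)
qed

lemma partition_less: "partition01 n p \<Longrightarrow> k < n \<Longrightarrow> p k < p (Suc k)"
  by (simp add: partition01_def)

lemma partition_mono:
  assumes "partition01 n p" "i \<le> j" "j \<le> n" shows "p i \<le> p j"
  using assms(2,3)
proof (induction j rule: dec_induct)
  case (step m)
  then show ?case using partition_less [OF assms(1), of m] by simp
qed simp

lemma partition_subset:
  assumes "partition01 n p" "k < n" shows "{p k..p (Suc k)} \<subseteq> {0..1}"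
  using partition_mono [OF assms(1), of 0 k] partition_mono [OF assms(1), of "Suc k" n] assms
  by (auto simp: partition01_def)

lemma continuous_on_det:
  fixes B :: "real \<Rightarrow> real^'n^'n"
  assumes "\<And>i j. continuous_on T (\<lambda>t. B t $ i $ j)"
  shows "continuous_on T (\<lambda>t. det (B t))"
  unfolding det_def by (intro continuous_intros assms)

context
  fixes \<alpha> \<beta> \<gamma> :: real
  assumes pos: "\<alpha> > 0" "\<beta> > 0" "\<gamma> > 0"
begin

context
  fixes a b :: real and c X
  assumes ab: "a < b" and cG: "c ` {a..b} \<subseteq> G_grp"
    and c': "\<And>t. t \<in> {a..b} \<Longrightarrow> (c has_vector_derivative c t \<bullet>\<^sub>G X t) (at t within {a..b})"
    and XG: "\<And>t. t \<in> {a..b} \<Longrightarrow> X t \<in> G_alg"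
begin

lemma velocity_eq:
  assumes t: "t \<in> {a..b}" shows "velocity a b c t = m_vec (m_coord (X t))"
proof -
  have "c t \<in> G_grp" using cG t by auto
  then show ?thesis
    unfolding velocity_def vector_derivative_within_closed_interval [OF ab t c' [OF t]]
    by (simp add: mp_inv_G G_transp_cancel m_part_eq [OF XG [OF t]])
qed

lemma field_comb_deriv:
  fixes n :: nat
  assumes t: "t \<in> {a..b}" and E: "\<And>j. j < n \<Longrightarrow> E j \<in> V_fields"
    and \<phi>: "\<And>j. j < n \<Longrightarrow> (\<phi> j has_real_derivative \<phi>' j) (at t within {a..b})"
  shows "((\<lambda>s. \<Sum>j<n. \<phi> j s *\<^sub>R E j (c s)) has_vector_derivative
     (\<Sum>j<n. \<phi>' j *\<^sub>R E j (c t) + \<phi> j t *\<^sub>R levi_civita \<alpha> \<beta> \<gamma> (c t) (velocity a b c t) (E j))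
     - m_vec (transp (\<alpha> / (5 * \<beta>)) (\<alpha> / (10 * \<gamma>)) (X t) (m_coord (\<Sum>j<n. \<phi> j t *\<^sub>R E j (c t))))) (at t within {a..b})"
proof -
  have g: "c t \<in> G_grp" using cG t by auto
  let ?T = "transp (\<alpha> / (5 * \<beta>)) (\<alpha> / (10 * \<gamma>)) (X t)"
  let ?D = "\<lambda>j. levi_civita \<alpha> \<beta> \<gamma> (c t) (velocity a b c t) (E j)"
  have deriv: "dir_deriv (E j) (c t) (X t) = ?D j - m_vec (?T (m_coord (E j (c t))))" if "j < n" for j
  proof -
    note Ej = E [OF that]
    note lin = dir_deriv_linear [OF smooth_G_differentiable [OF V_fields_smooth [OF Ej] g]]
    have "dir_deriv (E j) (c t) (X t) = dir_deriv (E j) (c t) (m_vec (m_coord (X t))) - h_coord (X t) *\<^sub>R m_vec (ad_h (m_coord (E j (c t))))"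
      by (subst reductive_decomp [OF XG [OF t]])
        (simp add: linear_add [OF lin] linear_scale [OF lin] V_fields_dir_e_tilde0 [OF Ej g])
    then show ?thesis
      unfolding velocity_eq [OF t] levi_civita_eq [OF pos g m_vec_m_sp Ej] invariant_conn_def transp_def
      by (simp add: linear_add [OF linear_m_vec] linear_scale [OF linear_m_vec])
  qed
  have "((\<lambda>s. \<Sum>j<n. \<phi> j s *\<^sub>R E j (c s)) has_vector_derivative
     (\<Sum>j<n. \<phi> j t *\<^sub>R dir_deriv (E j) (c t) (X t) + \<phi>' j *\<^sub>R E j (c t))) (at t within {a..b})"
    by (intro has_vector_derivative_sum has_vector_derivative_scaleR \<phi>
        dir_deriv_curve [OF smooth_G_differentiable [OF V_fields_smooth [OF E] g] cG c' [OF t]]) auto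
  also have "(\<Sum>j<n. \<phi> j t *\<^sub>R dir_deriv (E j) (c t) (X t) + \<phi>' j *\<^sub>R E j (c t)) =
     (\<Sum>j<n. \<phi>' j *\<^sub>R E j (c t) + \<phi> j t *\<^sub>R ?D j) - (\<Sum>j<n. \<phi> j t *\<^sub>R m_vec (?T (m_coord (E j (c t)))))"
    unfolding sum_subtractf [symmetric] by (intro sum.cong) (auto simp: deriv scaleR_diff_right)
  also have "(\<Sum>j<n. \<phi> j t *\<^sub>R m_vec (?T (m_coord (E j (c t))))) = m_vec (?T (m_coord (\<Sum>j<n. \<phi> j t *\<^sub>R E j (c t))))"
    by (simp add: linear_sum [OF linear_m_vec] linear_scale [OF linear_m_vec] linear_sum [OF linear_transp]
        linear_scale [OF linear_transp] linear_sum [OF linear_m_coord] linear_scale [OF linear_m_coord])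
  finally show ?thesis .
qed

lemma parallel_on_deriv:
  assumes "parallel_on (levi_civita \<alpha> \<beta> \<gamma>) a b c v" and t: "t \<in> {a..b}"
  shows "v t \<in> m_sp"
    and "(v has_vector_derivative - m_vec (transp (\<alpha> / (5 * \<beta>)) (\<alpha> / (10 * \<gamma>)) (X t) (m_coord (v t)))) (at t within {a..b})"
proof -
  obtain n :: nat and E \<phi> \<phi>' where E: "\<And>j. j < n \<Longrightarrow> E j \<in> V_fields"
    and \<phi>: "\<And>j t. j < n \<Longrightarrow> t \<in> {a..b} \<Longrightarrow> (\<phi> j has_real_derivative \<phi>' j t) (at t within {a..b})"
    and v: "\<And>t. t \<in> {a..b} \<Longrightarrow> v t = (\<Sum>j<n. \<phi> j t *\<^sub>R E j (c t))"
    and par: "\<And>t. t \<in> {a..b} \<Longrightarrow>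
      (\<Sum>j<n. \<phi>' j t *\<^sub>R E j (c t) + \<phi> j t *\<^sub>R levi_civita \<alpha> \<beta> \<gamma> (c t) (velocity a b c t) (E j)) = 0"
    using assms(1) unfolding parallel_on_def by blast
  have "c t \<in> G_grp" using cG t by auto
  then show "v t \<in> m_sp"
    unfolding v [OF t]
    by (intro subspace_sum [OF subspace_m_sp] subspace_scale [OF subspace_m_sp] V_fields_m_sp [OF E]) auto
  show "(v has_vector_derivative - m_vec (transp (\<alpha> / (5 * \<beta>)) (\<alpha> / (10 * \<gamma>)) (X t) (m_coord (v t)))) (at t within {a..b})"
    using has_vector_derivative_transform [OF t v field_comb_deriv [OF t E \<phi> [OF _ t]]]
    unfolding par [OF t] v [OF t] by simp
qed

lemma parallel_onI:
  assumes v: "\<And>t. t \<in> {a..b} \<Longrightarrow> v t \<in> m_sp"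
    and v': "\<And>t. t \<in> {a..b} \<Longrightarrow>
      (v has_vector_derivative - m_vec (transp (\<alpha> / (5 * \<beta>)) (\<alpha> / (10 * \<gamma>)) (X t) (m_coord (v t)))) (at t within {a..b})"
  shows "parallel_on (levi_civita \<alpha> \<beta> \<gamma>) a b c v"
proof -
  define n where "n = card (Basis :: mpair set)"
  obtain e where e: "bij_betw e {0..<n} (Basis :: mpair set)"
    unfolding n_def using ex_bij_betw_nat_finite [OF finite_Basis] by blast
  define E where "E j = killing (skew_proj (e j))" for j
  define \<phi> where "\<phi> j t = (c t \<bullet>\<^sub>G v t \<bullet>\<^sub>G mp_transp (c t)) \<bullet> e j" for j t
  have E: "E j \<in> V_fields" for j unfolding E_def by (rule killing_V_fields) simp
  \<comment> \<open>Only existence matters here: the vanishing of the covariant derivative comes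
    later from comparing two derivatives of \<open>v\<close>.\<close>
  have ex: "\<exists>d. (\<phi> j has_real_derivative d) (at t within {a..b})" if t: "t \<in> {a..b}" for j t
    unfolding \<phi>_def has_vector_derivative_real_iff [symmetric]
    using bounded_linear.has_vector_derivative [OF bounded_linear_inner_left
        mp.has_vector_derivative [OF mp.has_vector_derivative [OF c' [OF t] v' [OF t]]
          bounded_linear.has_vector_derivative [OF bounded_linear_mp_transp c' [OF t]]]] by blast
  define \<phi>' where "\<phi>' j t = (SOME d. (\<phi> j has_real_derivative d) (at t within {a..b}))" for j t
  have \<phi>: "(\<phi> j has_real_derivative \<phi>' j t) (at t within {a..b})" if "t \<in> {a..b}" for j t
    unfolding \<phi>'_def by (rule someI_ex [OF ex [OF that]])
  \<comment> \<open>\<open>v t\<close> is the value at \<open>c t\<close> of the fundamental field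
    of \<open>Ad (c t) (v t)\<close>. Expanding that matrix pair in the standard basis gives fixed
    fields with differentiable coefficients.\<close>
  have comb: "v t = (\<Sum>j<n. \<phi> j t *\<^sub>R E j (c t))" if t: "t \<in> {a..b}" for t
  proof -
    have g: "c t \<in> G_grp" using cG t by auto
    let ?A = "c t \<bullet>\<^sub>G v t \<bullet>\<^sub>G mp_transp (c t)"
    have A: "?A = Ad (c t) (v t)" by (simp add: Ad_def mp_inv_G g)
    have lin: "linear (\<lambda>A. killing (skew_proj A) (c t))"
      by (intro linearI) (simp_all add: killing_def linear_add [OF bounded_linear.linear [OF bounded_linear_skew_proj]]
          linear_scale [OF bounded_linear.linear [OF bounded_linear_skew_proj]] mp.add_left mp.add_right mp.scaleR_left mp.scaleR_right
          linear_add [OF linear_m_coord] linear_scale [OF linear_m_coord] linear_add [OF linear_m_vec] linear_scale [OF linear_m_vec])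
    have "v t = killing (skew_proj ?A) (c t)"
      unfolding A skew_proj_ident [OF Ad_G_alg [OF g m_sp_G_alg [OF v [OF t]]]] by (rule killing_extends [OF g v [OF t], symmetric])
    also have "\<dots> = killing (skew_proj (\<Sum>b\<in>Basis. (?A \<bullet> b) *\<^sub>R b)) (c t)"
      by (simp only: euclidean_representation)
    also have "\<dots> = (\<Sum>b\<in>Basis. (?A \<bullet> b) *\<^sub>R killing (skew_proj b) (c t))"
      by (simp only: linear_sum [OF lin] linear_scale [OF lin])
    also have "\<dots> = (\<Sum>j<n. \<phi> j t *\<^sub>R E j (c t))"
      unfolding \<phi>_def E_def lessThan_atLeast0 by (rule sum.reindex_bij_betw [OF e, symmetric])
    finally show ?thesis .
  qed
  have "(\<Sum>j<n. \<phi>' j t *\<^sub>R E j (c t) + \<phi> j t *\<^sub>R levi_civita \<alpha> \<beta> \<gamma> (c t) (velocity a b c t) (E j)) = 0" if t: "t \<in> {a..b}" for t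
  proof -
    have "- m_vec (transp (\<alpha> / (5 * \<beta>)) (\<alpha> / (10 * \<gamma>)) (X t) (m_coord (v t))) =
      (\<Sum>j<n. \<phi>' j t *\<^sub>R E j (c t) + \<phi> j t *\<^sub>R levi_civita \<alpha> \<beta> \<gamma> (c t) (velocity a b c t) (E j))
      - m_vec (transp (\<alpha> / (5 * \<beta>)) (\<alpha> / (10 * \<gamma>)) (X t) (m_coord (v t)))"
    proof (rule vector_derivative_unique_within_closed_interval [OF ab])
      show "t \<in> cbox a b" using t by simp
      show "(v has_vector_derivative - m_vec (transp (\<alpha> / (5 * \<beta>)) (\<alpha> / (10 * \<gamma>)) (X t) (m_coord (v t)))) (at t within cbox a b)"
        using v' [OF t] by simp
      show "(v has_vector_derivative (\<Sum>j<n. \<phi>' j t *\<^sub>R E j (c t) + \<phi> j t *\<^sub>R levi_civita \<alpha> \<beta> \<gamma> (c t) (velocity a b c t) (E j))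
          - m_vec (transp (\<alpha> / (5 * \<beta>)) (\<alpha> / (10 * \<gamma>)) (X t) (m_coord (v t)))) (at t within cbox a b)"
        using has_vector_derivative_transform [OF t comb field_comb_deriv [OF t E \<phi> [OF t]]]
        by (simp only: comb [OF t, symmetric] box_real)
    qed
    then show ?thesis by simp
  qed
  then show ?thesis
    unfolding parallel_on_def using E \<phi> comb by blast
qed

end

subsection \<open>The holonomy group consists of rotations\<close>

text \<open>At break points only one-sided derivatives exist. The partition may vary with the field
  \<open>v\<close>, so just a finite exceptional set and continuity are retained.\<close>

lemma parallel_along_deriv:
  assumes c: "c ` {0..1} \<subseteq> G_grp" and par: "parallel_along (levi_civita \<alpha> \<beta> \<gamma>) c v"
  obtains K where "finite K" "\<And>t. t \<in> {0..1} \<Longrightarrow> v t \<in> m_sp" "continuous_on {0..1} v"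
    "\<And>t. t \<in> {0..1} - K \<Longrightarrow> (v has_vector_derivative
       - m_vec (transp (\<alpha> / (5 * \<beta>)) (\<alpha> / (10 * \<gamma>)) (mp_transp (c t) \<bullet>\<^sub>G vector_derivative c (at t)) (m_coord (v t)))) (at t)"
proof -
  obtain n p where p: "partition01 n p" and C: "\<And>k. k < n \<Longrightarrow> C1_on (p k) (p (Suc k)) c"
    and P: "\<And>k. k < n \<Longrightarrow> parallel_on (levi_civita \<alpha> \<beta> \<gamma>) (p k) (p (Suc k)) c v"
    using par unfolding parallel_along_def by blast
  have piece: "v t \<in> m_sp \<and> (\<exists>d. (c has_vector_derivative d) (at t within {p k..p (Suc k)}) \<and>
      (v has_vector_derivative - m_vec (transp (\<alpha> / (5 * \<beta>)) (\<alpha> / (10 * \<gamma>)) (mp_transp (c t) \<bullet>\<^sub>G d) (m_coord (v t))))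
        (at t within {p k..p (Suc k)}))" if k: "k < n" and t: "t \<in> {p k..p (Suc k)}" for k t
  proof -
    obtain c' where c': "\<And>t. t \<in> {p k..p (Suc k)} \<Longrightarrow> (c has_vector_derivative c' t) (at t within {p k..p (Suc k)})"
      using C [OF k] unfolding C1_on_def by blast
    have G: "c ` {p k..p (Suc k)} \<subseteq> G_grp"
      using c partition_subset [OF p k] by blast
    define X where "X t = mp_transp (c t) \<bullet>\<^sub>G c' t" for t
    have X: "X t \<in> G_alg" if "t \<in> {p k..p (Suc k)}" for t
      unfolding X_def by (rule G_curve_velocity [OF partition_less [OF p k] that G c' [OF that]])
    have "(c has_vector_derivative c t \<bullet>\<^sub>G X t) (at t within {p k..p (Suc k)})" if "t \<in> {p k..p (Suc k)}" for t
      using c' [OF that] G that by (simp add: X_def G_transp_cancel image_subset_iff)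
    from parallel_on_deriv [OF partition_less [OF p k] G this X P [OF k] t] c' [OF t]
    show ?thesis unfolding X_def by blast
  qed
  show ?thesis
  proof (rule that [of "p ` {..n}"])
    show "v t \<in> m_sp" if "t \<in> {0..1}" for t
      using partition_cover [OF p that] piece by blast
    have "continuous_on {p k..p (Suc k)} v" if "k < n" for k
      unfolding continuous_on_eq_continuous_within using piece [OF that] has_vector_derivative_continuous by blast
    then have "continuous_on (\<Union>k\<in>{..<n}. {p k..p (Suc k)}) v"
      by (intro continuous_on_closed_Union) auto
    moreover have "{0..1} \<subseteq> (\<Union>k\<in>{..<n}. {p k..p (Suc k)})"
      using partition_cover [OF p] by blast
    ultimately show "continuous_on {0..1} v" by (rule continuous_on_subset)
    fix t :: real assume t: "t \<in> {0..1} - p ` {..n}"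
    then obtain k where k: "k < n" "t \<in> {p k..p (Suc k)}" using partition_cover [OF p] by blast
    moreover have "t \<noteq> p k" "t \<noteq> p (Suc k)" using t k(1) by auto
    ultimately have "t \<in> {p k<..<p (Suc k)}" by auto
    then have at: "at t within {p k..p (Suc k)} = at t"
      by (intro at_within_interior) auto
    show "(v has_vector_derivative
       - m_vec (transp (\<alpha> / (5 * \<beta>)) (\<alpha> / (10 * \<gamma>)) (mp_transp (c t) \<bullet>\<^sub>G vector_derivative c (at t)) (m_coord (v t)))) (at t)"
      using piece [OF k] unfolding at by (metis vector_derivative_at)
  qed simp
qed

text \<open>Passage from coordinates in \<open>e_tilde\<close> to coordinates in
  \<open>e_orth\<close>, which turns the metric into the Euclidean inner product.\<close>

definition diag_sqrt :: "real^5 \<Rightarrow> real^5"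
  where "diag_sqrt y = (\<chi> i. sqrt (metric_diag \<alpha> \<beta> \<gamma> i) * y $ i)"

lemma diag_sqrt_nth: "diag_sqrt y $ i = sqrt (metric_diag \<alpha> \<beta> \<gamma> i) * y $ i"
  by (simp add: diag_sqrt_def)

lemma metric_e_orth: "metric \<alpha> \<beta> \<gamma> (m_vec y) (e_orth \<alpha> \<beta> \<gamma> i) = diag_sqrt y $ i"
proof -
  define d where "d = metric_diag \<alpha> \<beta> \<gamma> i"
  have "d > 0" unfolding d_def by (rule metric_diag_pos [OF pos])
  then have "d / sqrt d = sqrt d" by (intro real_div_sqrt less_imp_le)
  moreover have "(1 / sqrt d) * (d * y $ i) = d / sqrt d * y $ i" by simp
  ultimately have "(1 / sqrt d) * (d * y $ i) = sqrt d * y $ i" by (simp only:)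
  then show ?thesis
    unfolding e_orth_eq [OF pos] metric_m_vec inner5_simps inner5_axis [OF pos] diag_sqrt_nth d_def .
qed

lemma diag_sqrt_h_rot: "diag_sqrt (h_rot t y) = (plane_rot 2 3 t ** plane_rot 4 5 (2 * t)) *v diag_sqrt y"
  by (simp add: vec5_eq_iff matrix_vector_mul_assoc [symmetric] plane_rot_vec diag_sqrt_nth h_rot_def metric_diag_def algebra_simps)

lemma diag_sqrt_inner: "diag_sqrt x \<bullet> diag_sqrt y = inner5 \<alpha> \<beta> \<gamma> x y"
proof -
  have s: "sqrt r * u * (sqrt r * w) = r * (u * w)" if "r > 0" for r u w :: real
    using that by (simp add: mult.commute mult.left_commute)
  show ?thesis
    by (simp add: inner_vec_def sum_5 diag_sqrt_nth s metric_diag_pos [OF pos] inner5_def metric_diag_def pos less_imp_le algebra_simps)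
qed

lemma m_coord_e_orth: "diag_sqrt (m_coord (e_orth \<alpha> \<beta> \<gamma> j)) = axis j 1"
  using metric_diag_pos [OF pos, of j]
  by (simp add: e_orth_eq [OF pos] vec_eq_iff diag_sqrt_nth axis_def)

lemma holonomy_rotation:
  assumes "A \<in> holonomy \<alpha> \<beta> \<gamma>"
  shows "rotation_matrix A"
proof -
  obtain c where c: "c \<in> lifted_loops"
    and ex: "\<forall>j. \<exists>v. parallel_along (levi_civita \<alpha> \<beta> \<gamma>) c v \<and> v 0 = e_orth \<alpha> \<beta> \<gamma> j \<and>
       (\<forall>i. A $ i $ j = metric \<alpha> \<beta> \<gamma> (Ad (c 1) (v 1)) (e_orth \<alpha> \<beta> \<gamma> i))"
    using assms unfolding holonomy_def by blast
  from choice [OF ex] obtain v where v_all: "\<forall>j. parallel_along (levi_civita \<alpha> \<beta> \<gamma>) c (v j) \<and> v j 0 = e_orth \<alpha> \<beta> \<gamma> j \<and>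
       (\<forall>i. A $ i $ j = metric \<alpha> \<beta> \<gamma> (Ad (c 1) (v j 1)) (e_orth \<alpha> \<beta> \<gamma> i))" ..
  then have v: "\<And>j. parallel_along (levi_civita \<alpha> \<beta> \<gamma>) c (v j)" "\<And>j. v j 0 = e_orth \<alpha> \<beta> \<gamma> j"
    and A: "\<And>i j. A $ i $ j = metric \<alpha> \<beta> \<gamma> (Ad (c 1) (v j 1)) (e_orth \<alpha> \<beta> \<gamma> i)"
    by blast+
  have cG: "c ` {0..1} \<subseteq> G_grp" using c by (simp add: lifted_loops_def)
  obtain \<tau> where \<tau>: "c 1 = h_elem \<tau>" using c by (auto simp: lifted_loops_def H_grp_eq)
  let ?X = "\<lambda>t. mp_transp (c t) \<bullet>\<^sub>G vector_derivative c (at t)"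
  let ?T = "\<lambda>t. transp (\<alpha> / (5 * \<beta>)) (\<alpha> / (10 * \<gamma>)) (?X t)"
  define y where "y j t = m_coord (v j t)" for j t
  have "\<forall>j. \<exists>K. finite K \<and> (\<forall>t\<in>{0..1}. v j t \<in> m_sp) \<and> continuous_on {0..1} (v j) \<and>
    (\<forall>t\<in>{0..1} - K. (v j has_vector_derivative - m_vec (?T t (y j t))) (at t))"
  proof
    fix j
    show "\<exists>K. finite K \<and> (\<forall>t\<in>{0..1}. v j t \<in> m_sp) \<and> continuous_on {0..1} (v j) \<and>
      (\<forall>t\<in>{0..1} - K. (v j has_vector_derivative - m_vec (?T t (y j t))) (at t))"
      by (rule parallel_along_deriv [OF cG v(1) [of j]]) (unfold y_def, blast)
  qed
  from choice [OF this] obtain K where K_all: "\<forall>j. finite (K j) \<and> (\<forall>t\<in>{0..1}. v j t \<in> m_sp) \<and> continuous_on {0..1} (v j) \<and>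
    (\<forall>t\<in>{0..1} - K j. (v j has_vector_derivative - m_vec (?T t (y j t))) (at t))" ..
  then have K: "\<And>j. finite (K j)" and m: "\<And>j t. t \<in> {0..1} \<Longrightarrow> v j t \<in> m_sp"
    and cont: "\<And>j. continuous_on {0..1} (v j)"
    and d: "\<And>j t. t \<in> {0..1} - K j \<Longrightarrow> (v j has_vector_derivative - m_vec (?T t (y j t))) (at t)"
    by blast+
  have y_cont: "continuous_on {0..1} (y j)" for j
    unfolding y_def by (rule bounded_linear.continuous_on [OF bounded_linear_m_coord cont])
  have y_d: "(y j has_vector_derivative - ?T t (y j t)) (at t)" if "t \<in> {0..1} - K j" for j t
    using bounded_linear.has_vector_derivative [OF bounded_linear_m_coord d [OF that]] unfolding y_def
    by (simp add: linear_neg [OF linear_m_coord])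
  define B where "B t = (\<chi> i j. diag_sqrt (y j t) $ i)" for t
  have BB: "(transpose (B t) ** B t) $ i $ j = inner5 \<alpha> \<beta> \<gamma> (y i t) (y j t)" for t i j
    unfolding diag_sqrt_inner [symmetric] by (simp add: B_def matrix_matrix_mult_def transpose_def inner_vec_def)
  have B0: "B 0 = mat 1"
    by (simp add: B_def vec_eq_iff y_def v(2) m_coord_e_orth mat_def axis_def)
  \<comment> \<open>The derivative vanishes off a finite set by skew-symmetry of the transport
    equation, and continuity bridges the exceptional points.\<close>
  have const: "inner5 \<alpha> \<beta> \<gamma> (y i t) (y j t) = inner5 \<alpha> \<beta> \<gamma> (y i 0) (y j 0)" if "t \<in> {0..1}" for i j t
  proof (rule has_derivative_zero_unique_strong_interval [of "K i \<union> K j" 0 1 _ _ t])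
    show "continuous_on {0..1} (\<lambda>t. inner5 \<alpha> \<beta> \<gamma> (y i t) (y j t))"
      by (rule bounded_bilinear.continuous_on [OF bounded_bilinear_inner5 y_cont y_cont])
    fix t assume t: "t \<in> {0..1} - (K i \<union> K j)"
    have "((\<lambda>t. inner5 \<alpha> \<beta> \<gamma> (y i t) (y j t)) has_vector_derivative
        inner5 \<alpha> \<beta> \<gamma> (y i t) (- ?T t (y j t)) + inner5 \<alpha> \<beta> \<gamma> (- ?T t (y i t)) (y j t)) (at t)"
      by (rule bounded_bilinear.has_vector_derivative [OF bounded_bilinear_inner5 y_d y_d]) (use t in auto)
    also have "inner5 \<alpha> \<beta> \<gamma> (y i t) (- ?T t (y j t)) + inner5 \<alpha> \<beta> \<gamma> (- ?T t (y i t)) (y j t) = 0"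
      using transp_skew [OF pos(2,3), of \<alpha> "?X t" "y i t" "y j t"]
      by (simp add: bounded_bilinear.minus_left [OF bounded_bilinear_inner5] bounded_bilinear.minus_right [OF bounded_bilinear_inner5])
    finally show "((\<lambda>t. inner5 \<alpha> \<beta> \<gamma> (y i t) (y j t)) has_derivative (\<lambda>h. 0)) (at t within {0..1})"
      unfolding has_vector_derivative_def by (simp add: has_derivative_at_withinI)
  next
    show "finite (K i \<union> K j)" using K by simp
  qed (rule refl, rule that)
  have orth: "orthogonal_matrix (B t)" if "t \<in> {0..1}" for t
  proof -
    have "transpose (B t) ** B t = transpose (B 0) ** B 0"
      by (simp add: vec_eq_iff BB const [OF that])
    then show ?thesis by (simp add: B0 orthogonal_matrix)
  qed
  have det_cont: "continuous_on {0..1} (\<lambda>t. det (B t))"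
    unfolding B_def
    by (intro continuous_on_det) (simp add: diag_sqrt_nth, intro continuous_intros y_cont)
  have det: "det (B t) = 1 \<or> det (B t) = - 1" if "t \<in> {0..1}" for t
    using det_orthogonal_matrix [OF orth [OF that]] .
  \<comment> \<open>The determinant is continuous in time, takes only the values 1 and -1 and starts
    at 1, so the intermediate value theorem excludes a change of sign.\<close>
  have "det (B 1) = 1"
  proof (rule ccontr)
    assume "det (B 1) \<noteq> 1"
    then have "det (B 1) = - 1" using det [of 1] by simp
    then obtain x where "0 \<le> x" "x \<le> 1" "det (B x) = 0"
      using IVT2' [of "\<lambda>t. det (B t)" 1 0 0] det_cont by (auto simp: B0)
    then show False using det [of x] by simp
  qed
  then have rotB: "rotation_matrix (B 1)"
    using orth by (simp add: rotation_matrix_def)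
  \<comment> \<open>The transported frame sits over \<open>c 1\<close>; moving it back over the
    identity by \<open>Ad (c 1)\<close> contributes an isotropy rotation.\<close>
  have "A $ i $ j = ((plane_rot 2 3 \<tau> ** plane_rot 4 5 (2 * \<tau>)) ** B 1) $ i $ j" for i j
  proof -
    have "A $ i $ j = diag_sqrt (h_rot \<tau> (y j 1)) $ i"
      unfolding A \<tau> y_def metric_e_orth [symmetric] Ad_h_elem [symmetric] by (simp add: m_vec_coord m)
    also have "\<dots> = ((plane_rot 2 3 \<tau> ** plane_rot 4 5 (2 * \<tau>)) ** B 1) $ i $ j"
      unfolding diag_sqrt_h_rot by (simp add: B_def matrix_matrix_mult_def matrix_vector_mult_def)
    finally show ?thesis .
  qed
  then have "A = (plane_rot 2 3 \<tau> ** plane_rot 4 5 (2 * \<tau>)) ** B 1"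
    by (simp add: vec_eq_iff)
  then show ?thesis
    by (simp add: rotation_matrix_mult rotation_plane_rot rotB)
qed

end

subsection \<open>The holonomy group contains all rotations\<close>

text \<open>The glued function follows the first segment whose right end is not yet passed. This can
  differ from segment \<open>i\<close> only at its left end, where the matching condition
  applies.\<close>

lemma glue_segments:
  fixes seg :: "nat \<Rightarrow> real \<Rightarrow> 'a"
  assumes n: "n > 0" and seg: "\<And>i. Suc i < n \<Longrightarrow> seg i (real (Suc i) / n) = seg (Suc i) (real (Suc i) / n)"
  obtains f where "\<And>i t. i < n \<Longrightarrow> t \<in> {real i / n..real (Suc i) / n} \<Longrightarrow> f t = seg i t"
proof
  fix i t assume i: "i < n" and t: "t \<in> {real i / n..real (Suc i) / n}"
  define L where "L = (LEAST i. t \<le> real (Suc i) / n)"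
  have L: "t \<le> real (Suc L) / n" "L \<le> i"
    unfolding L_def
    by (rule LeastI [of "\<lambda>i. t \<le> real (Suc i) / n" i] Least_le [of "\<lambda>i. t \<le> real (Suc i) / n" i]; use t in simp)+
  show "seg (LEAST i. t \<le> real (Suc i) / n) t = seg i t"
  proof (cases "L = i")
    case False
    then have "Suc L \<le> i" using L(2) by simp
    moreover from this have "real (Suc L) / n \<le> real i / n" by (simp add: divide_right_mono)
    moreover have "real i / n \<le> t" using t by simp
    ultimately have eq: "t = real (Suc L) / n" "real (Suc L) / n = real i / n" using L(1) by linarith+
    from this(2) n have L': "i = Suc L" by simp
    have "seg L t = seg (Suc L) t"
      unfolding eq(1) by (rule seg) (use i L' in simp)
    then show ?thesis by (simp only: L_def [symmetric] L')
  qed (simp only: L_def [symmetric])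
qed

text \<open>By the formula for \<open>nomizu\<close>, the direction \<open>k\<close> couples the
  first coordinate only with that of the other generator in the same factor of
  \<open>G\<close>.\<close>

definition partner :: "5 \<Rightarrow> 5"
  where "partner k = (if k = 2 then 3 else if k = 3 then 2 else if k = 4 then 5 else 4)"

lemma partner_neq_1: "1 \<noteq> partner k"
  by (simp add: partner_def)

lemma mp_rot_gen_e_tilde: "k \<noteq> 1 \<Longrightarrow> mp_rot_gen (e_tilde k)"
  by (simp add: e_tilde_def)

lemma mp_rodr_affine_deriv:
  assumes "mp_rot_gen X"
  shows "((\<lambda>t. mp_rodr X ((r * t - i) * s)) has_vector_derivative (r * s) *\<^sub>R (mp_rodr X ((r * t - i) * s) \<bullet>\<^sub>G X)) (at t within T)"
proof -
  have "((\<lambda>t. (r * t - i) * s) has_real_derivative r * s) (at t within T)"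
    by (auto intro!: derivative_eq_intros)
  then show ?thesis
    using vector_diff_chain_within [OF _ mp_rodr_deriv [OF assms], of "\<lambda>t. (r * t - i) * s" "r * s" t T]
    by (simp add: o_def has_vector_derivative_real_iff)
qed

lemma plane_rot_affine_deriv:
  assumes "i \<noteq> j"
  shows "((\<lambda>t. plane_rot i j (l * ((r * t - m) * s))) has_vector_derivative
    (l * (r * s)) *\<^sub>R (plane_gen i j ** plane_rot i j (l * ((r * t - m) * s)))) (at t within T)"
proof -
  have "((\<lambda>t. l * ((r * t - m) * s)) has_real_derivative l * (r * s)) (at t within T)"
    by (auto intro!: derivative_eq_intros)
  then show ?thesis
    using vector_diff_chain_within [OF _ rodr_has_vector_derivative [OF rot_gen_plane_gen [OF assms]],
        of "\<lambda>t. l * ((r * t - m) * s)" "l * (r * s)" t T]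
    by (simp add: o_def has_vector_derivative_real_iff plane_rot_def rodr_commute_gen rot_gen_plane_gen assms)
qed

section \<open>Transport along words in the flows of the basis vectors\<close>

context
  fixes \<alpha> \<beta> \<gamma> :: real
  assumes pos: "\<alpha> > 0" "\<beta> > 0" "\<gamma> > 0"
begin

text \<open>The Nomizu coefficients after rescaling to the orthonormal basis; for instance
  \<open>\<alpha> / (5 * \<beta>)\<close> is multiplied by
  \<open>sqrt \<beta> / sqrt \<alpha>\<close>.\<close>

definition speed :: "5 \<Rightarrow> real"
  where "speed k = (if k = 2 then sqrt \<alpha> / (5 * sqrt \<beta>) else if k = 3 then - (sqrt \<alpha> / (5 * sqrt \<beta>))
    else if k = 4 then - (sqrt \<alpha> / (10 * sqrt \<gamma>)) else sqrt \<alpha> / (10 * sqrt \<gamma>))"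

lemma speed_nonzero: "speed k \<noteq> 0"
  using pos by (simp add: speed_def)

abbreviation "dsqrt \<equiv> diag_sqrt \<alpha> \<beta> \<gamma>"

lemma diag_sqrt_nomizu:
  assumes k: "k \<noteq> 1"
  shows "dsqrt (nomizu (\<alpha> / (5 * \<beta>)) (\<alpha> / (10 * \<gamma>)) (axis k 1) y) = speed k *\<^sub>R (plane_gen 1 (partner k) *v dsqrt y)"
proof -
  define a b c where "a = sqrt \<alpha>" and "b = sqrt \<beta>" and "c = sqrt \<gamma>"
  have pq: "\<alpha> / (5 * \<beta>) = a * a / (5 * (b * b))" "\<alpha> / (10 * \<gamma>) = a * a / (10 * (c * c))" and abc: "a > 0" "b > 0" "c > 0"
    using pos by (simp_all add: a_def b_def c_def)
  have nth: "dsqrt y $ i = (if i = 1 then a else if i = 2 \<or> i = 3 then b else c) * y $ i" for y i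
    by (simp add: diag_sqrt_nth [OF pos] metric_diag_def a_def b_def c_def)
  have sp: "speed k = (if k = 2 then a / (5 * b) else if k = 3 then - (a / (5 * b)) else if k = 4 then - (a / (10 * c)) else a / (10 * c))"
    by (simp add: speed_def a_def b_def c_def)
  show ?thesis
    unfolding vec5_eq_iff vector_scaleR_component plane_gen_vec [OF partner_neq_1] nth sp pq
    using abc k by (cases k rule: exhaust_5) (simp_all add: partner_def nomizu_def axis_def field_simps)
qed

definition diag_isqrt :: "real^5 \<Rightarrow> real^5"
  where "diag_isqrt y = (\<chi> i. (1 / sqrt (metric_diag \<alpha> \<beta> \<gamma> i)) * y $ i)"

lemma diag_sqrt_isqrt: "dsqrt (diag_isqrt y) = y" "diag_isqrt (dsqrt y) = y"
proof -
  have "sqrt (metric_diag \<alpha> \<beta> \<gamma> i) \<noteq> 0" for i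
    using metric_diag_pos [OF pos, of i] by simp
  then show "dsqrt (diag_isqrt y) = y" "diag_isqrt (dsqrt y) = y"
    by (simp_all add: vec_eq_iff diag_sqrt_nth [OF pos] diag_isqrt_def)
qed

lemma linear_diag_sqrt: "linear dsqrt"
  by (intro linearI) (simp_all add: vec_eq_iff diag_sqrt_nth [OF pos] algebra_simps)

lemma linear_diag_isqrt: "linear diag_isqrt"
  by (intro linearI) (simp_all add: vec_eq_iff diag_isqrt_def algebra_simps add_divide_distrib)

text \<open>A letter \<open>(k, s)\<close> stands for following the flow of \<open>e_tilde k\<close> during time \<open>s\<close>.\<close>

definition word_pos :: "(5 \<times> real) list \<Rightarrow> mpair"
  where "word_pos w = foldl (\<lambda>g (k, s). g \<bullet>\<^sub>G mp_rodr (e_tilde k) s) 1\<^sub>G w"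

text \<open>Positions are extended on the right, as the flows are left-invariant, but transport
  along a later letter acts on the left. The minus sign is that of the transport equation.\<close>

definition word_frame :: "(5 \<times> real) list \<Rightarrow> real^5^5"
  where "word_frame w = foldl (\<lambda>Q (k, s). plane_rot 1 (partner k) (- speed k * s) ** Q) (mat 1) w"

definition word_ok :: "(5 \<times> real) list \<Rightarrow> bool"
  where "word_ok w \<longleftrightarrow> (\<forall>x\<in>set w. fst x \<noteq> 1)"

lemma word_snoc:
  "word_pos (w @ [(k, s)]) = word_pos w \<bullet>\<^sub>G mp_rodr (e_tilde k) s"
  "word_frame (w @ [(k, s)]) = plane_rot 1 (partner k) (- speed k * s) ** word_frame w"
  "word_ok (w @ [(k, s)]) \<longleftrightarrow> word_ok w \<and> k \<noteq> 1"
  by (auto simp: word_pos_def word_frame_def word_ok_def)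

lemma word_Nil [simp]: "word_pos [] = 1\<^sub>G" "word_frame [] = mat 1" "word_ok []"
  by (simp_all add: word_pos_def word_frame_def word_ok_def)

lemma word_append:
  "word_pos (u @ w) = word_pos u \<bullet>\<^sub>G word_pos w"
  "word_frame (u @ w) = word_frame w ** word_frame u"
proof -
  have "word_pos (u @ w) = word_pos u \<bullet>\<^sub>G word_pos w \<and> word_frame (u @ w) = word_frame w ** word_frame u"
  proof (induction w rule: rev_induct)
    case (snoc x w)
    obtain k s where x: "x = (k, s)" by (cases x)
    show ?case
      unfolding append_assoc [symmetric] x word_snoc using snoc by (simp add: mp_assoc matrix_mul_assoc)
  qed simp
  then show "word_pos (u @ w) = word_pos u \<bullet>\<^sub>G word_pos w" "word_frame (u @ w) = word_frame w ** word_frame u"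
    by auto
qed

lemma word_G: "word_ok w \<Longrightarrow> word_pos w \<in> G_grp"
proof (induction w rule: rev_induct)
  case (snoc x w)
  then show ?case by (cases x) (auto simp: word_snoc intro!: G_mult mp_rodr_G mp_rot_gen_e_tilde)
qed simp

lemma word_frame_rotation: "rotation_matrix (word_frame w)"
proof (induction w rule: rev_induct)
  case (snoc x w)
  then show ?case by (cases x) (simp add: word_snoc rotation_matrix_mult rotation_plane_rot partner_neq_1)
qed (simp add: rotation_matrix_def orthogonal_matrix_id)

lemma word_frame_holonomy:
  assumes w: "w \<noteq> []" "word_ok w" "word_pos w = 1\<^sub>G"
  shows "word_frame w \<in> holonomy \<alpha> \<beta> \<gamma>"
proof -
  define n where "n = length w"
  define k where "k i = fst (w ! i)" for i
  define s where "s i = snd (w ! i)" for i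
  \<comment> \<open>The letter \<open>i\<close> is run on the interval from \<open>i / n\<close> to
    \<open>(i + 1) / n\<close>, so its velocity is multiplied by \<open>n\<close>.\<close>
  define \<theta> where "\<theta> i t = (real n * t - real i) * s i" for i t
  define C where "C i t = word_pos (take i w) \<bullet>\<^sub>G mp_rodr (e_tilde (k i)) (\<theta> i t)" for i t
  define F where "F i t = plane_rot 1 (partner (k i)) (- speed (k i) * \<theta> i t) ** word_frame (take i w)" for i t
  define p where "p i = real i / real n" for i
  have n: "n > 0" using w by (simp add: n_def)
  have k1: "k i \<noteq> 1" if "i < n" for i
    using w(2) that by (auto simp: word_ok_def k_def n_def)
  note gen = mp_rot_gen_e_tilde [OF k1]
  have take_Suc: "take (Suc i) w = take i w @ [(k i, s i)]" if "i < n" for i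
    using that by (simp add: n_def k_def s_def take_Suc_conv_app_nth)
  have start: "C i (p i) = word_pos (take i w)" "F i (p i) = word_frame (take i w)" for i
    using n by (simp_all add: C_def F_def p_def \<theta>_def plane_rot_def)
  have stop: "C i (p (Suc i)) = word_pos (take (Suc i) w)" "F i (p (Suc i)) = word_frame (take (Suc i) w)" if "i < n" for i
    using n by (simp_all add: C_def F_def p_def \<theta>_def take_Suc [OF that] word_snoc)
  have join: "(C i (p (Suc i)), F i (p (Suc i))) = (C (Suc i) (p (Suc i)), F (Suc i) (p (Suc i)))" if "Suc i < n" for i
    using that by (simp add: start stop)
  have "\<exists>f. \<forall>i<n. \<forall>t\<in>{p i..p (Suc i)}. f t = (C i t, F i t)"
    by (rule glue_segments [OF n, of "\<lambda>i t. (C i t, F i t)", folded p_def, OF join]) blast+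
  then obtain f where "\<forall>i<n. \<forall>t\<in>{p i..p (Suc i)}. f t = (C i t, F i t)" ..
  then have f: "f t = (C i t, F i t)" if "i < n" "t \<in> {p i..p (Suc i)}" for i t
    using that by blast
  define c where "c t = fst (f t)" for t
  define Q where "Q t = snd (f t)" for t
  have c: "c t = C i t" and Q: "Q t = F i t" if "i < n" "t \<in> {p i..p (Suc i)}" for i t
    using f [OF that] by (simp_all add: c_def Q_def)
  have part: "partition01 n p"
    using n by (auto simp: partition01_def p_def divide_strict_right_mono)
  have okt: "word_ok (take i w)" for i
    using w(2) by (auto simp: word_ok_def dest: in_set_takeD)
  have CG: "C i t \<in> G_grp" if "i < n" for i t
    unfolding C_def by (intro G_mult word_G okt mp_rodr_G gen that)
  have cG: "c ` {0..1} \<subseteq> G_grp"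
  proof (rule image_subsetI)
    fix t :: real assume "t \<in> {0..1}"
    from partition_cover [OF part this] obtain i where "i < n" "t \<in> {p i..p (Suc i)}" by blast
    then show "c t \<in> G_grp" using CG [of i t] by (simp only: c)
  qed
  define X where "X i = (real n * s i) *\<^sub>R e_tilde (k i)" for i
  have C_deriv: "(C i has_vector_derivative C i t \<bullet>\<^sub>G X i) (at t within T)" if "i < n" for i t T
    using bounded_linear.has_vector_derivative [OF mp.bounded_linear_right mp_rodr_affine_deriv [OF gen [OF that]]]
    unfolding C_def [abs_def] \<theta>_def X_def by (simp add: mp_assoc mp.scaleR_right)
  have c_deriv: "(c has_vector_derivative c t \<bullet>\<^sub>G X i) (at t within {p i..p (Suc i)})" if "i < n" "t \<in> {p i..p (Suc i)}" for i t
    unfolding c [OF that] by (rule has_vector_derivative_transform [OF that(2) c [OF that(1)] C_deriv [OF that(1)]])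
  have C1: "C1_on (p i) (p (Suc i)) c" if i: "i < n" for i
    unfolding C1_on_def
  proof (intro exI conjI ballI)
    show "(c has_vector_derivative c t \<bullet>\<^sub>G X i) (at t within {p i..p (Suc i)})" if "t \<in> {p i..p (Suc i)}" for t
      by (rule c_deriv [OF i that])
    have "continuous_on {p i..p (Suc i)} c"
      unfolding continuous_on_eq_continuous_within using has_vector_derivative_continuous [OF c_deriv [OF i]] by blast
    then show "continuous_on {p i..p (Suc i)} (\<lambda>t. c t \<bullet>\<^sub>G X i)"
      by (intro mp.continuous_on continuous_on_const)
  qed
  have c01: "c 0 = 1\<^sub>G" "c 1 = 1\<^sub>G" and Q01: "Q 0 = mat 1" "Q 1 = word_frame w"
  proof -
    obtain m where m: "n = Suc m" using n by (cases n) auto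
    have p01: "p 0 = 0" "p (Suc m) = 1" using n by (simp_all add: p_def m)
    have in0: "p 0 \<in> {p 0..p (Suc 0)}" and in1: "p (Suc m) \<in> {p m..p (Suc m)}"
      by (simp_all add: p_def divide_right_mono)
    have tk: "take (Suc m) w = w" using m n_def by simp
    show "c 0 = 1\<^sub>G" "Q 0 = mat 1"
      using c [OF n in0] Q [OF n in0] start [of 0] p01(1) by simp_all
    show "c 1 = 1\<^sub>G" "Q 1 = word_frame w"
      using c [of m, OF _ in1] Q [of m, OF _ in1] stop [of m] w(3) unfolding tk p01(2) by (simp_all add: m)
  qed
  have loop: "c \<in> lifted_loops"
  proof -
    have "1\<^sub>G \<in> H_grp" unfolding H_grp_eq by (metis h_elem_0 rangeI)
    then show ?thesis unfolding lifted_loops_def using cG c01 part C1 by auto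
  qed
  define v where "v j t = m_vec (diag_isqrt (column j (Q t)))" for j t
  have par: "parallel_on (levi_civita \<alpha> \<beta> \<gamma>) (p i) (p (Suc i)) c (v j)" if i: "i < n" for i j
  proof (rule parallel_onI [OF pos partition_less [OF part i], of _ "\<lambda>_. X i"])
    show "c ` {p i..p (Suc i)} \<subseteq> G_grp" using cG partition_subset [OF part i] by blast
    show "X i \<in> G_alg" by (simp add: X_def subspace_scale subspace_G_alg)
    show "v j t \<in> m_sp" for t by (simp add: v_def)
    fix t assume t: "t \<in> {p i..p (Suc i)}"
    show "(c has_vector_derivative c t \<bullet>\<^sub>G X i) (at t within {p i..p (Suc i)})" by (rule c_deriv [OF i t])
    let ?P = "plane_gen 1 (partner (k i))" and ?l = "- speed (k i) * (real n * s i)"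
    have F': "(F i has_vector_derivative ?l *\<^sub>R (?P ** F i t)) (at t within {p i..p (Suc i)})"
      using bounded_linear.has_vector_derivative [OF mat_mult.bounded_linear_left [of "word_frame (take i w)"]
          plane_rot_affine_deriv [OF partner_neq_1 [of "k i"], of "- speed (k i)" "real n" "real i" "s i" t]]
      unfolding F_def [abs_def] \<theta>_def by (simp add: matrix_mul_assoc mat_mult.scaleR_left mat_mult.minus_left)
    have "(Q has_vector_derivative ?l *\<^sub>R (?P ** Q t)) (at t within {p i..p (Suc i)})"
      unfolding Q [OF i t] by (rule has_vector_derivative_transform [OF t Q [OF i] F'])
    moreover have "bounded_linear (\<lambda>Q. m_vec (diag_isqrt (column j Q)))"
      unfolding linear_conv_bounded_linear [symmetric]
      by (intro linear_compose [OF _ linear_m_vec, unfolded o_def] linear_compose [OF _ linear_diag_isqrt, unfolded o_def] linearI)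
        (simp_all add: column_def vec_eq_iff)
    ultimately have "(v j has_vector_derivative m_vec (diag_isqrt (column j (?l *\<^sub>R (?P ** Q t))))) (at t within {p i..p (Suc i)})"
      unfolding v_def [abs_def] by (rule bounded_linear.has_vector_derivative [rotated])
    moreover have "m_vec (diag_isqrt (column j (?l *\<^sub>R (?P ** Q t)))) =
      - m_vec (transp (\<alpha> / (5 * \<beta>)) (\<alpha> / (10 * \<gamma>)) (X i) (m_coord (v j t)))"
    proof -
      have "transp (\<alpha> / (5 * \<beta>)) (\<alpha> / (10 * \<gamma>)) (X i) (m_coord (v j t)) =
        (real n * s i) *\<^sub>R nomizu (\<alpha> / (5 * \<beta>)) (\<alpha> / (10 * \<gamma>)) (axis (k i) 1) (diag_isqrt (column j (Q t)))"
        by (simp add: transp_def X_def v_def linear_scale [OF linear_m_coord] linear_scale [OF linear_h_coord] m_coord_e_tilde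
            nomizu.scaleR_left) (simp add: m_vec_axis [symmetric])
      \<comment> \<open>Passing to orthonormal coordinates and back exposes the Nomizu matrix as a
        multiple of the plane generator.\<close>
      also have "\<dots> = diag_isqrt (dsqrt \<dots>)" by (rule diag_sqrt_isqrt(2) [symmetric])
      also have "\<dots> = diag_isqrt ((real n * s i) *\<^sub>R speed (k i) *\<^sub>R (?P *v column j (Q t)))"
        unfolding linear_scale [OF linear_diag_sqrt] diag_sqrt_nomizu [OF k1 [OF i]] diag_sqrt_isqrt(1) ..
      also have "?P *v column j (Q t) = column j (?P ** Q t)"
        by (simp add: vec_eq_iff column_def matrix_vector_mult_def matrix_matrix_mult_def)
      also have "(real n * s i) *\<^sub>R speed (k i) *\<^sub>R column j (?P ** Q t) = - column j (?l *\<^sub>R (?P ** Q t))"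
        by (simp add: vec_eq_iff column_def)
      finally show ?thesis
        by (simp add: linear_neg [OF linear_diag_isqrt] linear_neg [OF linear_m_vec])
    qed
    ultimately show "(v j has_vector_derivative - m_vec (transp (\<alpha> / (5 * \<beta>)) (\<alpha> / (10 * \<gamma>)) (X i) (m_coord (v j t)))) (at t within {p i..p (Suc i)})"
      by simp
  qed
  have along: "parallel_along (levi_civita \<alpha> \<beta> \<gamma>) c (v j)" for j
    unfolding parallel_along_def using part C1 par by blast
  have v0: "v j 0 = e_orth \<alpha> \<beta> \<gamma> j" for j
  proof -
    have "column j (mat 1) = (axis j 1 :: real^5)" by (simp add: vec_eq_iff column_def mat_def axis_def)
    moreover have "diag_isqrt (axis j 1) = (1 / sqrt (metric_diag \<alpha> \<beta> \<gamma> j)) *\<^sub>R axis j 1"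
      by (simp add: vec_eq_iff diag_isqrt_def axis_def)
    ultimately show ?thesis by (simp add: v_def Q01 e_orth_eq [OF pos])
  qed
  have "Ad 1\<^sub>G Y = Y" for Y
    by (simp add: Ad_def mp_inv_G mp_transp_def) (simp add: mp_one_def mp_mult_def)
  then have "word_frame w $ i $ j = metric \<alpha> \<beta> \<gamma> (Ad (c 1) (v j 1)) (e_orth \<alpha> \<beta> \<gamma> i)" for i j
    unfolding c01 v_def Q01 by (simp add: metric_e_orth [OF pos] diag_sqrt_isqrt(1) column_def)
  then show ?thesis
    unfolding holonomy_def using loop along v0 by blast
qed

text \<open>The half turn reverses the \<open>i\<close>-axis and fixes the \<open>l\<close>-axis,
  hence it reverses the orientation of the plane they span.\<close>

lemma plane_rot_pi_conj:
  assumes "i \<noteq> j" "i \<noteq> l" "j \<noteq> l"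
  shows "plane_rot i j pi ** (plane_rot i l t ** plane_rot i j (- pi)) = plane_rot i l (- t)"
  using assms by (simp add: matrix_eq matrix_vector_mul_assoc [symmetric] vec_eq_iff plane_rot_vec)

text \<open>The flows of \<open>e_tilde k\<close> and \<open>e_tilde k'\<close> from different factors of \<open>G\<close> commute, so that their
  commutators are loops; the corresponding commutators of plane rotations are non-trivial.\<close>

lemma pencil_in_holonomy:
  assumes k: "k \<noteq> 1"
  shows "\<exists>w. w \<noteq> [] \<and> word_ok w \<and> word_pos w = 1\<^sub>G \<and> word_frame w = plane_rot 1 (partner k) t"
proof -
  \<comment> \<open>An auxiliary direction in the other factor of \<open>G\<close>, whose plane
    meets that of \<open>k\<close> only in the line of \<open>e_1\<close>.\<close>
  define k' :: 5 where "k' = (if k = 2 \<or> k = 3 then 4 else 2)"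
  have k': "k' \<noteq> 1" "partner k \<noteq> partner k'"
    using k by (cases k rule: exhaust_5; simp add: k'_def partner_def)+
  define s where "s = t / (2 * speed k)"
  define r where "r = pi / speed k'"
  define w where "w = [(k', r), (k, s), (k', - r), (k, - s)]"
  have sp: "speed k * s = t / 2" "speed k' * r = pi"
    using speed_nonzero [of k] speed_nonzero [of k'] by (simp_all add: s_def r_def)
  let ?g = "mp_rodr (e_tilde k) s" and ?h = "mp_rodr (e_tilde k') r"
  have comm: "?h \<bullet>\<^sub>G ?g = ?g \<bullet>\<^sub>G ?h"
    using k by (cases k rule: exhaust_5) (simp_all add: k'_def e_tilde_def a_vec_def b_vec_def mp_rodr_def mp_mult_def)
  have inv: "?g \<bullet>\<^sub>G mp_rodr (e_tilde k) (- s) = 1\<^sub>G" "?h \<bullet>\<^sub>G mp_rodr (e_tilde k') (- r) = 1\<^sub>G"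
    using mp_rodr_add [OF mp_rot_gen_e_tilde [OF k], of s "- s"] mp_rodr_add [OF mp_rot_gen_e_tilde [OF k'(1)], of r "- r"] by simp_all
  have "word_pos w = ?h \<bullet>\<^sub>G ?g \<bullet>\<^sub>G mp_rodr (e_tilde k') (- r) \<bullet>\<^sub>G mp_rodr (e_tilde k) (- s)"
    by (simp add: w_def word_pos_def)
  also have "\<dots> = ?g \<bullet>\<^sub>G (?h \<bullet>\<^sub>G mp_rodr (e_tilde k') (- r)) \<bullet>\<^sub>G mp_rodr (e_tilde k) (- s)"
    unfolding comm by (simp only: mp_assoc)
  finally have "word_pos w = 1\<^sub>G" by (simp add: inv)
  moreover have "word_frame w = plane_rot 1 (partner k) t"
  proof -
    have "word_frame w = plane_rot 1 (partner k) (t / 2) ** (plane_rot 1 (partner k') pi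
      ** (plane_rot 1 (partner k) (- (t / 2)) ** plane_rot 1 (partner k') (- pi)))"
      by (simp add: w_def word_frame_def sp)
    also have "\<dots> = plane_rot 1 (partner k) (t / 2) ** plane_rot 1 (partner k) (t / 2)"
      using plane_rot_pi_conj [OF partner_neq_1 [of k'] partner_neq_1 [of k] k'(2) [symmetric], of "- (t / 2)"] by simp
    also have "\<dots> = plane_rot 1 (partner k) t"
      unfolding plane_rot_def by (simp add: rodr_add [OF rot_gen_plane_gen [OF partner_neq_1], symmetric])
    finally show ?thesis .
  qed
  moreover have "w \<noteq> []" "word_ok w" using k k' by (simp_all add: w_def word_ok_def)
  ultimately show ?thesis by blast
qed

text \<open>Closure under products is needed only for the frames of closed words, where it is
  concatenation, and not for the parallel transport of arbitrary loops.\<close>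

lemma rotation_holonomy:
  assumes A: "rotation_matrix A" shows "A \<in> holonomy \<alpha> \<beta> \<gamma>"
proof -
  define P where "P = {word_frame w |w. w \<noteq> [] \<and> word_ok w \<and> word_pos w = 1\<^sub>G}"
  have "A \<in> P"
  proof (rule pencil_rotations_generate [where k = 1, OF _ _ _ _ A])
    show "rotation_matrix B" if "B \<in> P" for B
      using that word_frame_rotation by (auto simp: P_def)
    show "mat 1 \<in> P"
      unfolding P_def
      \<comment> \<open>A non-empty word with trivial effect is used, since the unit interval is
        divided into as many pieces as the word has letters.\<close>
      by (rule CollectI, rule exI [of _ "[(2, 0)]"]) (simp add: word_ok_def word_pos_def word_frame_def plane_rot_def)
    show "B ** C \<in> P" if "B \<in> P" "C \<in> P" for B C
    proof -
      from that(1) obtain u where "B = word_frame u" "u \<noteq> []" "word_ok u" "word_pos u = 1\<^sub>G"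
        by (auto simp: P_def)
      moreover from that(2) obtain w where "C = word_frame w" "w \<noteq> []" "word_ok w" "word_pos w = 1\<^sub>G"
        by (auto simp: P_def)
      ultimately show ?thesis
        \<comment> \<open>The order is reversed because frames multiply opposite to
          concatenation.\<close>
        unfolding P_def by (intro CollectI exI [of _ "w @ u"]) (auto simp: word_append word_ok_def)
    qed
    show "plane_rot 1 j t \<in> P" if "1 \<noteq> j" for j t
    proof -
      have j: "partner j \<noteq> 1" "partner (partner j) = j"
        using that by (cases j rule: exhaust_5; simp add: partner_def)+
      from pencil_in_holonomy [OF j(1), of t] obtain w where
        "w \<noteq> []" "word_ok w" "word_pos w = 1\<^sub>G" "word_frame w = plane_rot 1 j t"
        unfolding j(2) by (elim exE conjE)
      then show ?thesis unfolding P_def by (intro CollectI exI [of _ w]) simp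
    qed
  qed
  then show ?thesis using word_frame_holonomy by (auto simp: P_def)
qed

end

theorem theorem4p2:
  shows
    "(\<forall>\<alpha> \<beta> \<gamma> :: real. \<alpha> > 0 \<and> \<beta> > 0 \<and> \<gamma> > 0 \<longrightarrow>
       (\<forall>g\<in>G_grp.
          (let e = e_orth \<alpha> \<beta> \<gamma>; R = (\<lambda>i j. Ric \<alpha> \<beta> \<gamma> g (e i) (e j)) in
            (\<forall>i j. i \<noteq> j \<longrightarrow> R i j = 0) \<and>
            R 1 1 = 2 * \<alpha> / (25 * \<beta>^2) + \<alpha> / (50 * \<gamma>^2) \<and>
            R 2 2 = 1 / \<beta> - 2 * \<alpha> / (25 * \<beta>^2) \<and>
            R 3 3 = 1 / \<beta> - 2 * \<alpha> / (25 * \<beta>^2) \<and>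
            R 4 4 = 1 / \<gamma> - \<alpha> / (50 * \<gamma>^2) \<and>
            R 5 5 = 1 / \<gamma> - \<alpha> / (50 * \<gamma>^2))))
     \<and>
     (\<forall>\<alpha> \<beta> \<gamma> :: real.
        \<alpha> = 1 \<and>
        \<beta> = 18 / (25 * (10 powr (2/3) - 2 * 10 powr (1/3) + 4)) \<and>
        \<gamma> = 3 * (9 + sqrt (21 + 12 * 10 powr (1/3) + 3 * 10 powr (2/3)))
              / (25 * (20 - 4 * 10 powr (1/3) - 10 powr (2/3))) \<longrightarrow>
        \<bar>\<beta> - 0.166177\<bar> < 0.0000005 \<and>
        \<bar>\<gamma> - 0.299009\<bar> < 0.0000005 \<and>
        Einstein \<alpha> \<beta> \<gamma> \<and>
        \<not> naturally_reductive \<alpha> \<beta> \<gamma> \<and>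
        (\<forall>g\<in>G_grp. Scal \<alpha> \<beta> \<gamma> g = (5/3)^3 * (10 - 2 * 10 powr (1/3) - 10 powr (2/3) / 2)) \<and>
        \<bar>(5/3)^3 * (10 - 2 * 10 powr (1/3) - 10 powr (2/3) / 2) - (15.60340835::real)\<bar> < 0.000000005)
     \<and>
     (\<forall>\<alpha> \<beta> \<gamma> :: real. \<alpha> > 0 \<and> \<beta> > 0 \<and> \<gamma> > 0 \<longrightarrow>
        holonomy \<alpha> \<beta> \<gamma> = {A :: real^5^5. rotation_matrix A})"
proof (intro conjI allI impI)
  fix \<alpha> \<beta> \<gamma> :: real assume pos: "\<alpha> > 0 \<and> \<beta> > 0 \<and> \<gamma> > 0"
  then show "\<forall>g\<in>G_grp.
          (let e = e_orth \<alpha> \<beta> \<gamma>; R = (\<lambda>i j. Ric \<alpha> \<beta> \<gamma> g (e i) (e j)) in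
            (\<forall>i j. i \<noteq> j \<longrightarrow> R i j = 0) \<and>
            R 1 1 = 2 * \<alpha> / (25 * \<beta>^2) + \<alpha> / (50 * \<gamma>^2) \<and>
            R 2 2 = 1 / \<beta> - 2 * \<alpha> / (25 * \<beta>^2) \<and>
            R 3 3 = 1 / \<beta> - 2 * \<alpha> / (25 * \<beta>^2) \<and>
            R 4 4 = 1 / \<gamma> - \<alpha> / (50 * \<gamma>^2) \<and>
            R 5 5 = 1 / \<gamma> - \<alpha> / (50 * \<gamma>^2))"
    by (simp add: Let_def Ric_e_orth)
  show "holonomy \<alpha> \<beta> \<gamma> = {A. rotation_matrix A}"
    using holonomy_rotation rotation_holonomy pos by blast
next
  fix \<alpha> \<beta> \<gamma> :: real
  assume *: "\<alpha> = 1 \<and>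
        \<beta> = 18 / (25 * (10 powr (2/3) - 2 * 10 powr (1/3) + 4)) \<and>
        \<gamma> = 3 * (9 + sqrt (21 + 12 * 10 powr (1/3) + 3 * 10 powr (2/3)))
              / (25 * (20 - 4 * 10 powr (1/3) - 10 powr (2/3)))"
  then have \<alpha>: "\<alpha> = 1" by simp
  define S :: real where "S = (5/3)^3 * (10 - 2 * 10 powr (1/3) - 10 powr (2/3) / 2)"
  note vals = Einstein_metric_values [OF * [THEN conjunct2, THEN conjunct1] * [THEN conjunct2, THEN conjunct2], folded S_def]
  show "\<bar>\<beta> - 0.166177\<bar> < 0.0000005" "\<bar>\<gamma> - 0.299009\<bar> < 0.0000005"
    by (rule vals)+
  show "\<bar>(5/3)^3 * (10 - 2 * 10 powr (1/3) - 10 powr (2/3) / 2) - (15.60340835::real)\<bar> < 0.000000005"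
    unfolding S_def [symmetric] by (rule vals)
  have pos: "\<alpha> > 0" "\<beta> > 0" "\<gamma> > 0" using vals(3,4) \<alpha> by simp_all
  have Ric: "Ric \<alpha> \<beta> \<gamma> g y z = (1/5 * S) * metric \<alpha> \<beta> \<gamma> y z" if "g \<in> G_grp" "y \<in> m_sp" "z \<in> m_sp" for g y z
  proof -
    have "Ric \<alpha> \<beta> \<gamma> g y z = (2 / (25 * \<beta>^2) + 1 / (50 * \<gamma>^2)) * (m_coord y $ 1 * m_coord z $ 1)
      + (1 - 2 / (25 * \<beta>)) * (m_coord y $ 2 * m_coord z $ 2 + m_coord y $ 3 * m_coord z $ 3)
      + (1 - 1 / (50 * \<gamma>)) * (m_coord y $ 4 * m_coord z $ 4 + m_coord y $ 5 * m_coord z $ 5)"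
      using Ric_eq [OF pos that] \<alpha> by simp
    also have "\<dots> = (1/5 * S) * metric \<alpha> \<beta> \<gamma> y z"
      unfolding vals(5-7) metric_m_sp [OF that(2,3)] inner5_def \<alpha> by (simp add: algebra_simps)
    finally show ?thesis .
  qed
  then show "Einstein \<alpha> \<beta> \<gamma>" unfolding Einstein_def by blast
  show "\<not> naturally_reductive \<alpha> \<beta> \<gamma>"
    \<comment> \<open>Natural reductivity would force \<open>\<beta> = 1 / 5\<close>, outside the
      numerical enclosure of \<open>\<beta>\<close>.\<close>
    using naturally_reductive_imp [of \<alpha> \<beta> \<gamma>] vals(1) \<alpha> by (auto simp: abs_less_iff)
  show "\<forall>g\<in>G_grp. Scal \<alpha> \<beta> \<gamma> g = (5/3)^3 * (10 - 2 * 10 powr (1/3) - 10 powr (2/3) / 2)"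
  proof
    fix g assume g: "g \<in> G_grp"
    have "metric \<alpha> \<beta> \<gamma> (e_orth \<alpha> \<beta> \<gamma> i) (e_orth \<alpha> \<beta> \<gamma> i) = 1" for i
      using metric_e_orth [OF pos, of "m_coord (e_orth \<alpha> \<beta> \<gamma> i)" i]
      by (simp add: m_coord_e_orth [OF pos]) (simp add: e_orth_eq [OF pos] axis_def)
    then have R: "Ric \<alpha> \<beta> \<gamma> g (e_orth \<alpha> \<beta> \<gamma> i) (e_orth \<alpha> \<beta> \<gamma> i) = 1/5 * S" for i
      using Ric [OF g, of "e_orth \<alpha> \<beta> \<gamma> i" "e_orth \<alpha> \<beta> \<gamma> i"] by (simp add: e_orth_eq [OF pos])
    then show "Scal \<alpha> \<beta> \<gamma> g = (5/3)^3 * (10 - 2 * 10 powr (1/3) - 10 powr (2/3) / 2)"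
      unfolding S_def [symmetric] Scal_def R by (simp add: sum_5)
  qed
qed

end
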